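(* Let $N\ge1$, $d\ge1$. For any $\mathbf{s}\in\mathbb{N}^d$ and $\boldsymbol\eta\in(\Gamma_N)^d$, we have $$\zeta_{\sqcup\!\sqcup}^{\mathcal{S}}\binom{\mathbf{s}}{\boldsymbol\eta}\equiv\zeta_\ast^{\mathcal{S}}\binom{\mathbf{s}}{\boldsymbol\eta}\pmod{\zeta(2)},$$ i.e. the difference of the two sides lies in the ideal $\zeta(2)\,\mathcal{Z}_N$ of $\mathcal{Z}_N$, where $\mathcal{Z}_N\subset\mathbb{C}$ is the $\mathbb{Q}(\Gamma_N)$-subalgebra generated by all convergent colored multiple zeta values of level $N$.
   Context: $\mathbb{N}$ denotes the positive integers, $\Gamma_N\subset\mathbb{C}$ the group of $N$th roots of unity, $\zeta(2)=\pi^2/6$. Colored multiple zeta values of level $N$: $\zeta\binom{\mathbf{s}}{\boldsymbol\eta}:=\sum_{k_1>\cdots>k_d>0}\frac{\eta_1^{k_1}\cdots\eta_d^{k_d}}{k_1^{s_1}\cdots k_d^{s_d}}$ for $\mathbf{s}\in\mathbb{N}^d$, $\boldsymbol\eta\in\Gamma_N^d$, convergent for $(s_1,\eta_1)\ne(1,1)$ (limit of the partial sums over $k_1\le n$). Words: $\mathfrak{A}_N=\mathbb{Q}\langle x_\eta:\eta\in\Gamma_N\cup\{0\}\rangle$; $\mathfrak{A}_N^1$ is the span of words not ending in $x_0$, freely generated by $y_{m,\mu}:=x_0^{m-1}x_\mu$ ($m\in\mathbb{N},\mu\in\Gamma_N$); $\mathfrak{A}_N^0\subset\mathfrak{A}_N^1$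 is the span of words that moreover do not begin with $x_1$; $1$ is the empty word. The stuffle product $\ast$ on $\mathfrak{A}_N^1$: $1\ast w=w\ast1=w$, $y_{m,\mu}u\ast y_{n,\nu}v=y_{m,\mu}(u\ast y_{n,\nu}v)+y_{n,\nu}(y_{m,\mu}u\ast v)+y_{m+n,\mu\nu}(u\ast v)$. The shuffle product $\sqcup\!\sqcup$ on $\mathfrak{A}_N$: $1\sqcup\!\sqcup w=w\sqcup\!\sqcup1=w$, $au\sqcup\!\sqcup bv=a(u\sqcup\!\sqcup bv)+b(au\sqcup\!\sqcup v)$ for letters $a,b$. Regularization (known facts): the $\mathbb{Q}$-linear maps on $\mathfrak{A}_N^0$ given by $y_{s_1,\eta_1}\cdots y_{s_d,\eta_d}\mapsto\zeta\binom{s_1,\dots,s_d}{\eta_1,\dots,\eta_d}$ and $y_{s_1,\eta_1}\cdots y_{s_d,\eta_d}\mapsto\zeta\binom{s_1,\,s_2,\dots,\,s_d}{\eta_1,\,\eta_2/\eta_1,\dots,\,\eta_d/\eta_{d-1}}$ (and $1\mapsto1$) are algebra homomorphisms $(\mathfrak{A}_N^0,\ast)\to\mathbb{C}$ and $(\mathfrak{A}_N^0,\sqcup\!\sqcup)\to\mathbb{C}$ respectively, and they extend uniquely to algebra homomorphisms $\zeta_\ast(-;T)\colon(\mathfrak{A}_N^1,\ast)\to\mathbb{C}[T]$ with $\zeta_\ast(y_{1,1};T)=T$ and $\zeta_{\sqcup\!\sqcup}(-;T)\colon(\mathfrak{A}_N^1,\sqcup\!\sqcup)\to\mathbb{C}[T]$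 with $\zeta_{\sqcup\!\sqcup}(x_1;T)=T$. For arbitrary $\mathbf{s},\boldsymbol\eta$ put $\zeta_\ast\big(\begin{smallmatrix}\mathbf{s}\\ \boldsymbol\eta\end{smallmatrix}\big|T\big):=\zeta_\ast(y_{s_1,\eta_1}\cdots y_{s_d,\eta_d};T)$ and $\zeta_{\sqcup\!\sqcup}\big(\begin{smallmatrix}\mathbf{s}\\ \boldsymbol\eta\end{smallmatrix}\big|T\big):=\zeta_{\sqcup\!\sqcup}(y_{s_1,\eta_1}y_{s_2,\eta_1\eta_2}\cdots y_{s_d,\eta_1\cdots\eta_d};T)$ (value $1$ for $d=0$). Symmetrized colored multiple zeta values: for $\sharp\in\{\ast,\sqcup\!\sqcup\}$, $$\zeta_\sharp^{\mathcal{S}}\binom{\mathbf{s}}{\boldsymbol\eta}:=\sum_{j=0}^d(-1)^{s_1+\cdots+s_j}\,\overline{\eta_1}\cdots\overline{\eta_j}\;\zeta_\sharp\Big(\begin{smallmatrix}s_j,\dots,s_1\\ \overline{\eta_j},\dots,\overline{\eta_1}\end{smallmatrix}\Big|T\Big)\,\zeta_\sharp\Big(\begin{smallmatrix}s_{j+1},\dots,s_d\\ \eta_{j+1},\dots,\eta_d\end{smallmatrix}\Big|T\Big),$$ which is known to be independent of $T$ (a complex number). *)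

theory Defs
  imports
    Complex_Main
    "HOL-Library.Poly_Mapping"
    "HOL-Computational_Algebra.Polynomial"
begin

definition roots_unity :: "nat \<Rightarrow> complex set" where
  "roots_unity N = {z. z ^ N = 1}"

(* A pair of lists s, e stands for the index (s_1, ..., s_d; eta_1, ..., eta_d). *)
definition cmzv_index :: "nat \<Rightarrow> nat list \<Rightarrow> complex list \<Rightarrow> bool" where
  "cmzv_index N s e \<longleftrightarrow> length s = length e \<and> (\<forall>m\<in>set s. m \<ge> 1) \<and> set e \<subseteq> roots_unity N"

definition convergent_index :: "nat \<Rightarrow> nat list \<Rightarrow> complex list \<Rightarrow> bool" where
  "convergent_index N s e \<longleftrightarrow> cmzv_index N s e \<and> (s = [] \<or> (hd s, hd e) \<noteq> (1, 1))"

definition cmzv_partial :: "nat \<Rightarrow> nat list \<Rightarrow> complex list \<Rightarrow> complex" where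
  "cmzv_partial n s e =
     (\<Sum>k | length k = length s \<and> sorted_wrt (>) k \<and> set k \<subseteq> {1..n}.
        \<Prod>i<length s. (e ! i) ^ (k ! i) / of_nat (k ! i) ^ (s ! i))"

definition cmzv :: "nat list \<Rightarrow> complex list \<Rightarrow> complex" where
  "cmzv s e = lim (\<lambda>n. cmzv_partial n s e)"

(* Noncommutative polynomials over the rationals: finitely supported functions on words. *)
type_synonym 'a ncpoly = "'a list \<Rightarrow>\<^sub>0 rat"

definition word_poly :: "'a list \<Rightarrow> 'a ncpoly" where
  "word_poly w = Poly_Mapping.single w 1"

definition nc_scale :: "rat \<Rightarrow> 'a ncpoly \<Rightarrow> 'a ncpoly" where
  "nc_scale c p = Poly_Mapping.map ((*) c) p"

definition letter_mult :: "'a \<Rightarrow> 'a ncpoly \<Rightarrow> 'a ncpoly" where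
  "letter_mult a p =
     (\<Sum>w\<in>Poly_Mapping.keys p. Poly_Mapping.single (a # w) (Poly_Mapping.lookup p w))"

definition bilinear_ext ::
  "('a list \<Rightarrow> 'a list \<Rightarrow> 'a ncpoly) \<Rightarrow> 'a ncpoly \<Rightarrow> 'a ncpoly \<Rightarrow> 'a ncpoly" where
  "bilinear_ext B p q =
     (\<Sum>u\<in>Poly_Mapping.keys p. \<Sum>v\<in>Poly_Mapping.keys q.
        nc_scale (Poly_Mapping.lookup p u * Poly_Mapping.lookup q v) (B u v))"

(* The letter x_a is the complex number a, for a a root of unity or 0. *)
type_synonym xletter = complex

(* The letter y_{m,mu} is the pair (m, mu). *)
type_synonym yletter = "nat \<times> complex"

fun shuffle_words :: "xletter list \<Rightarrow> xletter list \<Rightarrow> xletter ncpoly" where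
  "shuffle_words [] v = word_poly v"
| "shuffle_words u [] = word_poly u"
| "shuffle_words (a # u) (b # v) =
     letter_mult a (shuffle_words u (b # v)) + letter_mult b (shuffle_words (a # u) v)"

definition shuffle_prod :: "xletter ncpoly \<Rightarrow> xletter ncpoly \<Rightarrow> xletter ncpoly" where
  "shuffle_prod = bilinear_ext shuffle_words"

fun stuffle_words :: "yletter list \<Rightarrow> yletter list \<Rightarrow> yletter ncpoly" where
  "stuffle_words [] v = word_poly v"
| "stuffle_words u [] = word_poly u"
| "stuffle_words ((m, \<mu>) # u) ((n, \<nu>) # v) =
     letter_mult (m, \<mu>) (stuffle_words u ((n, \<nu>) # v))
     + letter_mult (n, \<nu>) (stuffle_words ((m, \<mu>) # u) v)
     + letter_mult (m + n, \<mu> * \<nu>) (stuffle_words u v)"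

definition stuffle_prod :: "yletter ncpoly \<Rightarrow> yletter ncpoly \<Rightarrow> yletter ncpoly" where
  "stuffle_prod = bilinear_ext stuffle_words"

(* The span of the words not ending in x_0, once inside the free algebra on the x_a and once
   as the free algebra on the letters y_{m,mu} = x_0^(m-1) x_mu. The word
   y_{s_1,e_1} ... y_{s_d,e_d} is zip s e in the second form and xword s e in the first. *)
definition A1x :: "nat \<Rightarrow> xletter ncpoly set" where
  "A1x N = {p. \<forall>w\<in>Poly_Mapping.keys p. set w \<subseteq> insert 0 (roots_unity N) \<and> (w = [] \<or> last w \<noteq> 0)}"

definition A1y :: "nat \<Rightarrow> yletter ncpoly set" where
  "A1y N = {p. \<forall>w\<in>Poly_Mapping.keys p. set w \<subseteq> {1..} \<times> roots_unity N}"

definition xword :: "nat list \<Rightarrow> complex list \<Rightarrow> xletter list" where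
  "xword s e = concat (map2 (\<lambda>m \<mu>. replicate (m - 1) 0 @ [\<mu>]) s e)"

definition successive_quotients :: "complex list \<Rightarrow> complex list" where
  "successive_quotients e =
     map (\<lambda>i. if i = 0 then e ! 0 else e ! i / e ! (i - 1)) [0..<length e]"

definition partial_products :: "complex list \<Rightarrow> complex list" where
  "partial_products e = map (\<lambda>i. \<Prod>j\<le>i. e ! j) [0..<length e]"

definition algebra_hom_on ::
  "'a ncpoly set \<Rightarrow> ('a ncpoly \<Rightarrow> 'a ncpoly \<Rightarrow> 'a ncpoly) \<Rightarrow> ('a ncpoly \<Rightarrow> complex poly) \<Rightarrow> bool"
where
  "algebra_hom_on A M f \<longleftrightarrow>
     (\<forall>p\<in>A. \<forall>q\<in>A. f (p + q) = f p + f q) \<and>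
     (\<forall>c. \<forall>p\<in>A. f (nc_scale c p) = smult (of_rat c) (f p)) \<and>
     f (word_poly []) = 1 \<and>
     (\<forall>p\<in>A. \<forall>q\<in>A. f (M p q) = f p * f q)"

(* The words with convergent index are exactly the words of A^1 not beginning with x_1, so by
   linearity the second condition in each of the next two definitions prescribes the map on
   all of A^0. *)
definition stuffle_regularization :: "nat \<Rightarrow> (yletter ncpoly \<Rightarrow> complex poly) \<Rightarrow> bool" where
  "stuffle_regularization N f \<longleftrightarrow>
     algebra_hom_on (A1y N) stuffle_prod f \<and>
     (\<forall>s e. convergent_index N s e \<longrightarrow> f (word_poly (zip s e)) = [:cmzv s e:]) \<and>
     f (word_poly [(1, 1)]) = [:0, 1:]"

definition shuffle_regularization :: "nat \<Rightarrow> (xletter ncpoly \<Rightarrow> complex poly) \<Rightarrow> bool" where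
  "shuffle_regularization N f \<longleftrightarrow>
     algebra_hom_on (A1x N) shuffle_prod f \<and>
     (\<forall>s e. convergent_index N s e \<longrightarrow>
        f (word_poly (xword s e)) = [:cmzv s (successive_quotients e):]) \<and>
     f (word_poly [1]) = [:0, 1:]"

(* SOME rather than THE: the regularization is unique on A^1 only, its values elsewhere are
   unconstrained and never used. *)
definition stuffle_reg_map :: "nat \<Rightarrow> yletter ncpoly \<Rightarrow> complex poly" where
  "stuffle_reg_map N = (SOME f. stuffle_regularization N f)"

definition shuffle_reg_map :: "nat \<Rightarrow> xletter ncpoly \<Rightarrow> complex poly" where
  "shuffle_reg_map N = (SOME f. shuffle_regularization N f)"

definition zeta_stuffle :: "nat \<Rightarrow> nat list \<Rightarrow> complex list \<Rightarrow> complex poly" where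
  "zeta_stuffle N s e = stuffle_reg_map N (word_poly (zip s e))"

definition zeta_shuffle :: "nat \<Rightarrow> nat list \<Rightarrow> complex list \<Rightarrow> complex poly" where
  "zeta_shuffle N s e = shuffle_reg_map N (word_poly (xword s (partial_products e)))"

definition symmetrized_poly ::
  "(nat list \<Rightarrow> complex list \<Rightarrow> complex poly) \<Rightarrow> nat list \<Rightarrow> complex list \<Rightarrow> complex poly" where
  "symmetrized_poly Z s e =
     (\<Sum>j\<le>length s.
        smult ((-1) ^ sum_list (take j s) * prod_list (map cnj (take j e)))
          (Z (rev (take j s)) (rev (map cnj (take j e))) * Z (drop j s) (drop j e)))"

(* The symmetrized polynomial is independent of T; its value is the number c. *)
definition symmetrized ::
  "(nat list \<Rightarrow> complex list \<Rightarrow> complex poly) \<Rightarrow> nat list \<Rightarrow> complex list \<Rightarrow> complex" where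
  "symmetrized Z s e = (THE c. symmetrized_poly Z s e = [:c:])"

definition zetaS_stuffle :: "nat \<Rightarrow> nat list \<Rightarrow> complex list \<Rightarrow> complex" where
  "zetaS_stuffle N = symmetrized (zeta_stuffle N)"

definition zetaS_shuffle :: "nat \<Rightarrow> nat list \<Rightarrow> complex list \<Rightarrow> complex" where
  "zetaS_shuffle N = symmetrized (zeta_shuffle N)"

(* The subfield of the complex numbers generated by the N-th roots of unity; it contains
   0 = 1 - 1 and hence the rationals. *)
inductive_set cyclotomic_field :: "nat \<Rightarrow> complex set" for N :: nat where
  root: "z \<in> roots_unity N \<Longrightarrow> z \<in> cyclotomic_field N"
| diff: "x \<in> cyclotomic_field N \<Longrightarrow> y \<in> cyclotomic_field N \<Longrightarrow> x - y \<in> cyclotomic_field N"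
| mult: "x \<in> cyclotomic_field N \<Longrightarrow> y \<in> cyclotomic_field N \<Longrightarrow> x * y \<in> cyclotomic_field N"
| inverse: "x \<in> cyclotomic_field N \<Longrightarrow> inverse x \<in> cyclotomic_field N"

inductive_set cmzv_algebra :: "nat \<Rightarrow> complex set" for N :: nat where
  scalar: "c \<in> cyclotomic_field N \<Longrightarrow> c \<in> cmzv_algebra N"
| zeta_value: "convergent_index N s e \<Longrightarrow> cmzv s e \<in> cmzv_algebra N"
| add: "x \<in> cmzv_algebra N \<Longrightarrow> y \<in> cmzv_algebra N \<Longrightarrow> x + y \<in> cmzv_algebra N"
| mult: "x \<in> cmzv_algebra N \<Longrightarrow> y \<in> cmzv_algebra N \<Longrightarrow> x * y \<in> cmzv_algebra N"

definition zeta2_ideal :: "nat \<Rightarrow> complex set" where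
  "zeta2_ideal N = {of_real (pi\<^sup>2 / 6) * z | z. z \<in> cmzv_algebra N}"

end

theory Submission
  imports Defs "HOL-Analysis.Analysis"
begin

text \<open>
  Write \<open>y\<close> for the letter \<open>(1, 1)\<close>. Splitting the leading letters \<open>y\<close> off a word \<open>w\<close> gives constants
  \<open>reg_const\<close> such that the truncated sums satisfy
  \<open>hsum w n = (\<Sum>i\<le>lead w. reg_const (drop i w) * hsum y\<^sup>i n) + O(1 / sqrt n)\<close>.
  Truncated sums multiply by the stuffle product, and \<open>hsum y\<^sup>i n\<close> is a polynomial \<open>p\<^sub>i\<close> in the harmonic
  number \<open>hsum y n\<close> up to a negligible error; so the stuffle regularization of \<open>w\<close> is
  \<open>\<Sum>i. reg_const (drop i w) * p\<^sub>i\<close>. The polylogarithm of \<open>w\<close> is \<open>(1 - z)\<close> times the generating function of \<open>hsum w\<close>,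
  polylogarithms multiply by the shuffle product, and the one of \<open>y\<^sup>i\<close> is \<open>L\<^sup>i / i!\<close> with
  \<open>L = - ln (1 - z)\<close>; so as \<open>z\<close> tends to 1 the same constants give the shuffle regularization
  \<open>\<Sum>i. reg_const (drop i w) * T\<^sup>i / i!\<close>.
  In the symmetrized sums everything cancels except the alternating convolutions
  \<open>\<Sum>i\<le>r. (-1)\<^sup>i p\<^sub>i p\<^bsub>r-i\<^esub>\<close>. For \<open>p\<^sub>i = T\<^sup>i / i!\<close> they vanish when \<open>r > 0\<close>; in the stuffle case they are the
  limits of the coefficients of \<open>\<Prod>k\<le>n. 1 - u\<^sup>2 / k\<^sup>2\<close>, i.e. the coefficients of \<open>sin (\<pi> u) / (\<pi> u)\<close>,
  which are rational multiples of powers of \<open>\<zeta>(2)\<close>.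
\<close>

section \<open>Linear functionals and regularizations\<close>

text \<open>Both regularization maps are introduced by choice, so a regularization has to be
  exhibited first. One principle exhibits both: functionals that are multiplicative for the product,
  and whose value on each word is a polynomial in a divergent quantity \<open>h\<close> up to an
  error, define a homomorphism into polynomials. The errors get multiplied by polynomials in
  \<open>h\<close> and must beat all of them, hence \<open>rapid_null\<close>. Uniqueness, from
  solving the product with a single divergent letter for the word with the longest leading run,
  transfers the result to the chosen maps. The rate 1 / sqrt n is a matter of convenience: a bound
  of every truncated sum by a multiple of sqrt n reproduces itself when a letter is prefixed, which
  spares the bookkeeping of powers of logarithms, and the 1 / sqrt n that results is still
  exponentially small in \<open>h\<close>. The constants come from the truncated sums, before any
  regularization is formed. So both expansions share them, and the comparison concerns only the two
  families of polynomials attached to powers of \<open>y\<close>.\<close>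

lemma lookup_nc_scale [simp]: "Poly_Mapping.lookup (nc_scale c p) w = c * Poly_Mapping.lookup p w"
  unfolding nc_scale_def by (transfer) (auto simp: when_def)

lemma keys_nc_scale: "Poly_Mapping.keys (nc_scale c p) \<subseteq> Poly_Mapping.keys p"
  by (auto simp: in_keys_iff)

lemma lookup_word_poly [simp]: "Poly_Mapping.lookup (word_poly u) w = (if u = w then 1 else 0)"
  by (simp add: word_poly_def lookup_single)

lemma keys_word_poly [simp]: "Poly_Mapping.keys (word_poly u) = {u}"
  by (simp add: word_poly_def)

lemma keys_letter_mult: "Poly_Mapping.keys (letter_mult a p) \<subseteq> (#) a ` Poly_Mapping.keys p"
  unfolding letter_mult_def by (rule order_trans[OF Poly_Mapping.keys_sum]) auto

lemma nc_expand:
  "p = (\<Sum>w\<in>Poly_Mapping.keys p. nc_scale (Poly_Mapping.lookup p w) (word_poly w))"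
  by (rule poly_mapping_eqI) (auto simp: lookup_sum in_keys_iff if_distrib cong: if_cong)

definition lin_ext :: "('a list \<Rightarrow> complex) \<Rightarrow> 'a ncpoly \<Rightarrow> complex" where
  "lin_ext \<phi> p = (\<Sum>w\<in>Poly_Mapping.keys p. of_rat (Poly_Mapping.lookup p w) * \<phi> w)"

lemma lin_ext_superset:
  assumes "finite S" "Poly_Mapping.keys p \<subseteq> S"
  shows "lin_ext \<phi> p = (\<Sum>w\<in>S. of_rat (Poly_Mapping.lookup p w) * \<phi> w)"
  unfolding lin_ext_def by (rule sum.mono_neutral_left) (use assms in \<open>auto simp: in_keys_iff\<close>)

lemma lin_ext_add: "lin_ext \<phi> (p + q) = lin_ext \<phi> p + lin_ext \<phi> q"
proof -
  let ?S = "Poly_Mapping.keys p \<union> Poly_Mapping.keys q"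
  have "lin_ext \<phi> r = (\<Sum>w\<in>?S. of_rat (Poly_Mapping.lookup r w) * \<phi> w)" if "r \<in> {p, q, p + q}" for r
    using that Poly_Mapping.keys_add[of p q] by (intro lin_ext_superset) auto
  then show ?thesis
    by (simp add: lookup_add of_rat_add algebra_simps sum.distrib)
qed

lemma lin_ext_zero [simp]: "lin_ext \<phi> 0 = 0"
  by (simp add: lin_ext_def)

lemma lin_ext_sum: "lin_ext \<phi> (\<Sum>i\<in>I. p i) = (\<Sum>i\<in>I. lin_ext \<phi> (p i))"
  by (induction I rule: infinite_finite_induct) (auto simp: lin_ext_add)

lemma lin_ext_nc_scale: "lin_ext \<phi> (nc_scale c p) = of_rat c * lin_ext \<phi> p"
  using lin_ext_superset[OF finite_keys keys_nc_scale, of \<phi> c p]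
  by (simp add: lin_ext_def of_rat_mult sum_distrib_left mult.assoc)

lemma lin_ext_word_poly [simp]: "lin_ext \<phi> (word_poly w) = \<phi> w"
  by (simp add: lin_ext_def)

lemma lin_ext_letter_mult: "lin_ext \<phi> (letter_mult a p) = lin_ext (\<lambda>w. \<phi> (a # w)) p"
  unfolding letter_mult_def lin_ext_sum by (subst (2) lin_ext_def) (auto simp: lin_ext_def in_keys_iff intro!: sum.cong)

lemma lin_ext_plus_fun: "lin_ext (\<lambda>w. \<phi> w + \<psi> w) p = lin_ext \<phi> p + lin_ext \<psi> p"
  by (simp add: lin_ext_def algebra_simps sum.distrib)

lemma lin_ext_scale_fun: "lin_ext (\<lambda>w. c * \<phi> w) p = c * lin_ext \<phi> p"
  by (simp add: lin_ext_def sum_distrib_left algebra_simps)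

lemma lin_ext_sum_fun: "lin_ext (\<lambda>w. \<Sum>i\<in>I. \<phi> i w) p = (\<Sum>i\<in>I. lin_ext (\<phi> i) p)"
  unfolding lin_ext_def by (subst sum.swap) (simp add: sum_distrib_left)

lemma lin_ext_bilinear_ext:
  assumes "\<And>u v. u \<in> Poly_Mapping.keys p \<Longrightarrow> v \<in> Poly_Mapping.keys q \<Longrightarrow> lin_ext \<phi> (B u v) = \<phi> u * \<phi> v"
  shows "lin_ext \<phi> (bilinear_ext B p q) = lin_ext \<phi> p * lin_ext \<phi> q"
  unfolding bilinear_ext_def lin_ext_sum lin_ext_nc_scale
  by (simp add: assms lin_ext_def[of _ p] lin_ext_def[of _ q] sum_product of_rat_mult mult.assoc mult.left_commute)

lemma bilinear_ext_word_poly [simp]: "bilinear_ext B (word_poly u) (word_poly v) = B u v"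
  by (simp add: bilinear_ext_def, rule poly_mapping_eqI, simp)

section \<open>Recursion on the number of leading copies of a letter\<close>

definition lead :: "'a \<Rightarrow> 'a list \<Rightarrow> nat" where
  "lead l w = length (takeWhile ((=) l) w)"

lemma lead_simps [simp]: "lead l [] = 0" "lead l (a # w) = (if a = l then Suc (lead l w) else 0)"
  by (auto simp: lead_def)

lemma lead_le_length: "lead l w \<le> length w"
  by (simp add: lead_def length_takeWhile_le)

text \<open>The hypothesis reaches all words of \<open>G\<close> with fewer leading letters than
  \<open>l # v\<close>, not only tails: multiplying \<open>[l]\<close> with \<open>v\<close> also
  produces words that are no tails of \<open>l # v\<close>, such as \<open>v\<close> with
  \<open>l\<close> inserted further inside.\<close>

lemma lead_induct [consumes 1, case_names zero step]:
  assumes "w \<in> G"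
    and zero: "\<And>w. w \<in> G \<Longrightarrow> lead l w = 0 \<Longrightarrow> P w"
    and step: "\<And>v. l # v \<in> G \<Longrightarrow> (\<And>w. w \<in> G \<Longrightarrow> lead l w \<le> lead l v \<Longrightarrow> P w) \<Longrightarrow> P (l # v)"
  shows "P w"
  using assms(1)
proof (induction "lead l w" arbitrary: w rule: less_induct)
  case less
  show ?case
  proof (cases "lead l w = 0")
    case True
    then show ?thesis using zero less.prems by blast
  next
    case False
    then obtain v where "w = l # v" by (cases w) (auto split: if_splits)
    then show ?thesis using step less by simp
  qed
qed

text \<open>The coefficient counts the insertions of \<open>l\<close> into the leading run of
  \<open>v\<close>: there are \<open>lead l v + 1\<close> slots, all giving \<open>l # v\<close>.
  Every other word of the product starts with a run no longer than that of \<open>v\<close>, so over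
  the rationals the product can be solved for \<open>l # v\<close>.\<close>

definition leading_letter_law ::
  "'a list set \<Rightarrow> 'a \<Rightarrow> ('a ncpoly \<Rightarrow> 'a ncpoly \<Rightarrow> 'a ncpoly) \<Rightarrow> bool" where
  "leading_letter_law G l M \<longleftrightarrow> [l] \<in> G \<and> (\<forall>v. l # v \<in> G \<longrightarrow> v \<in> G \<and>
     (\<exists>r. M (word_poly [l]) (word_poly v)
            = nc_scale (of_nat (Suc (lead l v))) (word_poly (l # v)) + r
        \<and> Poly_Mapping.keys r \<subseteq> {w \<in> G. lead l w \<le> lead l v}))"

lemma algebra_hom_on_0:
  assumes "algebra_hom_on {p. Poly_Mapping.keys p \<subseteq> G} M f"
  shows "f 0 = 0"
proof -
  have "nc_scale 0 0 = (0 :: 'a ncpoly)" by (rule poly_mapping_eqI) simp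
  moreover have "f (nc_scale 0 0) = smult (of_rat 0) (f 0)"
    using assms unfolding algebra_hom_on_def by (metis (no_types, lifting) Poly_Mapping.keys_zero empty_subsetI mem_Collect_eq)
  ultimately show ?thesis by simp
qed

lemma algebra_hom_on_expand:
  assumes "algebra_hom_on {p. Poly_Mapping.keys p \<subseteq> G} M f" "Poly_Mapping.keys p \<subseteq> G"
  shows "f p = (\<Sum>w\<in>Poly_Mapping.keys p. smult (of_rat (Poly_Mapping.lookup p w)) (f (word_poly w)))"
proof -
  have add: "f (p + q) = f p + f q" if "Poly_Mapping.keys p \<subseteq> G" "Poly_Mapping.keys q \<subseteq> G" for p q
    using assms(1) that by (auto simp: algebra_hom_on_def)
  have scale: "f (nc_scale c p) = smult (of_rat c) (f p)" if "Poly_Mapping.keys p \<subseteq> G" for c p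
    using assms(1) that by (auto simp: algebra_hom_on_def)
  let ?t = "\<lambda>w. nc_scale (Poly_Mapping.lookup p w) (word_poly w)"
  have key: "Poly_Mapping.keys (\<Sum>w\<in>W. ?t w) \<subseteq> G \<and>
      f (\<Sum>w\<in>W. ?t w) = (\<Sum>w\<in>W. smult (of_rat (Poly_Mapping.lookup p w)) (f (word_poly w)))"
    if "finite W" "W \<subseteq> G" for W
    using that
  proof (induction W)
    case empty
    then show ?case using algebra_hom_on_0[OF assms(1)] by simp
  next
    case (insert w W)
    have 1: "Poly_Mapping.keys (?t w) \<subseteq> G"
      using keys_nc_scale[of "Poly_Mapping.lookup p w" "word_poly w"] insert.prems by auto
    have "Poly_Mapping.keys (?t w + (\<Sum>w\<in>W. ?t w)) \<subseteq> G"
      using 1 insert.IH insert.prems Poly_Mapping.keys_add[of "?t w" "\<Sum>w\<in>W. ?t w"] by blast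
    then show ?case
      using insert 1 by (simp add: add scale)
  qed
  show ?thesis
    using key[OF finite_keys assms(2)] nc_expand[of p] by simp
qed

text \<open>The law solved for \<open>l # v\<close>: the value there is fixed by values on words
  with a shorter leading run. The remainder \<open>r\<close> is handed out together with its
  defining equation, so that two homomorphisms can be compared on the same \<open>r\<close>.\<close>

lemma algebra_hom_on_leading_letter:
  assumes hom: "algebra_hom_on {p. Poly_Mapping.keys p \<subseteq> G} M f"
    and law: "leading_letter_law G l M" and v: "l # v \<in> G"
  obtains r where "Poly_Mapping.keys r \<subseteq> {w \<in> G. lead l w \<le> lead l v}"
    "M (word_poly [l]) (word_poly v) = nc_scale (of_nat (Suc (lead l v))) (word_poly (l # v)) + r"
    "f (word_poly (l # v)) = smult (inverse (of_nat (Suc (lead l v))))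
       (f (word_poly [l]) * f (word_poly v)
         - (\<Sum>w\<in>Poly_Mapping.keys r. smult (of_rat (Poly_Mapping.lookup r w)) (f (word_poly w))))"
proof -
  obtain r where r: "M (word_poly [l]) (word_poly v)
            = nc_scale (of_nat (Suc (lead l v))) (word_poly (l # v)) + r"
        "Poly_Mapping.keys r \<subseteq> {w \<in> G. lead l w \<le> lead l v}" and vG: "v \<in> G" and l: "[l] \<in> G"
    using law v unfolding leading_letter_law_def by blast
  have "f (word_poly [l]) * f (word_poly v) = f (M (word_poly [l]) (word_poly v))"
    using hom vG l by (auto simp: algebra_hom_on_def)
  also have "\<dots> = f (nc_scale (of_nat (Suc (lead l v))) (word_poly (l # v))) + f r"
  proof -
    have "Poly_Mapping.keys r \<subseteq> G"
      "Poly_Mapping.keys (nc_scale (of_nat (Suc (lead l v))) (word_poly (l # v))) \<subseteq> G"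
      using r(2) v keys_nc_scale[of "of_nat (Suc (lead l v))" "word_poly (l # v)"] by auto
    then show ?thesis
      using hom unfolding r(1) algebra_hom_on_def by blast
  qed
  also have "f (nc_scale (of_nat (Suc (lead l v))) (word_poly (l # v)))
      = smult (of_rat (of_nat (Suc (lead l v)))) (f (word_poly (l # v)))"
    using hom v unfolding algebra_hom_on_def by (metis (no_types, lifting) empty_subsetI insert_subset keys_word_poly mem_Collect_eq)
  also have "of_rat (of_nat (Suc (lead l v))) = (of_nat (Suc (lead l v)) :: complex)"
    by (rule of_rat_of_nat_eq)
  also have "f r = (\<Sum>w\<in>Poly_Mapping.keys r. smult (of_rat (Poly_Mapping.lookup r w)) (f (word_poly w)))"
    using r(2) by (intro algebra_hom_on_expand[OF hom]) auto
  finally have e: "f (word_poly [l]) * f (word_poly v)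
     - (\<Sum>w\<in>Poly_Mapping.keys r. smult (of_rat (Poly_Mapping.lookup r w)) (f (word_poly w)))
     = smult (of_nat (Suc (lead l v))) (f (word_poly (l # v)))"
    by simp
  have ne: "(of_nat (Suc (lead l v)) :: complex) \<noteq> 0" using of_nat_neq_0 by blast
  have "smult (inverse (of_nat (Suc (lead l v)))) (smult (of_nat (Suc (lead l v))) (f (word_poly (l # v)))) = f (word_poly (l # v))"
    unfolding smult_smult left_inverse[OF ne] by simp
  then show ?thesis using that[OF r(2,1)] e by metis
qed

text \<open>This ties a map obtained by choice to one whose values are known: the recursion leaves
  freedom only on \<open>[l]\<close> and on the words that do not start with
  \<open>l\<close>.\<close>

lemma algebra_hom_on_unique:
  assumes f: "algebra_hom_on {p. Poly_Mapping.keys p \<subseteq> G} M f"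
    and g: "algebra_hom_on {p. Poly_Mapping.keys p \<subseteq> G} M g"
    and law: "leading_letter_law G l M"
    and l: "f (word_poly [l]) = g (word_poly [l])"
    and zero: "\<And>w. w \<in> G \<Longrightarrow> lead l w = 0 \<Longrightarrow> f (word_poly w) = g (word_poly w)"
    and w: "w \<in> G"
  shows "f (word_poly w) = g (word_poly w)"
  using w
proof (induction w rule: lead_induct[where l = l])
  case (zero w)
  then show ?case by (rule assms(5))
next
  case (step v)
  obtain r where r: "Poly_Mapping.keys r \<subseteq> {w \<in> G. lead l w \<le> lead l v}"
    "M (word_poly [l]) (word_poly v) = nc_scale (of_nat (Suc (lead l v))) (word_poly (l # v)) + r"
    "f (word_poly (l # v)) = smult (inverse (of_nat (Suc (lead l v))))
       (f (word_poly [l]) * f (word_poly v)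
         - (\<Sum>w\<in>Poly_Mapping.keys r. smult (of_rat (Poly_Mapping.lookup r w)) (f (word_poly w))))"
    using algebra_hom_on_leading_letter[OF f law step(1)] .
  obtain r' where r': "Poly_Mapping.keys r' \<subseteq> {w \<in> G. lead l w \<le> lead l v}"
    "M (word_poly [l]) (word_poly v) = nc_scale (of_nat (Suc (lead l v))) (word_poly (l # v)) + r'"
    "g (word_poly (l # v)) = smult (inverse (of_nat (Suc (lead l v))))
       (g (word_poly [l]) * g (word_poly v)
         - (\<Sum>w\<in>Poly_Mapping.keys r'. smult (of_rat (Poly_Mapping.lookup r' w)) (g (word_poly w))))"
    using algebra_hom_on_leading_letter[OF g law step(1)] .
  \<comment> \<open>The product equation determines the remainder, so both homomorphisms obey one
    recursion.\<close>
  have [simp]: "r' = r" using r(2) r'(2) by simp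
  have "v \<in> G" using law step(1) by (auto simp: leading_letter_law_def)
  moreover have "f (word_poly w) = g (word_poly w)" if "w \<in> Poly_Mapping.keys r" for w
    using step(2) r(1) that by blast
  ultimately show ?case
    unfolding r(3) r'(3) using l step(2) by simp
qed

section \<open>Errors negligible against all powers of a divergent quantity\<close>

text \<open>Plain convergence to 0 is not stable under multiplication with the divergent quantity
  \<open>h\<close>, which occurs as soon as two expansions are multiplied; decay against every power
  of \<open>h\<close> is.\<close>

definition rapid_null :: "'x filter \<Rightarrow> ('x \<Rightarrow> complex) \<Rightarrow> ('x \<Rightarrow> complex) \<Rightarrow> bool" where
  "rapid_null F h f \<longleftrightarrow> (\<forall>J. ((\<lambda>x. f x * h x ^ J) \<longlongrightarrow> 0) F)"

lemma rapid_null_tendsto: "rapid_null F h f \<Longrightarrow> (f \<longlongrightarrow> 0) F"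
  using spec[of "\<lambda>J. ((\<lambda>x. f x * h x ^ J) \<longlongrightarrow> 0) F" 0] by (simp add: rapid_null_def)

lemma rapid_null_0 [simp]: "rapid_null F h (\<lambda>_. 0)"
  by (simp add: rapid_null_def)

lemma rapid_null_add: "rapid_null F h f \<Longrightarrow> rapid_null F h g \<Longrightarrow> rapid_null F h (\<lambda>x. f x + g x)"
  by (auto simp: rapid_null_def distrib_right intro: tendsto_add_zero)

lemma rapid_null_cmult: "rapid_null F h f \<Longrightarrow> rapid_null F h (\<lambda>x. c * f x)"
  by (auto simp: rapid_null_def mult.assoc intro: tendsto_mult_right_zero)

lemma rapid_null_uminus: "rapid_null F h f \<Longrightarrow> rapid_null F h (\<lambda>x. - f x)"
  using rapid_null_cmult[of F h f "-1"] by simp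

lemma rapid_null_diff: "rapid_null F h f \<Longrightarrow> rapid_null F h g \<Longrightarrow> rapid_null F h (\<lambda>x. f x - g x)"
  using rapid_null_add[OF _ rapid_null_uminus, of F h f g] by simp

lemma rapid_null_sum: "(\<And>i. i \<in> I \<Longrightarrow> rapid_null F h (f i)) \<Longrightarrow> rapid_null F h (\<lambda>x. \<Sum>i\<in>I. f i x)"
  by (induction I rule: infinite_finite_induct) (auto intro: rapid_null_add)

lemma rapid_null_mult_tendsto:
  assumes "rapid_null F h f" "(g \<longlongrightarrow> c) F" shows "rapid_null F h (\<lambda>x. f x * g x)"
  unfolding rapid_null_def
proof
  fix J
  have "((\<lambda>x. (f x * h x ^ J) * g x) \<longlongrightarrow> 0 * c) F"
    using assms by (intro tendsto_mult) (auto simp: rapid_null_def)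
  then show "((\<lambda>x. f x * g x * h x ^ J) \<longlongrightarrow> 0) F" by (simp add: mult_ac)
qed

lemma rapid_null_mult_h: "rapid_null F h f \<Longrightarrow> rapid_null F h (\<lambda>x. f x * h x)"
  unfolding rapid_null_def
proof
  fix J assume "\<forall>J. ((\<lambda>x. f x * h x ^ J) \<longlongrightarrow> 0) F"
  then have "((\<lambda>x. f x * h x ^ Suc J) \<longlongrightarrow> 0) F" by blast
  then show "((\<lambda>x. f x * h x * h x ^ J) \<longlongrightarrow> 0) F" by (simp add: mult_ac)
qed

lemma rapid_null_mult_poly: "rapid_null F h f \<Longrightarrow> rapid_null F h (\<lambda>x. f x * poly P (h x))"
proof (induction P arbitrary: f)
  case (pCons a P)
  have "rapid_null F h (\<lambda>x. a * f x + (f x * h x) * poly P (h x))"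
    using pCons by (intro rapid_null_add rapid_null_cmult pCons.IH rapid_null_mult_h)
  then show ?case by (simp add: algebra_simps)
qed simp

lemma rapid_null_cong: "rapid_null F h f \<Longrightarrow> eventually (\<lambda>x. f x = g x) F \<Longrightarrow> rapid_null F h g"
  unfolding rapid_null_def by (auto elim!: Lim_transform_eventually eventually_mono)

text \<open>The difference polynomial tends to 0 along \<open>h\<close>; a nonconstant polynomial
  tends to infinity there, and a nonzero constant stays away from 0.\<close>

lemma rapid_null_poly_unique:
  assumes "F \<noteq> bot" "filterlim h at_infinity F"
    and "rapid_null F h (\<lambda>x. g x - poly P (h x))" "rapid_null F h (\<lambda>x. g x - poly Q (h x))"
  shows "P = Q"
proof (rule ccontr)
  assume "P \<noteq> Q"
  define R where "R = P - Q"
  have "rapid_null F h (\<lambda>x. poly R (h x))"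
    using rapid_null_diff[OF assms(4) assms(3)] by (simp add: R_def)
  then have lim: "((\<lambda>x. poly R (h x)) \<longlongrightarrow> 0) F" by (rule rapid_null_tendsto)
  show False
  proof (cases "degree R = 0")
    case True
    then obtain a where R: "R = [:a:]" by (metis degree_eq_zeroE)
    then have "((\<lambda>x. a) \<longlongrightarrow> 0) F" using lim by simp
    then have "a = 0" using assms(1) by (simp add: tendsto_const_iff)
    then show False using R \<open>P \<noteq> Q\<close> by (simp add: R_def)
  next
    case False
    then have "filterlim (\<lambda>x. poly R (h x)) at_infinity F"
      by (intro filterlim_compose[OF filterlim_poly_at_infinity assms(2)]) simp
    then show False using not_tendsto_and_filterlim_at_infinity[OF assms(1) lim] by blast
  qed
qed

text \<open>The parameter \<open>x\<close> is either the truncation point tending to infinity or the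
  argument of polylogarithms tending to 1 from the left. The homomorphism sends an element to the
  polynomial in \<open>h\<close> that approximates it, well defined by
  \<open>rapid_null_poly_unique\<close>. Multiplicativity is asked only eventually because
  polylogarithms are controlled only inside the unit interval.\<close>

lemma regularization_exists:
  fixes \<Phi> :: "'x \<Rightarrow> 'a list \<Rightarrow> complex"
  assumes F: "F \<noteq> bot" "filterlim h at_infinity F"
    and ex: "\<And>w. w \<in> G \<Longrightarrow> \<exists>P. rapid_null F h (\<lambda>x. \<Phi> x w - poly P (h x))"
    and nil: "\<And>x. \<Phi> x [] = 1"
    and mult: "\<And>p q. Poly_Mapping.keys p \<subseteq> G \<Longrightarrow> Poly_Mapping.keys q \<subseteq> G \<Longrightarrow>
        eventually (\<lambda>x. lin_ext (\<Phi> x) (M p q) = lin_ext (\<Phi> x) p * lin_ext (\<Phi> x) q) F"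
  obtains f where "algebra_hom_on {p. Poly_Mapping.keys p \<subseteq> G} M f"
    "\<And>w P. rapid_null F h (\<lambda>x. \<Phi> x w - poly P (h x)) \<Longrightarrow> f (word_poly w) = P"
proof -
  define asy where "asy = (\<lambda>p P. rapid_null F h (\<lambda>x. lin_ext (\<Phi> x) p - poly P (h x)))"
  define f where "f = (\<lambda>p. THE P. asy p P)"
  have f_eqI: "f p = P" if "asy p P" for p P
    unfolding f_def using that rapid_null_poly_unique[OF F] by (intro the_equality) (auto simp: asy_def)
  have asy_scale: "asy (nc_scale c p) (smult (of_rat c) P)" if "asy p P" for c p P
    using rapid_null_cmult[OF that[unfolded asy_def], of "of_rat c"]
    by (simp add: asy_def lin_ext_nc_scale algebra_simps)
  have asy_add: "asy (p + q) (P + Q)" if "asy p P" "asy q Q" for p q P Q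
    using rapid_null_add[OF that[unfolded asy_def]] by (simp add: asy_def lin_ext_add algebra_simps)
  have asy: "asy p (f p)" if "Poly_Mapping.keys p \<subseteq> G" for p
  proof -
    have "\<exists>P. asy (\<Sum>w\<in>W. nc_scale (Poly_Mapping.lookup p w) (word_poly w)) P"
      if "finite W" "W \<subseteq> G" for W
      using that
    proof (induction W)
      case empty
      have "asy 0 0" by (simp add: asy_def)
      then show ?case by auto
    next
      case (insert w W)
      obtain P where "asy (word_poly w) P" using ex[of w] insert by (auto simp: asy_def)
      then show ?case using asy_add[OF asy_scale] insert by (simp add: insert_subset) blast
    qed
    from this[OF finite_keys that] nc_expand[of p] obtain P where "asy p P" by auto
    then show ?thesis using f_eqI by metis
  qed
  have asy_mult: "asy (M p q) (f p * f q)" if "Poly_Mapping.keys p \<subseteq> G" "Poly_Mapping.keys q \<subseteq> G" for p q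
  proof -
    define ep where "ep = (\<lambda>x. lin_ext (\<Phi> x) p - poly (f p) (h x))"
    define eq where "eq = (\<lambda>x. lin_ext (\<Phi> x) q - poly (f q) (h x))"
    have e: "rapid_null F h ep" "rapid_null F h eq" using asy[OF that(1)] asy[OF that(2)] by (simp_all add: asy_def ep_def eq_def)
    \<comment> \<open>With both values written as polynomial plus error, their product exceeds the
      product of the polynomials by exactly these three terms, each with an error as a
      factor.\<close>
    have "rapid_null F h (\<lambda>x. ep x * eq x + ep x * poly (f q) (h x) + eq x * poly (f p) (h x))"
      by (intro rapid_null_add rapid_null_mult_tendsto[OF e(1) rapid_null_tendsto[OF e(2)]] rapid_null_mult_poly e)
    then show ?thesis unfolding asy_def
      by (rule rapid_null_cong) (use mult[OF that] in eventually_elim, simp add: ep_def eq_def algebra_simps)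
  qed
  have "algebra_hom_on {p. Poly_Mapping.keys p \<subseteq> G} M f"
    unfolding algebra_hom_on_def
    by (auto intro!: f_eqI asy_add asy_scale asy asy_mult) (simp add: asy_def nil)
  moreover have "f (word_poly w) = P" if "rapid_null F h (\<lambda>x. \<Phi> x w - poly P (h x))" for w P
    using that by (intro f_eqI) (simp add: asy_def)
  ultimately show ?thesis using that by blast
qed

section \<open>Truncated sums and the stuffle product\<close>

lemma lookup_letter_mult:
  "Poly_Mapping.lookup (letter_mult a p) w
     = (case w of [] \<Rightarrow> 0 | b # u \<Rightarrow> if a = b then Poly_Mapping.lookup p u else 0)"
  by (cases w) (auto simp: letter_mult_def lookup_sum lookup_single when_def in_keys_iff)

lemma letter_mult_add: "letter_mult a (p + q) = letter_mult a p + letter_mult a q"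
  by (rule poly_mapping_eqI) (auto simp: lookup_letter_mult lookup_add split: list.splits)

lemma letter_mult_nc_scale: "letter_mult a (nc_scale c p) = nc_scale c (letter_mult a p)"
  by (rule poly_mapping_eqI) (auto simp: lookup_letter_mult split: list.splits)

lemma letter_mult_word_poly [simp]: "letter_mult a (word_poly w) = word_poly (a # w)"
  by (rule poly_mapping_eqI) (auto simp: lookup_letter_mult split: list.splits)

lemma nc_scale_of_nat_Suc: "nc_scale (of_nat (Suc n)) p = p + nc_scale (of_nat n) p"
  by (rule poly_mapping_eqI) (simp add: lookup_add algebra_simps)

lemma nc_scale_simps [simp]: "nc_scale 1 p = p" "nc_scale 0 p = 0"
  by (rule poly_mapping_eqI, simp)+

lemma keys_add_subset:
  "Poly_Mapping.keys p \<subseteq> A \<Longrightarrow> Poly_Mapping.keys q \<subseteq> A \<Longrightarrow> Poly_Mapping.keys (p + q) \<subseteq> A"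
  using Poly_Mapping.keys_add[of p q] by blast

definition y1 :: yletter where "y1 = (1, 1)"

primrec hsum :: "yletter list \<Rightarrow> nat \<Rightarrow> complex" where
  "hsum [] n = 1"
| "hsum (a # w) n = (\<Sum>k=1..n. snd a ^ k / of_nat k ^ fst a * hsum w (k - 1))"

lemma hsum_Suc:
  "hsum (a # w) (Suc n) = hsum (a # w) n + snd a ^ Suc n / of_nat (Suc n) ^ fst a * hsum w n"
  by simp

lemma hsum_Cons_0 [simp]: "hsum (a # w) 0 = 0"
  by simp

declare hsum.simps(2) [simp del]

lemma lin_ext_hsum_letter_mult_Suc:
  "lin_ext (\<lambda>w. hsum w (Suc n)) (letter_mult a p)
     = lin_ext (\<lambda>w. hsum w n) (letter_mult a p)
       + snd a ^ Suc n / of_nat (Suc n) ^ fst a * lin_ext (\<lambda>w. hsum w n) p"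
  unfolding lin_ext_letter_mult hsum_Suc lin_ext_plus_fun lin_ext_scale_fun ..

lemma lin_ext_hsum_letter_mult_0: "lin_ext (\<lambda>w. hsum w 0) (letter_mult a p) = 0"
  unfolding lin_ext_letter_mult hsum_Cons_0 by (simp add: lin_ext_def)

text \<open>Discrete product rule: the increment of a product of two sequences is the first
  increment times the second sequence, plus the first sequence times the second increment, plus the
  product of the increments. These are the three terms of the stuffle recursion.\<close>

lemma hsum_stuffle: "lin_ext (\<lambda>w. hsum w n) (stuffle_words u v) = hsum u n * hsum v n"
proof (induction n arbitrary: u v)
  case 0
  show ?case
    by (cases "(u, v)" rule: stuffle_words.cases) (auto simp: lin_ext_add lin_ext_hsum_letter_mult_0)
next
  case (Suc n)
  show ?case
  proof (cases "(u, v)" rule: stuffle_words.cases)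
    case (3 m \<mu> u' k \<nu> v')
    define c d where "c = \<mu> ^ Suc n / of_nat (Suc n) ^ m" and "d = \<nu> ^ Suc n / of_nat (Suc n) ^ k"
    have cd: "(\<mu> * \<nu>) ^ Suc n / of_nat (Suc n) ^ (m + k) = c * d"
      by (simp add: c_def d_def power_mult_distrib power_add)
    have "lin_ext (\<lambda>w. hsum w (Suc n)) (stuffle_words u v)
      = lin_ext (\<lambda>w. hsum w n) (stuffle_words u v) + c * (hsum u' n * hsum v n)
        + d * (hsum u n * hsum v' n) + c * d * (hsum u' n * hsum v' n)"
      using 3 Suc.IH[of u' v] Suc.IH[of u v'] Suc.IH[of u' v']
      by (simp add: lin_ext_add lin_ext_hsum_letter_mult_Suc cd c_def[symmetric] d_def[symmetric]
          del: power_Suc of_nat_Suc)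
    also have "\<dots> = hsum u (Suc n) * hsum v (Suc n)"
      using 3 Suc.IH[of u v] by (simp add: hsum_Suc c_def[symmetric] d_def[symmetric] algebra_simps
          del: power_Suc of_nat_Suc)
    finally show ?thesis .
  qed auto
qed

lemma cmzv_partial_eq_hsum:
  assumes "length s = length e"
  shows "cmzv_partial n s e = hsum (zip s e) n"
  using assms
proof (induction s e arbitrary: n rule: list_induct2)
  case Nil
  have "{k :: nat list. k = [] \<and> sorted_wrt (>) k \<and> set k \<subseteq> {1..n}} = {[]}" by auto
  then show ?case by (simp add: cmzv_partial_def)
next
  case (Cons x s y e)
  define S where "S = (\<lambda>n d. {k :: nat list. length k = d \<and> sorted_wrt (>) k \<and> set k \<subseteq> {1..n}})"
  have fin: "finite (S n d)" for n d
    by (rule finite_subset[OF _ finite_lists_length_eq[of "{1..n}" d]]) (auto simp: S_def)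
  have split: "S n (Suc d) = (\<lambda>(k, ks). k # ks) ` (SIGMA k:{1..n}. S (k - 1) d)" for d
  proof (intro set_eqI iffI)
    fix l assume l: "l \<in> S n (Suc d)"
    then obtain k ks where "l = k # ks" by (cases l) (auto simp: S_def)
    with l have "(k, ks) \<in> (SIGMA k:{1..n}. S (k - 1) d)" by (fastforce simp: S_def)
    then show "l \<in> (\<lambda>(k, ks). k # ks) ` (SIGMA k:{1..n}. S (k - 1) d)"
      using \<open>l = k # ks\<close> by force
  next
    fix l assume "l \<in> (\<lambda>(k, ks). k # ks) ` (SIGMA k:{1..n}. S (k - 1) d)"
    then show "l \<in> S n (Suc d)" by (fastforce simp: S_def)
  qed
  define f where "f = (\<lambda>(s :: nat list) e k. \<Prod>i<length s. (e ! i :: complex) ^ (k ! i) / of_nat (k ! i) ^ (s ! i))"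
  have f: "f (x # s) (y # e) (k # ks) = y ^ k / of_nat k ^ x * f s e ks" for k ks
    by (simp add: f_def prod.lessThan_Suc_shift del: prod.lessThan_Suc)
  have IH: "hsum (zip s e) n = sum (f s e) (S n (length s))" for n
    using Cons.IH[of n] by (simp add: cmzv_partial_def f_def S_def)
  have "cmzv_partial n (x # s) (y # e) = sum (f (x # s) (y # e)) (S n (Suc (length s)))"
    by (simp add: cmzv_partial_def f_def S_def)
  also have "\<dots> = (\<Sum>(k, ks)\<in>(SIGMA k:{1..n}. S (k - 1) (length s)). f (x # s) (y # e) (k # ks))"
    unfolding split by (subst sum.reindex) (auto simp: inj_on_def case_prod_unfold)
  also have "\<dots> = (\<Sum>k=1..n. \<Sum>ks\<in>S (k - 1) (length s). f (x # s) (y # e) (k # ks))"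
    by (subst sum.Sigma) (auto simp: fin)
  also have "\<dots> = hsum (zip (x # s) (y # e)) n"
    by (simp add: f IH hsum.simps(2) sum_distrib_left)
  finally show ?case .
qed

definition yletters :: "nat \<Rightarrow> yletter set" where
  "yletters N = {1..} \<times> roots_unity N"

lemma y1_in_yletters [simp]: "y1 \<in> yletters N"
  by (simp add: yletters_def roots_unity_def y1_def)

lemma A1y_eq: "A1y N = {p. Poly_Mapping.keys p \<subseteq> lists (yletters N)}"
  by (auto simp: A1y_def yletters_def)

text \<open>Merging \<open>y1\<close> with a letter raises its first component to at least 2, so
  merged words never gain a leading \<open>y1\<close> and go to the remainder. The other terms
  insert \<open>y1\<close> into \<open>v\<close>; those inserted into the leading run coincide and
  give the coefficient.\<close>

lemma stuffle_y1_word: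
  assumes "v \<in> lists (yletters N)"
  shows "\<exists>r. stuffle_words [y1] v = nc_scale (of_nat (Suc (lead y1 v))) (word_poly (y1 # v)) + r
           \<and> Poly_Mapping.keys r \<subseteq> {w \<in> lists (yletters N). lead y1 w \<le> lead y1 v}"
  using assms
proof (induction v)
  case Nil
  show ?case by (rule exI[of _ 0]) simp
next
  case (Cons b v)
  obtain m \<nu> where b: "b = (m, \<nu>)" by (cases b)
  obtain r where r: "stuffle_words [y1] v = nc_scale (of_nat (Suc (lead y1 v))) (word_poly (y1 # v)) + r"
    "Poly_Mapping.keys r \<subseteq> {w \<in> lists (yletters N). lead y1 w \<le> lead y1 v}"
    using Cons by auto
  let ?m = "word_poly ((1 + m, \<nu>) # v)"
  have e: "stuffle_words [y1] (b # v) = word_poly (y1 # b # v) + letter_mult b (stuffle_words [y1] v) + ?m"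
    by (simp add: b y1_def)
  have kr: "Poly_Mapping.keys (letter_mult b r)
      \<subseteq> {w \<in> lists (yletters N). lead y1 w \<le> (if b = y1 then Suc (lead y1 v) else 0)}"
    
  proof
    fix x assume "x \<in> Poly_Mapping.keys (letter_mult b r)"
    then obtain u where "x = b # u" "u \<in> Poly_Mapping.keys r" using keys_letter_mult[of b r] by blast
    moreover from this have "u \<in> lists (yletters N)" "lead y1 u \<le> lead y1 v" using r(2) by auto
    ultimately show "x \<in> {w \<in> lists (yletters N). lead y1 w \<le> (if b = y1 then Suc (lead y1 v) else 0)}"
      using Cons.hyps by simp
  qed
  have km: "(1 + m, \<nu>) # v \<in> lists (yletters N)" "lead y1 ((1 + m, \<nu>) # v) = 0"
    using Cons.hyps by (auto simp: b yletters_def y1_def)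
  have km': "(1 + m, \<nu>) # v \<in> {w \<in> lists (yletters N). lead y1 w \<le> k}" for k
    using km by simp
  have leadb: "lead y1 (b # v) = (if b = y1 then Suc (lead y1 v) else 0)" by simp
  show ?case
  proof (cases "b = y1")
    case True
    show ?thesis
    proof (intro exI conjI)
      show "stuffle_words [y1] (b # v)
        = nc_scale (of_nat (Suc (lead y1 (b # v)))) (word_poly (y1 # b # v)) + (letter_mult b r + ?m)"
        unfolding e r(1) letter_mult_add letter_mult_nc_scale
        using True by (simp add: nc_scale_of_nat_Suc add_ac del: of_nat_Suc)
      show "Poly_Mapping.keys (letter_mult b r + ?m) \<subseteq> {w \<in> lists (yletters N). lead y1 w \<le> lead y1 (b # v)}"
        using kr km'[of "Suc (lead y1 v)"] unfolding leadb if_P[OF True] by (intro keys_add_subset) simp_all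
    qed
  next
    case False
    let ?n = "nc_scale (of_nat (Suc (lead y1 v))) (word_poly (b # y1 # v))"
    have "Poly_Mapping.keys ?n \<subseteq> {b # y1 # v}"
      using keys_nc_scale[of _ "word_poly (b # y1 # v)"] by auto
    moreover have "b # y1 # v \<in> {w \<in> lists (yletters N). lead y1 w \<le> 0}"
      using Cons.hyps False by simp
    ultimately have kn: "Poly_Mapping.keys ?n \<subseteq> {w \<in> lists (yletters N). lead y1 w \<le> 0}"
      by blast
    show ?thesis
    proof (intro exI conjI)
      show "stuffle_words [y1] (b # v)
        = nc_scale (of_nat (Suc (lead y1 (b # v)))) (word_poly (y1 # b # v)) + (?n + letter_mult b r + ?m)"
        unfolding e r(1) letter_mult_add letter_mult_nc_scale
        using False by (simp add: add_ac)
      show "Poly_Mapping.keys (?n + letter_mult b r + ?m) \<subseteq> {w \<in> lists (yletters N). lead y1 w \<le> lead y1 (b # v)}"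
        using kr kn km'[of 0] unfolding leadb if_not_P[OF False] by (intro keys_add_subset) simp_all
    qed
  qed
qed

lemma leading_letter_law_stuffle: "leading_letter_law (lists (yletters N)) y1 stuffle_prod"
  unfolding leading_letter_law_def stuffle_prod_def bilinear_ext_word_poly
  using stuffle_y1_word[of _ N] by simp

section \<open>Growth and convergence rates of truncated sums\<close>

lemma norm_roots_unity: "N \<ge> 1 \<Longrightarrow> z \<in> roots_unity N \<Longrightarrow> norm z = 1"
  using power_eq_imp_eq_base[of "norm z" N 1] by (simp add: roots_unity_def flip: norm_power)

lemma sum_inverse_sqrt_le: "(\<Sum>k=1..n. 1 / sqrt (real k)) \<le> 2 * sqrt (real n)"
proof (induction n)
  case (Suc n)
  have "1 / sqrt (real (Suc n)) \<le> 2 * (sqrt (real (Suc n)) - sqrt (real n))"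
  proof -
    have "sqrt (real (Suc n)) * sqrt (real n) \<le> (real (Suc n) + real n) / 2"
      by (rule order_trans[OF _ arith_geo_mean_sqrt]) (auto simp: real_sqrt_mult)
    then have "1 \<le> 2 * (sqrt (real (Suc n)) * sqrt (real (Suc n)) - sqrt (real (Suc n)) * sqrt (real n))"
      by (simp add: real_sqrt_mult_self)
    then show ?thesis by (simp add: field_simps)
  qed
  then show ?case using Suc by simp
qed simp

text \<open>The true growth is at most a power of the logarithm, but a square root closes the
  induction at once: dividing by \<open>k\<close> leaves 1 / sqrt k, whose sum is at most 2 sqrt n.
  Only the constant doubles with each letter.\<close>

lemma hsum_growth:
  assumes "N \<ge> 1" "w \<in> lists (yletters N)"
  shows "\<exists>C\<ge>0. \<forall>n. norm (hsum w n) \<le> C * sqrt (real (Suc n))"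
  using assms(2)
proof (induction w)
  case Nil
  show ?case by (rule exI[of _ 1]) auto
next
  case (Cons a w)
  obtain C where C: "C \<ge> 0" "\<And>n. norm (hsum w n) \<le> C * sqrt (real (Suc n))" using Cons by auto
  have a: "fst a \<ge> 1" "norm (snd a) = 1"
    using Cons.hyps norm_roots_unity[OF assms(1)] by (auto simp: yletters_def)
  have "norm (hsum (a # w) n) \<le> 2 * C * sqrt (real (Suc n))" for n
  proof -
    have "norm (hsum (a # w) n) \<le> (\<Sum>k=1..n. C * (1 / sqrt (real k)))"
      unfolding hsum.simps
    proof (rule sum_norm_le)
      fix k assume k: "k \<in> {1..n}"
      have sq: "sqrt (real k) * sqrt (real k) = real k" by simp
      have "norm (snd a ^ k / of_nat k ^ fst a * hsum w (k - 1)) = norm (hsum w (k - 1)) / real k ^ fst a"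
        by (simp add: norm_mult norm_divide norm_power a)
      also have "\<dots> \<le> (C * sqrt (real k)) / real k ^ 1"
        using k a C(1) C(2)[of "k - 1"] by (intro frac_le power_increasing) auto
      also have "\<dots> = C * (1 / sqrt (real k))"
        using k sq by (auto simp add: divide_simps)
      finally show "norm (snd a ^ k / of_nat k ^ fst a * hsum w (k - 1)) \<le> C * (1 / sqrt (real k))" .
    qed
    also have "\<dots> \<le> C * (2 * sqrt (real n))"
      unfolding sum_distrib_left[symmetric] using C(1) sum_inverse_sqrt_le by (intro mult_left_mono) auto
    also have "\<dots> \<le> C * (2 * sqrt (real (Suc n)))"
      using C(1) by (intro mult_left_mono) auto
    finally show ?thesis by simp
  qed
  then show ?case using C(1) by (intro exI[of _ "2 * C"]) auto
qed

text \<open>The rate is that of the tails of series with terms of size k^(-3/2), which is what the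
  growth bound provides. It suffices because the harmonic number grows like ln n, so that 1 / sqrt n
  beats all its powers.\<close>

definition fast_limit :: "(nat \<Rightarrow> complex) \<Rightarrow> complex \<Rightarrow> bool" where
  "fast_limit f c \<longleftrightarrow> (\<exists>C\<ge>0. \<forall>n. norm (f n - c) \<le> C / sqrt (real (Suc n)))"

lemma inverse_sqrt_LIMSEQ: "(\<lambda>n. C / sqrt (real (Suc n))) \<longlonglongrightarrow> 0"
  by (rule real_tendsto_divide_at_top[OF tendsto_const])
    (rule filterlim_compose[OF sqrt_at_top filterlim_compose[OF filterlim_real_sequentially filterlim_Suc]])

lemma fast_limit_LIMSEQ: 
  assumes "fast_limit f c" shows "f \<longlonglongrightarrow> c"
proof -
  obtain C where C: "\<And>n. norm (f n - c) \<le> C / sqrt (real (Suc n))"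
    using assms by (auto simp: fast_limit_def)
  have "(\<lambda>n. f n - c) \<longlonglongrightarrow> 0"
    by (rule Lim_null_comparison[OF _ inverse_sqrt_LIMSEQ[of C]]) (intro always_eventually allI C)
  then show ?thesis by (rule LIM_zero_cancel)
qed

lemma fast_limit_lim: "fast_limit f c \<Longrightarrow> lim f = c"
  by (intro limI fast_limit_LIMSEQ)

lemma fast_limit_add:
  assumes "fast_limit f c" "fast_limit g d" shows "fast_limit (\<lambda>n. f n + g n) (c + d)"
proof -
  obtain C D where "C \<ge> 0" "\<And>n. norm (f n - c) \<le> C / sqrt (real (Suc n))"
    and "D \<ge> 0" "\<And>n. norm (g n - d) \<le> D / sqrt (real (Suc n))"
    using assms by (auto simp: fast_limit_def)
  then show ?thesis
    unfolding fast_limit_def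
    by (intro exI[of _ "C + D"]) (auto simp: add_diff_add add_divide_distrib intro!: norm_triangle_le add_mono)
qed

lemma fast_limit_cmult:
  assumes "fast_limit f c" shows "fast_limit (\<lambda>n. a * f n) (a * c)"
proof -
  obtain C where "C \<ge> 0" "\<And>n. norm (f n - c) \<le> C / sqrt (real (Suc n))"
    using assms by (auto simp: fast_limit_def)
  then show ?thesis
    unfolding fast_limit_def
    by (intro exI[of _ "norm a * C"])
      (auto simp: right_diff_distrib[symmetric] norm_mult intro!: mult_left_mono simp flip: times_divide_eq_right)
qed

lemma fast_limit_const: "fast_limit (\<lambda>_. c) c"
  by (auto simp: fast_limit_def)

text \<open>Telescoping majorant for k^(-3/2). With \<open>a\<close>, \<open>b\<close> the two
  square roots, 1 / a - 1 / b = 1 / (a b (a + b)), and b^2 = a^2 + 1 together with b \<le> 2 a gives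
  b (a + b) \<le> 4 a^2, the origin of the factor 4.\<close>

lemma inverse_sqrt_diff:
  "1 / (real (Suc k) * sqrt (real (Suc k)))
     \<le> 4 * (1 / sqrt (real (Suc k)) - 1 / sqrt (real (Suc (Suc k))))"
proof -
  define a b where "a = sqrt (real (Suc k))" and "b = sqrt (real (Suc (Suc k)))"
  have ab: "a > 0" "b > 0" "b * b = a * a + 1" "a \<ge> 1" and aa: "real (Suc k) = a * a"
    by (auto simp: a_def b_def)
  have "1 \<le> a * a" using mult_mono[OF ab(4) ab(4)] ab(1) by simp
  have "b \<le> 2 * a"
  proof (rule power2_le_imp_le)
    show "b\<^sup>2 \<le> (2 * a)\<^sup>2" using \<open>1 \<le> a * a\<close> ab(3) by (simp add: power2_eq_square)
  qed (use ab in auto)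
  have "b * (b + a) = a * a + 1 + b * a" using ab(3) by (simp add: algebra_simps)
  also have "\<dots> \<le> 4 * (a * a)"
    using \<open>1 \<le> a * a\<close> mult_right_mono[OF \<open>b \<le> 2 * a\<close> less_imp_le[OF ab(1)]]
    unfolding mult.assoc by linarith
  finally have ba: "b * (b + a) \<le> 4 * (a * a)" .
  have "1 / a - 1 / b = (b - a) / (a * b)" using ab(1,2) by (simp add: field_simps)
  also have "\<dots> = ((b - a) * (b + a)) / (a * b * (b + a))"
    using ab(1,2) by (subst mult_divide_mult_cancel_right) auto
  also have "(b - a) * (b + a) = 1" using ab(3) by (simp add: algebra_simps)
  also have "1 / (a * b * (b + a)) = 1 / (a * (b * (b + a)))" by (simp only: mult.assoc)
  also have "\<dots> \<ge> 1 / (a * (4 * (a * a)))"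
    using ab(1,2) ba by (intro divide_left_mono mult_left_mono mult_pos_pos add_pos_pos) auto
  finally have "1 / (a * (4 * (a * a))) \<le> 1 / a - 1 / b" .
  moreover have "1 / (a * a * a) = 4 * (1 / (a * (4 * (a * a))))" using ab(1) by (simp add: field_simps)
  ultimately have "1 / (a * a * a) \<le> 4 * (1 / a - 1 / b)"
    by (metis mult_left_mono zero_le_numeral)
  moreover have "sqrt (a * a) = a" using ab(1) by simp
  ultimately show ?thesis unfolding a_def[symmetric] b_def[symmetric] aa by simp
qed

text \<open>The tail from \<open>n\<close> on is dominated by the telescoping series of
  \<open>inverse_sqrt_diff\<close>, whose sum is 4 C / sqrt (n + 1).\<close>

lemma fast_limit_sum:
  fixes f :: "nat \<Rightarrow> complex"
  assumes C: "C \<ge> 0" and f: "\<And>k. k \<ge> 1 \<Longrightarrow> norm (f k) \<le> C / (real k * sqrt (real k))"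
  shows "\<exists>c. fast_limit (\<lambda>n. \<Sum>k=1..n. f k) c"
proof -
  define t where "t = (\<lambda>k. 1 / sqrt (real (Suc k)))"
  have t0: "t \<longlonglongrightarrow> 0"
    unfolding t_def by (rule inverse_sqrt_LIMSEQ)
  define g where "g = (\<lambda>k. f (Suc k))"
  have bound: "norm (g k) \<le> 4 * C * (t k - t (Suc k))" for k
  proof -
    have "norm (g k) \<le> C * (1 / (real (Suc k) * sqrt (real (Suc k))))"
      unfolding g_def using f[of "Suc k"] by simp
    also have "\<dots> \<le> C * (4 * (t k - t (Suc k)))"
      unfolding t_def by (rule mult_left_mono[OF inverse_sqrt_diff C])
    finally show ?thesis by (simp only: mult_ac)
  qed
  have sums: "(\<lambda>k. 4 * C * (t (k + n) - t (Suc (k + n)))) sums (4 * C * t n)" for n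
    using sums_mult[OF telescope_sums'[OF LIMSEQ_ignore_initial_segment[OF t0, of n]], of "4 * C"]
    by (simp only: add_0 add_Suc diff_0_right)
  have summ: "summable g"
    using summable_comparison_test'[OF sums_summable[OF sums[of 0]], of 0 g] bound by (simp only: add_0_right)
  have "norm ((\<Sum>k=1..n. f k) - suminf g) \<le> 4 * C / sqrt (real (Suc n))" for n
  proof -
    have "(\<Sum>k=1..n. f k) = (\<Sum>k<n. g k)"
      by (simp add: g_def sum.atLeast1_atMost_eq)
    then have "norm ((\<Sum>k=1..n. f k) - suminf g) = norm (suminf (\<lambda>k. g (k + n)))"
      using suminf_split_initial_segment[OF summ, of n] by (simp add: norm_minus_commute)
    also have "\<dots> \<le> suminf (\<lambda>k. 4 * C * (t (k + n) - t (Suc (k + n))))"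
      by (rule norm_suminf_le[OF bound sums_summable[OF sums]])
    also have "\<dots> = 4 * C / sqrt (real (Suc n))"
      unfolding sums_unique[OF sums, symmetric] by (simp add: t_def)
    finally show ?thesis .
  qed
  then show ?thesis using C by (intro exI[of _ "suminf g"]) (auto simp: fast_limit_def intro!: exI[of _ "4 * C"])
qed

section \<open>Divergent truncated sums\<close>

lemma sqrt_div_self: "sqrt (real k) / real k = 1 / sqrt (real k)"
  by (cases "k = 0") (simp_all add: field_simps)

text \<open>An increment is a value for the tail of \<open>w\<close> divided by at least
  \<open>k\<close>, so the growth bound gains a factor \<open>k\<close>. This controls the
  increments in the summation by parts.\<close>

lemma hsum_diff_bound:
  assumes "N \<ge> 1" "w \<in> lists (yletters N)"
  shows "\<exists>D\<ge>0. \<forall>k\<ge>1. norm (hsum w k - hsum w (k - 1)) \<le> D / sqrt (real k)"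
proof (cases w)
  case Nil
  then show ?thesis by (intro exI[of _ 0]) auto
next
  case (Cons a u)
  obtain C where C: "C \<ge> 0" "\<And>n. norm (hsum u n) \<le> C * sqrt (real (Suc n))"
    using hsum_growth[OF assms(1), of u] assms(2) Cons by auto
  have a: "fst a \<ge> 1" "norm (snd a) = 1"
    using assms Cons norm_roots_unity by (auto simp: yletters_def)
  have "norm (hsum w k - hsum w (k - 1)) \<le> C / sqrt (real k)" if k1: "k \<ge> 1" for k
  proof -
    obtain j where k: "k = Suc j" using k1 by (cases k) auto
    have "norm (hsum w k - hsum w (k - 1)) = norm (hsum u j) / real k ^ fst a"
      unfolding k Cons hsum_Suc by (simp add: norm_mult norm_divide norm_power a del: of_nat_Suc)
    also have "\<dots> \<le> (C * sqrt (real k)) / real k ^ 1"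
      using C k a(1) by (intro frac_le power_increasing) auto
    also have "\<dots> = C / sqrt (real k)"
      by (simp only: power_one_right times_divide_eq_right[symmetric] sqrt_div_self) simp
    finally show ?thesis .
  qed
  then show ?thesis using C(1) by blast
qed

text \<open>Abel summation against the geometric sequence. The right side is bracketed, with an
  explicit factor -1, so that the closure rules of \<open>fast_limit\<close> apply to it as it
  stands.\<close>

lemma summation_by_parts_geometric:
  fixes \<mu> :: complex
  assumes "\<mu> \<noteq> 1"
  shows "(\<Sum>k=1..n. \<mu> ^ k * g k)
    = 1 / (\<mu> - 1) * (\<mu> ^ Suc n * g (Suc n) + (- \<mu> * g 1 + (- 1) * (\<Sum>k=1..n. \<mu> ^ Suc k * (g (Suc k) - g k))))"
  (is "?L n = 1 / (\<mu> - 1) * ?R n")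
proof -
  have "(\<mu> - 1) * ?L n = ?R n"
    by (induction n) (simp_all add: algebra_simps)
  then show ?thesis using assms by (simp add: field_simps)
qed

text \<open>If the first component is at least 2, the terms are of size k^(-3/2). If it is 1, then
  \<open>a \<noteq> y1\<close> forces a root of unity other than 1, and summation by parts trades
  its oscillation for increments of \<open>hsum w (k - 1) / k\<close>, again of size
  k^(-3/2).\<close>

lemma fast_limit_hsum:
  assumes N: "N \<ge> 1" and aw: "a # w \<in> lists (yletters N)" and "a \<noteq> y1"
  shows "\<exists>c. fast_limit (hsum (a # w)) c"
proof -
  obtain C where C: "C \<ge> 0" "\<And>n. norm (hsum w n) \<le> C * sqrt (real (Suc n))"
    using hsum_growth[OF N, of w] aw by auto
  have C': "norm (hsum w (k - 1)) \<le> C * sqrt (real k)" if "k \<ge> 1" for k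
    using C(2)[of "k - 1"] that by simp
  define \<mu> where "\<mu> = snd a"
  have a: "fst a \<ge> 1" and \<mu>: "norm \<mu> = 1"
    using aw norm_roots_unity[OF N] by (auto simp: yletters_def \<mu>_def)
  show ?thesis
  proof (cases "fst a \<ge> 2")
    case True
    have "norm (\<mu> ^ k / of_nat k ^ fst a * hsum w (k - 1)) \<le> C / (real k * sqrt (real k))"
      if k: "k \<ge> 1" for k
    proof -
      have "norm (\<mu> ^ k / of_nat k ^ fst a * hsum w (k - 1)) = norm (hsum w (k - 1)) / real k ^ fst a"
        by (simp add: norm_mult norm_divide norm_power \<mu>)
      also have "\<dots> \<le> (C * sqrt (real k)) / real k ^ 2"
        using C C'[OF k] k True by (intro frac_le power_increasing) auto
      also have "\<dots> = C / real k * (sqrt (real k) / real k)" by (simp add: power2_eq_square)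
      also have "\<dots> = C / (real k * sqrt (real k))" unfolding sqrt_div_self by simp
      finally show ?thesis .
    qed
    then show ?thesis
      using fast_limit_sum[OF C(1), of "\<lambda>k. \<mu> ^ k / of_nat k ^ fst a * hsum w (k - 1)"]
      by (simp add: hsum.simps(2)[abs_def] \<mu>_def)
  next
    case False
    then have a1: "fst a = 1" using a by simp
    then have \<mu>1: "\<mu> \<noteq> 1" using \<open>a \<noteq> y1\<close> by (cases a) (auto simp: y1_def \<mu>_def)
    define g where "g = (\<lambda>k. hsum w (k - 1) / of_nat k)"
    obtain D where D: "D \<ge> 0" "\<And>k. k \<ge> 1 \<Longrightarrow> norm (hsum w k - hsum w (k - 1)) \<le> D / sqrt (real k)"
      using hsum_diff_bound[OF N, of w] aw by auto
    have "\<exists>c. fast_limit (\<lambda>n. \<Sum>k=1..n. \<mu> ^ Suc k * (g (Suc k) - g k)) c"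
    proof (rule fast_limit_sum[of "C + D"])
      fix k :: nat assume k: "k \<ge> 1"
      \<comment> \<open>Quotient rule for differences: the first part is small by
        \<open>hsum_diff_bound\<close>, the second by the growth bound.\<close>
      have "g (Suc k) - g k = (hsum w k - hsum w (k - 1)) / of_nat (Suc k)
          - hsum w (k - 1) / (of_nat k * of_nat (Suc k))"
        using k by (simp add: g_def divide_simps del: of_nat_Suc) (simp add: algebra_simps)
      then have "norm (\<mu> ^ Suc k * (g (Suc k) - g k))
          \<le> norm (hsum w k - hsum w (k - 1)) / real (Suc k) + norm (hsum w (k - 1)) / (real k * real (Suc k))"
        using norm_triangle_ineq4[of "(hsum w k - hsum w (k - 1)) / of_nat (Suc k)"
            "hsum w (k - 1) / (of_nat k * of_nat (Suc k))"]
        by (simp add: norm_mult norm_power \<mu> norm_divide del: of_nat_Suc)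
      also have "\<dots> \<le> (D / sqrt (real k)) / real k + (C * sqrt (real k)) / (real k * real k)"
        using k C'[OF k] D(2)[OF k] C(1) D(1) by (intro add_mono frac_le mult_left_mono) auto
      also have "(C * sqrt (real k)) / (real k * real k) = C / real k * (sqrt (real k) / real k)" by simp
      also have "(D / sqrt (real k)) / real k + C / real k * (sqrt (real k) / real k)
          = (C + D) / (real k * sqrt (real k))"
        unfolding sqrt_div_self by (simp add: add_divide_distrib mult.commute)
      finally show "norm (\<mu> ^ Suc k * (g (Suc k) - g k)) \<le> (C + D) / (real k * sqrt (real k))" .
    qed (use C D in auto)
    then obtain c where c: "fast_limit (\<lambda>n. \<Sum>k=1..n. \<mu> ^ Suc k * (g (Suc k) - g k)) c" by blast
    have "norm (\<mu> ^ Suc n * g (Suc n)) \<le> C / sqrt (real (Suc n))" for n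
    proof -
      have "norm (\<mu> ^ Suc n * g (Suc n)) = norm (hsum w n) / real (Suc n)"
        by (simp add: norm_mult norm_power \<mu> norm_divide g_def del: of_nat_Suc)
      also have "\<dots> \<le> (C * sqrt (real (Suc n))) / real (Suc n)"
        using C(2)[of n] by (intro divide_right_mono) auto
      also have "\<dots> = C * (sqrt (real (Suc n)) / real (Suc n))" by simp
      also have "\<dots> = C / sqrt (real (Suc n))" unfolding sqrt_div_self by simp
      finally show ?thesis .
    qed
    then have "fast_limit (\<lambda>n. \<mu> ^ Suc n * g (Suc n)) 0"
      unfolding fast_limit_def diff_0_right using C(1) by blast
    from fast_limit_cmult[OF fast_limit_add[OF this fast_limit_add[OF fast_limit_const fast_limit_cmult[OF c]]]]
    have "fast_limit (\<lambda>n. \<Sum>k=1..n. \<mu> ^ k * g k) (1 / (\<mu> - 1) * (0 + (- \<mu> * g 1 + (- 1) * c)))"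
      unfolding summation_by_parts_geometric[OF \<mu>1] .
    moreover have "hsum (a # w) n = (\<Sum>k=1..n. \<mu> ^ k * g k)" for n
      by (simp add: hsum.simps(2) \<mu>_def g_def a1)
    ultimately show ?thesis by (auto simp: fast_limit_def)
  qed
qed

text \<open>
  The remainder \<open>hsum_rem w\<close> is what is left of \<open>hsum w\<close> after its divergent part, a combination of
  the sums attached to powers of the letter \<open>y1\<close>, has been split off.
\<close>

primrec hsum_rem :: "yletter list \<Rightarrow> nat \<Rightarrow> complex" where
  "hsum_rem [] n = 1"
| "hsum_rem (a # w) n =
     (if a = y1 then \<Sum>k=1..n. (hsum_rem w (k - 1) - lim (hsum_rem w)) / of_nat k else hsum (a # w) n)"

text \<open>For words over \<open>yletters N\<close> this is, by
  \<open>shuffle_reg_map_expand\<close>, the constant term of the shuffle regularization; without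
  leading \<open>y1\<close> it is the colored multiple zeta value itself.\<close>

definition reg_const :: "yletter list \<Rightarrow> complex" where
  "reg_const w = lim (hsum_rem w)"

text \<open>The limit subtracted in \<open>hsum_rem\<close> turns the summand for a leading
  \<open>y1\<close> into an error of size 1 / sqrt k divided by \<open>k\<close>, so the new sum
  converges at the same rate.\<close>

lemma fast_limit_hsum_rem:
  assumes N: "N \<ge> 1" and "w \<in> lists (yletters N)"
  shows "fast_limit (hsum_rem w) (reg_const w)"
proof -
  have "\<exists>c. fast_limit (hsum_rem w) c"
    using assms(2)
  proof (induction w)
    case Nil
    show ?case using fast_limit_const[of 1] by (auto simp: hsum_rem.simps(1)[abs_def])
  next
    case (Cons a w)
    show ?case
    proof (cases "a = y1")
      case False
      then show ?thesis using fast_limit_hsum[OF N _ False, of w] Cons by simp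
    next
      case True
      obtain c where "fast_limit (hsum_rem w) c" using Cons by auto
      then have "fast_limit (hsum_rem w) (lim (hsum_rem w))" using fast_limit_lim by blast
      then obtain C where C: "C \<ge> 0" "\<And>n. norm (hsum_rem w n - lim (hsum_rem w)) \<le> C / sqrt (real (Suc n))"
        by (auto simp: fast_limit_def)
      have "norm ((hsum_rem w (k - 1) - lim (hsum_rem w)) / of_nat k) \<le> C / (real k * sqrt (real k))"
        if k: "k \<ge> 1" for k
      proof -
        have "norm ((hsum_rem w (k - 1) - lim (hsum_rem w)) / of_nat k) = norm (hsum_rem w (k - 1) - lim (hsum_rem w)) / real k"
          by (simp add: norm_divide)
        also have "\<dots> \<le> (C / sqrt (real k)) / real k"
          using C(2)[of "k - 1"] k by (intro divide_right_mono) auto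
        finally show ?thesis by (simp add: mult.commute)
      qed
      from fast_limit_sum[OF C(1) this] show ?thesis using True by simp
    qed
  qed
  then show ?thesis unfolding reg_const_def using fast_limit_lim by blast
qed

text \<open>The limit subtracted at each leading \<open>y1\<close> comes back as a multiple of a sum
  over powers of \<open>y1\<close>, and each further prefix \<open>y1\<close> raises these powers by
  one. In place of a term with \<open>i = 0\<close> stands \<open>hsum_rem w\<close>, which tends to
  \<open>reg_const w\<close>.\<close>

lemma hsum_expand:
  "hsum w n = hsum_rem w n + (\<Sum>i=1..lead y1 w. reg_const (drop i w) * hsum (replicate i y1) n)"
proof (induction w arbitrary: n)
  case (Cons a w)
  show ?case
  proof (cases "a = y1")
    case True
    have ts: "hsum (replicate (Suc i) y1) n = (\<Sum>k=1..n. hsum (replicate i y1) (k - 1) / of_nat k)" for i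
      by (simp add: hsum.simps(2) y1_def)
    have "hsum (a # w) n = (\<Sum>k=1..n. hsum w (k - 1) / of_nat k)"
      by (simp add: hsum.simps(2) True y1_def)
    also have "\<dots> = (\<Sum>k=1..n. (hsum_rem w (k - 1) - lim (hsum_rem w)) / of_nat k
        + reg_const w * (hsum (replicate 0 y1) (k - 1) / of_nat k)
        + (\<Sum>i=1..lead y1 w. reg_const (drop i w) * (hsum (replicate i y1) (k - 1) / of_nat k)))"
      by (intro sum.cong refl, subst Cons.IH)
        (simp add: reg_const_def add_divide_distrib diff_divide_distrib sum_divide_distrib)
    also have "\<dots> = hsum_rem (a # w) n + reg_const w * hsum (replicate (Suc 0) y1) n
        + (\<Sum>i=1..lead y1 w. reg_const (drop i w) * hsum (replicate (Suc i) y1) n)"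
      unfolding ts sum.distrib using True
      by (subst sum.swap) (simp add: sum_distrib_left)
    also have "\<dots> = hsum_rem (a # w) n
        + (\<Sum>i=0..lead y1 w. reg_const (drop (Suc i) (a # w)) * hsum (replicate (Suc i) y1) n)"
      by (subst sum.atLeast_Suc_atMost) simp_all
    also have "(\<Sum>i=0..lead y1 w. reg_const (drop (Suc i) (a # w)) * hsum (replicate (Suc i) y1) n)
        = (\<Sum>i=1..lead y1 (a # w). reg_const (drop i (a # w)) * hsum (replicate i y1) n)"
      unfolding lead_simps if_P[OF True] One_nat_def sum.shift_bounds_cl_Suc_ivl ..
    finally show ?thesis .
  qed simp
qed simp

lemma hsum_y1: "hsum [y1] n = of_real (harm n)"
  by (simp add: hsum.simps(2) y1_def harm_def inverse_eq_divide)

lemma norm_hsum_y1: "norm (hsum [y1] n) = harm n"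
  by (simp add: hsum_y1 harm_nonneg)

lemma filterlim_hsum_y1: "filterlim (hsum [y1]) at_infinity sequentially"
  using harm_at_top by (intro filterlim_norm_at_top_imp_at_infinity) (simp add: norm_hsum_y1)

text \<open>Serves both limits: 1 / sqrt n is of order exp (- h / 2) for the harmonic number
  \<open>h\<close>, and the error of the Abel means is bounded by a multiple of exp (- h / 4) with h
  = - ln (1 - z).\<close>

lemma rapid_null_exp:
  assumes lim: "filterlim (\<lambda>x. norm (h x)) at_top F" and c: "c > 0"
    and bound: "eventually (\<lambda>x. norm (f x) \<le> C * exp (- c * norm (h x))) F"
  shows "rapid_null F h f"
  unfolding rapid_null_def
proof
  fix J
  have "filterlim (\<lambda>x. c * norm (h x)) at_top F"
    using filterlim_tendsto_pos_mult_at_top[OF tendsto_const c lim] .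
  from filterlim_compose[OF tendsto_power_div_exp_0[of J] this]
  have "((\<lambda>x. C / c ^ J * ((c * norm (h x)) ^ J / exp (c * norm (h x)))) \<longlongrightarrow> C / c ^ J * 0) F"
    by (intro tendsto_mult tendsto_const)
  then have lim0: "((\<lambda>x. C / c ^ J * ((c * norm (h x)) ^ J / exp (c * norm (h x)))) \<longlongrightarrow> 0) F"
    by simp
  show "((\<lambda>x. f x * h x ^ J) \<longlongrightarrow> 0) F"
  proof (rule Lim_null_comparison[OF _ lim0])
    show "eventually (\<lambda>x. norm (f x * h x ^ J) \<le> C / c ^ J * ((c * norm (h x)) ^ J / exp (c * norm (h x)))) F"
      using bound
    proof eventually_elim
      case (elim x)
      have "norm (f x * h x ^ J) \<le> C * exp (- c * norm (h x)) * norm (h x) ^ J"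
        unfolding norm_mult norm_power using elim by (intro mult_right_mono) auto
      also have "\<dots> = C / c ^ J * ((c * norm (h x)) ^ J / exp (c * norm (h x)))"
        using c by (simp add: exp_minus power_mult_distrib field_simps)
      finally show ?case .
    qed
  qed
qed

lemma harm_le_ln: "harm n \<le> 1 + ln (real (Suc n))"
proof (cases n)
  case (Suc m)
  have "harm n - ln (real n) \<le> harm 1 - ln (real 1)"
    using euler_mascheroni_sequence_decreasing[of 1 n] Suc by simp
  moreover have "ln (real n) \<le> ln (real (Suc n))" using Suc by simp
  moreover have "harm 1 - ln (real 1) = (1 :: real)" by (simp add: harm_def)
  ultimately show ?thesis by linarith
qed (simp add: harm_def)

lemma fast_limit_imp_rapid_null:
  assumes "fast_limit f c"
  shows "rapid_null sequentially (hsum [y1]) (\<lambda>n. f n - c)"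
proof -
  obtain C where C: "C \<ge> 0" "\<And>n. norm (f n - c) \<le> C / sqrt (real (Suc n))"
    using assms by (auto simp: fast_limit_def)
  have "norm (f n - c) \<le> C * exp (1 / 2) * exp (- (1 / 2) * norm (hsum [y1] n))" for n
  proof -
    have "ln (sqrt (real (Suc n))) = ln (real (Suc n)) / 2" by (simp add: ln_sqrt)
    then have "1 / sqrt (real (Suc n)) = exp (- (ln (real (Suc n)) / 2))"
      by (metis exp_ln exp_minus inverse_eq_divide of_nat_0_less_iff real_sqrt_gt_zero zero_less_Suc)
    \<comment> \<open>Passing from the logarithm to the harmonic number costs the factor exp (1 /
      2).\<close>
    also have "\<dots> \<le> exp (1 / 2 - harm n / 2)"
      using harm_le_ln[of n] by simp
    also have "\<dots> = exp (1 / 2) * exp (- (1 / 2) * norm (hsum [y1] n))"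
      unfolding exp_add[symmetric] norm_hsum_y1 by simp
    finally have "C * (1 / sqrt (real (Suc n))) \<le> C * (exp (1 / 2) * exp (- (1 / 2) * norm (hsum [y1] n)))"
      using C(1) by (rule mult_left_mono)
    then show ?thesis using C(2)[of n] by simp
  qed
  then show ?thesis
    using harm_at_top by (intro rapid_null_exp[of _ _ "1 / 2" _ "C * exp (1 / 2)"] always_eventually allI)
      (simp_all add: norm_hsum_y1)
qed

section \<open>The stuffle regularization\<close>

lemma lead_0_fast_limit:
  assumes "N \<ge> 1" "w \<in> lists (yletters N)" "lead y1 w = 0"
  shows "\<exists>c. fast_limit (hsum w) c"
proof (cases w)
  case Nil
  then show ?thesis using fast_limit_const[of 1] by (auto simp: hsum.simps(1)[abs_def])
next
  case (Cons a u)
  then show ?thesis using fast_limit_hsum[of N a u] assms by (auto split: if_splits)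
qed

text \<open>The leading letter recursion read on truncated sums: the factor
  \<open>hsum [y1] n\<close> becomes the variable, so the polynomial of \<open>y1 # v\<close> is the
  variable times that of \<open>v\<close>, minus those of the remainder words, divided by the length
  of the new run.\<close>

lemma ex_hsum_poly:
  assumes N: "N \<ge> 1" and "w \<in> lists (yletters N)"
  shows "\<exists>P. rapid_null sequentially (hsum [y1]) (\<lambda>n. hsum w n - poly P (hsum [y1] n))"
  using assms(2)
proof (induction w rule: lead_induct[where l = y1])
  case (zero w)
  then obtain c where "fast_limit (hsum w) c" using lead_0_fast_limit[OF N] by blast
  then show ?case using fast_limit_imp_rapid_null[of "hsum w" c] by (intro exI[of _ "[:c:]"]) simp
next
  case (step v)
  define L where "L = (of_nat (Suc (lead y1 v)) :: complex)"
  have L: "L \<noteq> 0" unfolding L_def using of_nat_neq_0 by blast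
  obtain r where r: "stuffle_words [y1] v = nc_scale (of_nat (Suc (lead y1 v))) (word_poly (y1 # v)) + r"
    "Poly_Mapping.keys r \<subseteq> {w \<in> lists (yletters N). lead y1 w \<le> lead y1 v}"
    using stuffle_y1_word[of v N] step by auto
  have "\<forall>w\<in>Poly_Mapping.keys r. \<exists>P. rapid_null sequentially (hsum [y1]) (\<lambda>n. hsum w n - poly P (hsum [y1] n))"
    using step.IH r(2) by blast
  then obtain R where R: "\<And>w. w \<in> Poly_Mapping.keys r \<Longrightarrow>
      rapid_null sequentially (hsum [y1]) (\<lambda>n. hsum w n - poly (R w) (hsum [y1] n))"
    by metis
  obtain V where V: "rapid_null sequentially (hsum [y1]) (\<lambda>n. hsum v n - poly V (hsum [y1] n))"
    using step by auto
  define P where "P = smult (inverse L) ([:0, 1:] * V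
      - (\<Sum>w\<in>Poly_Mapping.keys r. smult (of_rat (Poly_Mapping.lookup r w)) (R w)))"
  have h: "hsum (y1 # v) n = inverse L * (hsum v n * hsum [y1] n - lin_ext (\<lambda>w. hsum w n) r)" for n
  proof -
    have "hsum [y1] n * hsum v n = L * hsum (y1 # v) n + lin_ext (\<lambda>w. hsum w n) r"
      unfolding hsum_stuffle[symmetric] r(1) lin_ext_add lin_ext_nc_scale L_def by (simp only: of_rat_of_nat_eq lin_ext_word_poly)
    then show ?thesis using L by (simp add: field_simps)
  qed
  have "rapid_null sequentially (hsum [y1]) (\<lambda>n. inverse L * ((hsum v n - poly V (hsum [y1] n)) * hsum [y1] n
     - (\<Sum>w\<in>Poly_Mapping.keys r. of_rat (Poly_Mapping.lookup r w) * (hsum w n - poly (R w) (hsum [y1] n)))))"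
    by (intro rapid_null_cmult rapid_null_diff rapid_null_mult_h V rapid_null_sum R)
  also have "(\<lambda>n. inverse L * ((hsum v n - poly V (hsum [y1] n)) * hsum [y1] n
     - (\<Sum>w\<in>Poly_Mapping.keys r. of_rat (Poly_Mapping.lookup r w) * (hsum w n - poly (R w) (hsum [y1] n)))))
     = (\<lambda>n. hsum (y1 # v) n - poly P (hsum [y1] n))"
  proof
    fix n
    define S where "S = (\<Sum>w\<in>Poly_Mapping.keys r. of_rat (Poly_Mapping.lookup r w) * poly (R w) (hsum [y1] n))"
    have "(\<Sum>w\<in>Poly_Mapping.keys r. of_rat (Poly_Mapping.lookup r w) * (hsum w n - poly (R w) (hsum [y1] n)))
        = lin_ext (\<lambda>w. hsum w n) r - S"
      by (simp add: lin_ext_def S_def right_diff_distrib sum_subtractf)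
    moreover have "poly P (hsum [y1] n) = inverse L * (hsum [y1] n * poly V (hsum [y1] n) - S)"
      by (simp add: P_def S_def poly_sum)
    ultimately show "inverse L * ((hsum v n - poly V (hsum [y1] n)) * hsum [y1] n
     - (\<Sum>w\<in>Poly_Mapping.keys r. of_rat (Poly_Mapping.lookup r w) * (hsum w n - poly (R w) (hsum [y1] n))))
     = hsum (y1 # v) n - poly P (hsum [y1] n)"
      unfolding h by (simp only:) (simp add: algebra_simps)
  qed
  finally show ?case by blast
qed

lemma yword_index:
  assumes "w \<in> lists (yletters N)"
  shows "cmzv_index N (map fst w) (map snd w)" "w = zip (map fst w) (map snd w)"
    "lead y1 w = 0 \<Longrightarrow> convergent_index N (map fst w) (map snd w)"
proof -
  show 1: "cmzv_index N (map fst w) (map snd w)"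
    using assms by (force simp: cmzv_index_def yletters_def)
  show "w = zip (map fst w) (map snd w)" by (simp add: zip_map_fst_snd)
  show "convergent_index N (map fst w) (map snd w)" if "lead y1 w = 0"
    using 1 that by (cases w) (auto simp: convergent_index_def y1_def split: if_splits)
qed

lemma index_yword:
  assumes "cmzv_index N s e"
  shows "zip s e \<in> lists (yletters N)"
    "convergent_index N s e \<Longrightarrow> lead y1 (zip s e) = 0"
proof -
  show "zip s e \<in> lists (yletters N)"
    using assms by (auto simp: cmzv_index_def yletters_def elim!: in_set_zipE)
  show "lead y1 (zip s e) = 0" if "convergent_index N s e"
    using assms that by (cases s; cases e) (auto simp: cmzv_index_def convergent_index_def y1_def)
qed

lemma cmzv_eq_lim_hsum:
  assumes "cmzv_index N s e" shows "cmzv s e = lim (hsum (zip s e))"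
  using assms by (simp add: cmzv_def cmzv_partial_eq_hsum cmzv_index_def)

lemma fast_limit_cmzv:
  assumes "N \<ge> 1" "convergent_index N s e"
  shows "fast_limit (hsum (zip s e)) (cmzv s e)"
proof -
  have ix: "cmzv_index N s e" using assms(2) by (simp add: convergent_index_def)
  obtain c where "fast_limit (hsum (zip s e)) c"
    using lead_0_fast_limit[OF assms(1) index_yword(1)[OF ix] index_yword(2)[OF ix assms(2)]] by blast
  then show ?thesis using fast_limit_lim cmzv_eq_lim_hsum[OF ix] by metis
qed

lemma stuffle_regularization_asymp:
  assumes N: "N \<ge> 1"
  obtains f where "stuffle_regularization N f"
    "\<And>w. w \<in> lists (yletters N) \<Longrightarrow>
      rapid_null sequentially (hsum [y1]) (\<lambda>n. hsum w n - poly (f (word_poly w)) (hsum [y1] n))"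
proof -
  obtain f where f: "algebra_hom_on {p. Poly_Mapping.keys p \<subseteq> lists (yletters N)} stuffle_prod f"
    "\<And>w P. rapid_null sequentially (hsum [y1]) (\<lambda>n. hsum w n - poly P (hsum [y1] n)) \<Longrightarrow> f (word_poly w) = P"
  proof (rule regularization_exists[where F = sequentially and h = "hsum [y1]" and \<Phi> = "\<lambda>n w. hsum w n"
        and G = "lists (yletters N)" and M = stuffle_prod])
    show "filterlim (hsum [y1]) at_infinity sequentially" by (rule filterlim_hsum_y1)
    show "\<exists>P. rapid_null sequentially (hsum [y1]) (\<lambda>n. hsum w n - poly P (hsum [y1] n))"
      if "w \<in> lists (yletters N)" for w using ex_hsum_poly[OF N that] .
    show "eventually (\<lambda>n. lin_ext (\<lambda>w. hsum w n) (stuffle_prod p q)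
        = lin_ext (\<lambda>w. hsum w n) p * lin_ext (\<lambda>w. hsum w n) q) sequentially" for p q
      unfolding stuffle_prod_def by (intro always_eventually allI lin_ext_bilinear_ext hsum_stuffle)
  qed auto
  have "stuffle_regularization N f"
    unfolding stuffle_regularization_def A1y_eq
  proof (intro conjI allI impI f(1))
    show "f (word_poly (zip s e)) = [:cmzv s e:]" if "convergent_index N s e" for s e
      using fast_limit_imp_rapid_null[OF fast_limit_cmzv[OF N that]] by (intro f(2)) simp
    show "f (word_poly [(1, 1)]) = [:0, 1:]"
      by (intro f(2)) (simp add: y1_def)
  qed
  moreover have "rapid_null sequentially (hsum [y1]) (\<lambda>n. hsum w n - poly (f (word_poly w)) (hsum [y1] n))"
    if w: "w \<in> lists (yletters N)" for w
    using ex_hsum_poly[OF N w] f(2) by metis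
  ultimately show thesis using that by blast
qed

lemma stuffle_regularization_stuffle_reg_map:
  assumes "N \<ge> 1" shows "stuffle_regularization N (stuffle_reg_map N)"
  unfolding stuffle_reg_map_def
  using stuffle_regularization_asymp[OF assms] by (metis someI)

text \<open>By uniqueness the chosen regularization takes on words the values of the one built from
  truncated sums.\<close>

lemma stuffle_reg_map_asymp:
  assumes N: "N \<ge> 1" and w: "w \<in> lists (yletters N)"
  shows "rapid_null sequentially (hsum [y1])
    (\<lambda>n. hsum w n - poly (stuffle_reg_map N (word_poly w)) (hsum [y1] n))"
proof -
  obtain f where f: "stuffle_regularization N f"
    "\<And>w. w \<in> lists (yletters N) \<Longrightarrow>
      rapid_null sequentially (hsum [y1]) (\<lambda>n. hsum w n - poly (f (word_poly w)) (hsum [y1] n))"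
    by (rule stuffle_regularization_asymp[OF N]) (erule that, blast)
  have g: "stuffle_regularization N (stuffle_reg_map N)"
    by (rule stuffle_regularization_stuffle_reg_map[OF N])
  have "stuffle_reg_map N (word_poly w) = f (word_poly w)"
  proof (rule algebra_hom_on_unique[OF _ _ leading_letter_law_stuffle _ _ w])
    fix u assume u: "u \<in> lists (yletters N)" "lead y1 u = 0"
    show "stuffle_reg_map N (word_poly u) = f (word_poly u)"
      using f(1) g yword_index(2,3)[OF u(1)] u(2) unfolding stuffle_regularization_def by metis
  qed (use f(1) g in \<open>auto simp: stuffle_regularization_def A1y_eq y1_def\<close>)
  then show ?thesis using f(2)[OF w] by simp
qed

text \<open>The polynomial p_i of the overview. Level 1 is an arbitrary fixed choice: the truncated
  sums of powers of \<open>y1\<close> do not see the level, whence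
  \<open>stuffle_reg_map_replicate\<close>.\<close>

definition stuffle_pow :: "nat \<Rightarrow> complex poly" where
  "stuffle_pow i = stuffle_reg_map 1 (word_poly (replicate i y1))"

lemma replicate_y1 [simp]: "replicate i y1 \<in> lists (yletters N)"
  by (auto simp: in_lists_conv_set)

lemma stuffle_reg_map_replicate:
  assumes "N \<ge> 1" shows "stuffle_reg_map N (word_poly (replicate i y1)) = stuffle_pow i"
  unfolding stuffle_pow_def
  by (rule rapid_null_poly_unique[OF _ filterlim_hsum_y1 stuffle_reg_map_asymp stuffle_reg_map_asymp]) (use assms in auto)

lemma stuffle_pow_asymp:
  "rapid_null sequentially (hsum [y1]) (\<lambda>n. hsum (replicate i y1) n - poly (stuffle_pow i) (hsum [y1] n))"
  unfolding stuffle_pow_def by (rule stuffle_reg_map_asymp) auto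

lemma stuffle_pow_0 [simp]: "stuffle_pow 0 = 1"
  using stuffle_regularization_stuffle_reg_map[of 1]
  by (simp add: stuffle_pow_def stuffle_regularization_def algebra_hom_on_def)

text \<open>Both sides approximate \<open>hsum w\<close>: in \<open>hsum_expand\<close> the
  remainder is replaced by its limit and each power of \<open>y1\<close> by its polynomial.\<close>

lemma stuffle_reg_map_expand:
  assumes N: "N \<ge> 1" and w: "w \<in> lists (yletters N)"
  shows "stuffle_reg_map N (word_poly w) = (\<Sum>i\<le>lead y1 w. smult (reg_const (drop i w)) (stuffle_pow i))"
proof (rule rapid_null_poly_unique[OF _ filterlim_hsum_y1 stuffle_reg_map_asymp[OF assms]])
  let ?h = "hsum [y1]"
  have "rapid_null sequentially ?h (\<lambda>n. (hsum_rem w n - reg_const w) + (\<Sum>i=1..lead y1 w. reg_const (drop i w) *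
     (hsum (replicate i y1) n - poly (stuffle_pow i) (?h n))))"
    by (intro rapid_null_add rapid_null_sum rapid_null_cmult stuffle_pow_asymp fast_limit_imp_rapid_null fast_limit_hsum_rem[OF N w])
  moreover have "{..lead y1 w} = insert 0 {1..lead y1 w}" by auto
  ultimately show "rapid_null sequentially ?h (\<lambda>n. hsum w n
      - poly (\<Sum>i\<le>lead y1 w. smult (reg_const (drop i w)) (stuffle_pow i)) (?h n))"
    by (subst hsum_expand) (simp add: poly_sum algebra_simps sum_subtractf)
qed simp

section \<open>Membership of the constants in the algebra of colored multiple zeta values\<close>

lemma cyclotomic_field_0: "0 \<in> cyclotomic_field N"
  using cyclotomic_field.diff[OF cyclotomic_field.root cyclotomic_field.root, of 1 N 1]
  by (simp add: roots_unity_def)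

lemma cyclotomic_field_add: "x \<in> cyclotomic_field N \<Longrightarrow> y \<in> cyclotomic_field N \<Longrightarrow> x + y \<in> cyclotomic_field N"
  using cyclotomic_field.diff[OF _ cyclotomic_field.diff[OF cyclotomic_field_0], of x N y] by simp

lemma cyclotomic_field_of_nat: "of_nat n \<in> cyclotomic_field N"
proof (induction n)
  case (Suc n)
  have "1 \<in> cyclotomic_field N" by (rule cyclotomic_field.root) (simp add: roots_unity_def)
  then show ?case using Suc cyclotomic_field_add by simp
qed (simp add: cyclotomic_field_0)

lemma cyclotomic_field_of_int: "of_int n \<in> cyclotomic_field N"
proof (cases n)
  case (nonneg k)
  then show ?thesis using cyclotomic_field_of_nat by simp
next
  case (neg k)
  then show ?thesis
    using cyclotomic_field.diff[OF cyclotomic_field_0 cyclotomic_field_of_nat[of "Suc k"]]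
    by (simp only: neg of_int_minus of_int_of_nat_eq diff_0)
qed

lemma cyclotomic_field_of_rat: "of_rat q \<in> cyclotomic_field N"
proof (cases q)
  case (Fract a b)
  then show ?thesis
    using cyclotomic_field.mult[OF cyclotomic_field_of_int cyclotomic_field.inverse[OF cyclotomic_field_of_int], where N = N]
    by (simp add: of_rat_rat divide_inverse)
qed

lemma cmzv_algebra_of_rat: "of_rat q \<in> cmzv_algebra N"
  by (intro cmzv_algebra.scalar cyclotomic_field_of_rat)

lemma cmzv_algebra_0: "0 \<in> cmzv_algebra N" and cmzv_algebra_1: "1 \<in> cmzv_algebra N"
  using cmzv_algebra_of_rat[of 0 N] cmzv_algebra_of_rat[of 1 N] by simp_all

lemma cmzv_algebra_diff: "x \<in> cmzv_algebra N \<Longrightarrow> y \<in> cmzv_algebra N \<Longrightarrow> x - y \<in> cmzv_algebra N"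
  using cmzv_algebra.add[OF _ cmzv_algebra.mult[OF cmzv_algebra_of_rat[of "-1"]], of x N y] by simp

lemma cmzv_algebra_sum: "(\<And>i. i \<in> I \<Longrightarrow> f i \<in> cmzv_algebra N) \<Longrightarrow> sum f I \<in> cmzv_algebra N"
  by (induction I rule: infinite_finite_induct) (auto intro: cmzv_algebra.add cmzv_algebra_0)

text \<open>At \<open>T = 0\<close> the factor belonging to \<open>[y1]\<close> vanishes, so the
  recursion leaves a rational combination of values at words with a shorter run, down to convergent
  values.\<close>

lemma stuffle_reg_map_0_in_algebra:
  assumes N: "N \<ge> 1" and "w \<in> lists (yletters N)"
  shows "poly (stuffle_reg_map N (word_poly w)) 0 \<in> cmzv_algebra N"
  using assms(2)
proof (induction w rule: lead_induct[where l = y1])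
  case (zero w)
  have "stuffle_reg_map N (word_poly w) = [:cmzv (map fst w) (map snd w):]"
    using stuffle_regularization_stuffle_reg_map[OF N] yword_index[OF zero(1)] zero(2)
    unfolding stuffle_regularization_def by metis
  then show ?case using yword_index(3)[OF zero] by (simp add: cmzv_algebra.zeta_value)
next
  case (step v)
  have reg: "stuffle_regularization N (stuffle_reg_map N)"
    by (rule stuffle_regularization_stuffle_reg_map[OF N])
  then have hom: "algebra_hom_on {p. Poly_Mapping.keys p \<subseteq> lists (yletters N)} stuffle_prod (stuffle_reg_map N)"
    by (simp add: stuffle_regularization_def A1y_eq)
  obtain r where r: "Poly_Mapping.keys r \<subseteq> {w \<in> lists (yletters N). lead y1 w \<le> lead y1 v}"
    "stuffle_reg_map N (word_poly (y1 # v)) = smult (inverse (of_nat (Suc (lead y1 v))))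
       (stuffle_reg_map N (word_poly [y1]) * stuffle_reg_map N (word_poly v)
         - (\<Sum>w\<in>Poly_Mapping.keys r. smult (of_rat (Poly_Mapping.lookup r w)) (stuffle_reg_map N (word_poly w))))"
    by (rule algebra_hom_on_leading_letter[OF hom leading_letter_law_stuffle step(1)]) (erule that)
  have 0: "poly (stuffle_reg_map N (word_poly [y1])) 0 = 0"
    using reg by (simp add: stuffle_regularization_def y1_def)
  have "(\<Sum>w\<in>Poly_Mapping.keys r. of_rat (Poly_Mapping.lookup r w) * poly (stuffle_reg_map N (word_poly w)) 0)
      \<in> cmzv_algebra N"
    using step(2) r(1) by (intro cmzv_algebra_sum cmzv_algebra.mult cmzv_algebra_of_rat) blast
  moreover have "inverse (of_nat (Suc (lead y1 v))) \<in> cmzv_algebra N"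
    by (intro cmzv_algebra.scalar cyclotomic_field.inverse cyclotomic_field_of_nat)
  ultimately have "inverse (of_nat (Suc (lead y1 v))) *
      (0 - (\<Sum>w\<in>Poly_Mapping.keys r. of_rat (Poly_Mapping.lookup r w) * poly (stuffle_reg_map N (word_poly w)) 0))
      \<in> cmzv_algebra N"
    by (intro cmzv_algebra.mult cmzv_algebra_diff cmzv_algebra_0)
  then show ?case unfolding r(2) by (simp add: 0 poly_sum del: of_nat_Suc)
qed

text \<open>The expansion at \<open>T = 0\<close> is solved for its term \<open>i = 0\<close>, whose
  polynomial is 1; the other constants belong to shorter words.\<close>

lemma reg_const_in_algebra:
  assumes N: "N \<ge> 1" and "w \<in> lists (yletters N)"
  shows "reg_const w \<in> cmzv_algebra N"
  using assms(2)
proof (induction w rule: length_induct)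
  case (1 w)
  have "{..lead y1 w} = insert 0 {1..lead y1 w}" by auto
  then have "reg_const w = poly (stuffle_reg_map N (word_poly w)) 0
      - (\<Sum>i=1..lead y1 w. reg_const (drop i w) * poly (stuffle_reg_map N (word_poly (replicate i y1))) 0)"
    unfolding stuffle_reg_map_expand[OF N 1(2)] stuffle_reg_map_replicate[OF N] by (simp add: poly_sum)
  also have "\<dots> \<in> cmzv_algebra N"
  proof (intro cmzv_algebra_diff cmzv_algebra_sum cmzv_algebra.mult stuffle_reg_map_0_in_algebra[OF N])
    fix i assume i: "i \<in> {1..lead y1 w}"
    then have "length (drop i w) < length w" using lead_le_length[of y1 w] by auto
    moreover have "drop i w \<in> lists (yletters N)" using 1(2) by (auto simp: in_lists_conv_set dest: in_set_dropD)
    ultimately show "reg_const (drop i w) \<in> cmzv_algebra N" using 1(1) by blast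
  qed (use 1 in auto)
  finally show ?case .
qed

section \<open>Multiple polylogarithms and the shuffle product\<close>

text \<open>\<open>z\<close> times the density of the differential form of the letter: dz / z for
  \<open>0\<close>, and a dz / (1 - a z), expanded as a geometric series, for nonzero
  \<open>a\<close>.\<close>

definition omega :: "complex \<Rightarrow> complex fps" where
  "omega a = (if a = 0 then 1 else Abs_fps (\<lambda>k. if k = 0 then 0 else a ^ k))"

text \<open>
  Prefixing the letter \<open>a\<close> to \<open>w\<close> solves \<open>z (d/dz) f = omega a * g\<close> with \<open>f(0) = 0\<close>, where \<open>g\<close> is the series
  of \<open>w\<close>; for the empty word and \<open>a = 0\<close>, where no solution exists, \<open>f\<close> is \<open>0\<close>.
\<close>

primrec polylog_fps :: "complex list \<Rightarrow> complex fps" where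
  "polylog_fps [] = 1"
| "polylog_fps (a # w) = Abs_fps (\<lambda>n. if n = 0 then 0 else fps_nth (omega a * polylog_fps w) n / of_nat n)"

lemma polylog_fps_nonempty_0: "w \<noteq> [] \<Longrightarrow> fps_nth (polylog_fps w) 0 = 0"
  by (cases w) auto

lemma theta_polylog_fps:
  assumes "last (a # w) \<noteq> 0"
  shows "fps_X * fps_deriv (polylog_fps (a # w)) = omega a * polylog_fps w"
proof (rule fps_ext)
  fix n
  \<comment> \<open>The constant coefficient is the only one that the division by \<open>n\<close>
    loses. It vanishes because either \<open>a\<close> is nonzero or \<open>w\<close> is
    nonempty.\<close>
  have "fps_nth (omega a * polylog_fps w) 0 = 0"
    using assms polylog_fps_nonempty_0[of w] by (auto simp: omega_def split: if_splits)
  then show "fps_nth (fps_X * fps_deriv (polylog_fps (a # w))) n = fps_nth (omega a * polylog_fps w) n"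
    by (cases n) (simp_all add: of_nat_neq_0 del: of_nat_Suc)
qed

lemma lin_ext_polylog_fps_letter_mult:
  assumes "n > 0" and "\<And>k. lin_ext (\<lambda>w. fps_nth (polylog_fps w) k) p = fps_nth f k"
  shows "lin_ext (\<lambda>w. fps_nth (polylog_fps w) n) (letter_mult a p) = fps_nth (omega a * f) n / of_nat n"
proof -
  have "lin_ext (\<lambda>w. fps_nth (polylog_fps w) n) (letter_mult a p)
      = lin_ext (\<lambda>w. (1 / of_nat n) * (\<Sum>i=0..n. fps_nth (omega a) i * fps_nth (polylog_fps w) (n - i))) p"
    using assms(1) by (simp add: lin_ext_letter_mult fps_mult_nth)
  also have "\<dots> = (1 / of_nat n) * (\<Sum>i=0..n. fps_nth (omega a) i * fps_nth f (n - i))"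
    by (simp only: lin_ext_scale_fun lin_ext_sum_fun assms(2))
  finally show ?thesis by (simp add: fps_mult_nth)
qed

text \<open>The operator z d/dz is a derivation, and its product rule is the shuffle recursion. It
  determines all coefficients but that of index 0, which vanishes for nonempty words.\<close>

lemma polylog_fps_shuffle:
  assumes "u \<noteq> [] \<Longrightarrow> last u \<noteq> 0" "v \<noteq> [] \<Longrightarrow> last v \<noteq> 0"
  shows "lin_ext (\<lambda>w. fps_nth (polylog_fps w) n) (shuffle_words u v) = fps_nth (polylog_fps u * polylog_fps v) n"
  using assms
proof (induction u v arbitrary: n rule: shuffle_words.induct)
  case (3 a u b v)
  have IH1: "lin_ext (\<lambda>w. fps_nth (polylog_fps w) k) (shuffle_words u (b # v)) = fps_nth (polylog_fps u * polylog_fps (b # v)) k" for k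
    using "3.IH"(1)[of k] "3.prems" by (auto split: if_splits)
  have IH2: "lin_ext (\<lambda>w. fps_nth (polylog_fps w) k) (shuffle_words (a # u) v) = fps_nth (polylog_fps (a # u) * polylog_fps v) k" for k
    using "3.IH"(2)[of k] "3.prems" by (auto split: if_splits)
  show ?case
  proof (cases "n = 0")
    case True
    then show ?thesis by (simp add: lin_ext_add lin_ext_letter_mult lin_ext_def[where \<phi> = "\<lambda>_. 0"])
  next
    case False
    then obtain m where n: "n = Suc m" by (cases n) auto
    have "lin_ext (\<lambda>w. fps_nth (polylog_fps w) n) (shuffle_words (a # u) (b # v))
        = fps_nth (omega a * (polylog_fps u * polylog_fps (b # v)) + omega b * (polylog_fps (a # u) * polylog_fps v)) n / of_nat n"
      using False by (simp only: shuffle_words.simps lin_ext_add lin_ext_polylog_fps_letter_mult[OF _ IH1]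
          lin_ext_polylog_fps_letter_mult[OF _ IH2] fps_add_nth add_divide_distrib neq0_conv)
    also have "omega a * (polylog_fps u * polylog_fps (b # v)) + omega b * (polylog_fps (a # u) * polylog_fps v)
        = (omega a * polylog_fps u) * polylog_fps (b # v) + polylog_fps (a # u) * (omega b * polylog_fps v)"
      by (simp only: mult_ac)
    also have "\<dots> = fps_X * fps_deriv (polylog_fps (a # u) * polylog_fps (b # v))"
      unfolding theta_polylog_fps[OF "3.prems"(1)[OF list.distinct(2)], symmetric]
        theta_polylog_fps[OF "3.prems"(2)[OF list.distinct(2)], symmetric]
      by (simp only: fps_deriv_mult algebra_simps)
    also have "fps_nth \<dots> n / of_nat n = fps_nth (polylog_fps (a # u) * polylog_fps (b # v)) n"
      unfolding n fps_X_mult_nth fps_deriv_nth by (simp del: of_nat_Suc polylog_fps.simps)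
    finally show ?thesis .
  qed
qed auto

lemma polylog_fps_bound:
  assumes "\<And>a. a \<in> set w \<Longrightarrow> norm a \<le> 1"
  shows "norm (fps_nth (polylog_fps w) n) \<le> 1"
  using assms
proof (induction w arbitrary: n)
  case (Cons a w)
  have IH: "norm (fps_nth (polylog_fps w) k) \<le> 1" for k using Cons by simp
  show ?case
  proof (cases "n = 0")
    case False
    have "norm (fps_nth (omega a * polylog_fps w) n) \<le> real n"
    proof (cases "a = 0")
      case True
      then show ?thesis using IH[of n] False by (simp add: omega_def)
    next
      case a: False
      have "fps_nth (omega a * polylog_fps w) n = (\<Sum>i=0..n. if i = 0 then 0 else a ^ i * fps_nth (polylog_fps w) (n - i))"
        using a by (auto simp: fps_mult_nth omega_def intro!: sum.cong)
      also have "\<dots> = (\<Sum>i=1..n. a ^ i * fps_nth (polylog_fps w) (n - i))"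
        by (intro sum.mono_neutral_cong_right) auto
      also have "norm \<dots> \<le> (\<Sum>i=1..n. 1)"
        using Cons.prems IH by (intro sum_norm_le) (auto simp: norm_mult norm_power intro!: mult_le_one power_le_one)
      finally show ?thesis by simp
    qed
    then show ?thesis using False by (simp add: norm_divide divide_le_eq)
  qed simp
qed auto

lemma fps_conv_radius_ge_1:
  assumes "\<And>n. norm (fps_nth f n) \<le> C * real (Suc n)"
  shows "fps_conv_radius (f :: complex fps) \<ge> 1"
  unfolding fps_conv_radius_def
proof (rule conv_radius_geI_ex')
  fix r :: real assume r: "0 < r" "ereal r < 1"
  then have "(\<lambda>n. of_nat (Suc n) * r ^ n) sums (1 / (1 - r)\<^sup>2)"
    by (intro geometric_deriv_sums) auto
  then have "summable (\<lambda>n. C * (real (Suc n) * r ^ n))"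
    by (intro summable_mult sums_summable)
  then show "summable (\<lambda>n. fps_nth f n * of_real r ^ n)"
  proof (rule summable_comparison_test')
    fix n
    have "norm (fps_nth f n * of_real r ^ n) \<le> (C * real (Suc n)) * r ^ n"
      unfolding norm_mult norm_power using assms r order_trans[OF norm_ge_zero assms]
      by (intro mult_mono) auto
    then show "norm (fps_nth f n * of_real r ^ n) \<le> C * (real (Suc n) * r ^ n)" by (simp add: mult.assoc)
  qed
qed

lemma fps_conv_radius_polylog_fps:
  assumes "\<And>a. a \<in> set w \<Longrightarrow> norm a \<le> 1"
  shows "fps_conv_radius (polylog_fps w) \<ge> 1"
proof (rule fps_conv_radius_ge_1[of _ 1])
  fix n
  have "norm (fps_nth (polylog_fps w) n) \<le> 1" by (rule polylog_fps_bound[OF assms])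
  then show "norm (fps_nth (polylog_fps w) n) \<le> 1 * real (Suc n)" by simp
qed

definition polylog :: "real \<Rightarrow> complex list \<Rightarrow> complex" where
  "polylog z w = eval_fps (polylog_fps w) (of_real z)"

lemma polylog_sums:
  assumes "\<And>a. a \<in> set w \<Longrightarrow> norm a \<le> 1" "0 < z" "z < 1"
  shows "(\<lambda>n. fps_nth (polylog_fps w) n * of_real z ^ n) sums polylog z w"
proof -
  have "ereal z < fps_conv_radius (polylog_fps w)"
    using fps_conv_radius_polylog_fps[OF assms(1)] assms(3) by (metis less_le_trans less_ereal.simps(1) one_ereal_def)
  then show ?thesis
    unfolding polylog_def by (intro sums_eval_fps) (use assms in auto)
qed

lemma keys_shuffle_words: "w \<in> Poly_Mapping.keys (shuffle_words u v) \<Longrightarrow> set w \<subseteq> set u \<union> set v"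
proof (induction u v arbitrary: w rule: shuffle_words.induct)
  case (3 a u b v)
  from "3.prems" consider
      x where "x \<in> Poly_Mapping.keys (shuffle_words u (b # v))" "w = a # x"
    | x where "x \<in> Poly_Mapping.keys (shuffle_words (a # u) v)" "w = b # x"
    using Poly_Mapping.keys_add[of "letter_mult a (shuffle_words u (b # v))" "letter_mult b (shuffle_words (a # u) v)"]
      keys_letter_mult[of a "shuffle_words u (b # v)"] keys_letter_mult[of b "shuffle_words (a # u) v"]
    unfolding shuffle_words.simps by blast
  then show ?case using "3.IH"(1) "3.IH"(2) by cases fastforce+
qed auto

lemma polylog_shuffle:
  assumes "\<And>a. a \<in> set u \<union> set v \<Longrightarrow> norm a \<le> 1" "u \<noteq> [] \<Longrightarrow> last u \<noteq> 0" "v \<noteq> [] \<Longrightarrow> last v \<noteq> 0"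
    and z: "0 < z" "z < 1"
  shows "lin_ext (polylog z) (shuffle_words u v) = polylog z u * polylog z v"
proof -
  have "(\<lambda>n. \<Sum>w\<in>Poly_Mapping.keys (shuffle_words u v). of_rat (Poly_Mapping.lookup (shuffle_words u v) w)
          * (fps_nth (polylog_fps w) n * of_real z ^ n)) sums lin_ext (polylog z) (shuffle_words u v)"
    unfolding lin_ext_def using keys_shuffle_words[of _ u v] assms(1)
    by (intro sums_sum sums_mult polylog_sums z) blast
  moreover have "(\<Sum>w\<in>Poly_Mapping.keys (shuffle_words u v). of_rat (Poly_Mapping.lookup (shuffle_words u v) w)
          * (fps_nth (polylog_fps w) n * of_real z ^ n)) = fps_nth (polylog_fps u * polylog_fps v) n * of_real z ^ n" for n
    by (subst polylog_fps_shuffle[OF assms(2,3), symmetric]) (simp_all add: lin_ext_def sum_distrib_right mult.assoc)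
  ultimately have "(\<lambda>n. fps_nth (polylog_fps u * polylog_fps v) n * of_real z ^ n) sums lin_ext (polylog z) (shuffle_words u v)"
    by simp
  then have "lin_ext (polylog z) (shuffle_words u v) = eval_fps (polylog_fps u * polylog_fps v) (of_real z)"
    unfolding eval_fps_def using sums_unique by blast
  also have "\<dots> = polylog z u * polylog z v"
  proof -
    have "ereal (norm (of_real z :: complex)) < 1" using z by simp
    then show ?thesis
      unfolding polylog_def
      by (intro eval_fps_mult less_le_trans[OF _ fps_conv_radius_polylog_fps]) (use assms(1) in auto)
  qed
  finally show ?thesis .
qed

section \<open>Shuffle product with the divergent letter\<close>

definition xwords :: "nat \<Rightarrow> complex list set" where
  "xwords N = {w. set w \<subseteq> insert 0 (roots_unity N) \<and> (w = [] \<or> last w \<noteq> 0)}"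

lemma A1x_eq: "A1x N = {p. Poly_Mapping.keys p \<subseteq> xwords N}"
  by (auto simp: A1x_def xwords_def)

lemma one_in_roots_unity [simp]: "1 \<in> roots_unity N"
  by (simp add: roots_unity_def)

lemma xwords_tl: "b # v \<in> xwords N \<Longrightarrow> v \<in> xwords N"
  by (auto simp: xwords_def split: if_splits)

lemma xwords_Cons:
  "b # v \<in> xwords N \<Longrightarrow> w \<in> xwords N \<Longrightarrow> w \<noteq> [] \<Longrightarrow> b # w \<in> xwords N"
  by (auto simp: xwords_def)

text \<open>The clause \<open>w \<noteq> []\<close> strengthens the induction: prefixing
  \<open>b = 0\<close> keeps a word in \<open>xwords N\<close> only if that word is
  nonempty.\<close>

lemma shuffle_one_word:
  assumes "v \<in> xwords N"
  shows "\<exists>r. shuffle_words [1] v = nc_scale (of_nat (Suc (lead 1 v))) (word_poly (1 # v)) + r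
           \<and> Poly_Mapping.keys r \<subseteq> {w \<in> xwords N. w \<noteq> [] \<and> lead 1 w \<le> lead 1 v}"
  using assms
proof (induction v)
  case Nil
  show ?case by (rule exI[of _ 0]) simp
next
  case (Cons b v)
  have v: "v \<in> xwords N" using xwords_tl[OF Cons.prems] .
  obtain r where r: "shuffle_words [1] v = nc_scale (of_nat (Suc (lead 1 v))) (word_poly (1 # v)) + r"
    "Poly_Mapping.keys r \<subseteq> {w \<in> xwords N. w \<noteq> [] \<and> lead 1 w \<le> lead 1 v}"
    using Cons.IH[OF v] by auto
  let ?W = "\<lambda>k. {w \<in> xwords N. w \<noteq> [] \<and> lead 1 w \<le> k}"
  have e: "shuffle_words [1] (b # v) = word_poly (1 # b # v) + letter_mult b (shuffle_words [1] v)"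
    by simp
  have kr: "Poly_Mapping.keys (letter_mult b r) \<subseteq> ?W (if b = 1 then Suc (lead 1 v) else 0)"
  proof
    fix x assume "x \<in> Poly_Mapping.keys (letter_mult b r)"
    then obtain u where "x = b # u" "u \<in> Poly_Mapping.keys r" using keys_letter_mult[of b r] by blast
    moreover from this have "u \<in> xwords N" "u \<noteq> []" "lead 1 u \<le> lead 1 v" using r(2) by auto
    ultimately show "x \<in> ?W (if b = 1 then Suc (lead 1 v) else 0)"
      using xwords_Cons[OF Cons.prems] by simp
  qed
  have leadb: "lead 1 (b # v) = (if b = 1 then Suc (lead 1 v) else 0)" by simp
  show ?case
  proof (cases "b = 1")
    case True
    show ?thesis
    proof (intro exI conjI)
      show "shuffle_words [1] (b # v)
        = nc_scale (of_nat (Suc (lead 1 (b # v)))) (word_poly (1 # b # v)) + letter_mult b r"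
        unfolding e r(1) letter_mult_add letter_mult_nc_scale
        using True by (simp add: nc_scale_of_nat_Suc add_ac del: of_nat_Suc)
      show "Poly_Mapping.keys (letter_mult b r) \<subseteq> ?W (lead 1 (b # v))"
        using kr unfolding leadb .
    qed
  next
    case False
    let ?n = "nc_scale (of_nat (Suc (lead 1 v))) (word_poly (b # 1 # v))"
    have "Poly_Mapping.keys ?n \<subseteq> {b # 1 # v}"
      using keys_nc_scale[of _ "word_poly (b # 1 # v)"] by auto
    moreover have "1 # v \<in> xwords N" using v by (auto simp: xwords_def)
    then have "b # 1 # v \<in> ?W 0"
      using xwords_Cons[OF Cons.prems, of "1 # v"] False by simp
    ultimately have kn: "Poly_Mapping.keys ?n \<subseteq> ?W 0" by blast
    show ?thesis
    proof (intro exI conjI)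
      show "shuffle_words [1] (b # v)
        = nc_scale (of_nat (Suc (lead 1 (b # v)))) (word_poly (1 # b # v)) + (?n + letter_mult b r)"
        unfolding e r(1) letter_mult_add letter_mult_nc_scale
        using False by (simp add: add_ac)
      show "Poly_Mapping.keys (?n + letter_mult b r) \<subseteq> ?W (lead 1 (b # v))"
        using kr kn unfolding leadb if_not_P[OF False] by (intro keys_add_subset) simp_all
    qed
  qed
qed

lemma leading_letter_law_shuffle: "leading_letter_law (xwords N) 1 shuffle_prod"
  unfolding leading_letter_law_def shuffle_prod_def bilinear_ext_word_poly
proof (intro conjI allI impI)
  show "[1] \<in> xwords N" by (simp add: xwords_def)
  fix v assume "1 # v \<in> xwords N"
  then show v: "v \<in> xwords N" by (rule xwords_tl)
  show "\<exists>r. shuffle_words [1] v = nc_scale (of_nat (Suc (lead 1 v))) (word_poly (1 # v)) + r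
      \<and> Poly_Mapping.keys r \<subseteq> {w \<in> xwords N. lead 1 w \<le> lead 1 v}"
    using shuffle_one_word[OF v] by blast
qed

section \<open>Abel means of truncated sums\<close>

text \<open>The accumulator \<open>c\<close> is the product of the roots read so far, so the letters
  are the partial products that enter the definition of the shuffle values.\<close>

fun to_xword :: "complex \<Rightarrow> yletter list \<Rightarrow> complex list" where
  "to_xword c [] = []"
| "to_xword c ((m, \<eta>) # w) = replicate (m - 1) 0 @ (c * \<eta>) # to_xword (c * \<eta>) w"

definition dsum :: "yletter list \<Rightarrow> nat \<Rightarrow> complex" where
  "dsum w n = (if n = 0 then hsum w 0 else hsum w n - hsum w (n - 1))"

lemma sum_dsum: "(\<Sum>k\<le>n. dsum w k) = hsum w n"
  by (induction n) (simp_all add: dsum_def)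

lemma dsum_Nil: "dsum [] n = (if n = 0 then 1 else 0)"
  by (simp add: dsum_def)

lemma dsum_Cons: "n > 0 \<Longrightarrow> dsum (a # w) n = snd a ^ n / of_nat n ^ fst a * hsum w (n - 1)"
  by (cases n) (simp_all add: dsum_def hsum_Suc del: of_nat_Suc)

lemma dsum_Cons_0 [simp]: "dsum (a # w) 0 = 0"
  by (simp add: dsum_def)

lemma polylog_fps_replicate_0:
  "n > 0 \<Longrightarrow> fps_nth (polylog_fps (replicate j 0 @ v)) n = fps_nth (polylog_fps v) n / of_nat n ^ j"
  by (induction j) (simp_all add: omega_def)

text \<open>In the convolution the series of the tail contributes \<open>b ^ i\<close> and
  \<open>omega b\<close> contributes \<open>b ^ (n - i)\<close>. Their product does not depend on
  \<open>i\<close>, so the convolution collapses to a partial sum of \<open>dsum w\<close>; since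
  \<open>omega b\<close> has no constant term it stops at \<open>n - 1\<close>, which yields
  \<open>hsum w (n - 1)\<close>. The leading zeros only divide by powers of
  \<open>n\<close>.\<close>

lemma polylog_fps_to_xword:
  assumes "c \<noteq> 0" "\<And>a. a \<in> set w \<Longrightarrow> fst a \<ge> 1 \<and> snd a \<noteq> 0"
  shows "fps_nth (polylog_fps (to_xword c w)) n = c ^ n * dsum w n"
  using assms
proof (induction w arbitrary: c n)
  case Nil
  then show ?case by (simp add: dsum_Nil)
next
  case (Cons a w)
  obtain m \<eta> where a: "a = (m, \<eta>)" by (cases a)
  define b where "b = c * \<eta>"
  have b: "b \<noteq> 0" and m: "m \<ge> 1" using Cons.prems(1) Cons.prems(2)[of a] by (auto simp: a b_def)
  have IH: "fps_nth (polylog_fps (to_xword b w)) k = b ^ k * dsum w k" for k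
    using Cons.IH[OF b, of k] Cons.prems(2) by simp
  show ?case
  proof (cases "n = 0")
    case True
    have "to_xword c (a # w) \<noteq> []" by (simp add: a)
    then show ?thesis using True by (simp add: polylog_fps_nonempty_0)
  next
    case False
    then obtain l where n: "n = Suc l" by (cases n) auto
    have "fps_nth (omega b * polylog_fps (to_xword b w)) n = (\<Sum>i\<le>n. fps_nth (polylog_fps (to_xword b w)) i * fps_nth (omega b) (n - i))"
      by (simp only: mult.commute[of "omega b"] fps_mult_nth atLeast0AtMost)
    also have "\<dots> = (\<Sum>i\<le>l. b ^ n * dsum w i) + 0"
      unfolding n sum.atMost_Suc
    proof (intro arg_cong2[where f = "(+)"] sum.cong refl)
      fix i assume "i \<in> {..l}"
      then have "b ^ Suc l = b ^ i * b ^ (Suc l - i)" by (simp flip: power_add del: power_Suc)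
      then show "fps_nth (polylog_fps (to_xword b w)) i * fps_nth (omega b) (Suc l - i) = b ^ Suc l * dsum w i"
        using \<open>i \<in> {..l}\<close> b by (simp add: IH omega_def Suc_diff_le del: power_Suc)
    qed (use b in \<open>simp add: omega_def\<close>)
    also have "\<dots> = b ^ n * hsum w (n - 1)"
      by (simp add: n sum_dsum flip: sum_distrib_left)
    finally have "fps_nth (polylog_fps (b # to_xword b w)) n = b ^ n * hsum w (n - 1) / of_nat n"
      using False by simp
    then have "fps_nth (polylog_fps (to_xword c (a # w))) n = b ^ n * hsum w (n - 1) / of_nat n / of_nat n ^ (m - 1)"
      using False unfolding a to_xword.simps b_def[symmetric] by (simp only: polylog_fps_replicate_0 neq0_conv)
    also have "\<dots> = b ^ n * hsum w (n - 1) / of_nat n ^ m"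
      using m by (cases m) simp_all
    also have "\<dots> = c ^ n * dsum (a # w) n"
      using False by (simp add: dsum_Cons a b_def power_mult_distrib)
    finally show ?thesis .
  qed
qed

lemma polylog_fps_to_xword_hsum:
  assumes "\<And>a. a \<in> set w \<Longrightarrow> fst a \<ge> 1 \<and> snd a \<noteq> 0"
  shows "polylog_fps (to_xword 1 w) = (1 - fps_X) * Abs_fps (hsum w)"
proof (rule fps_ext)
  fix n show "fps_nth (polylog_fps (to_xword 1 w)) n = fps_nth ((1 - fps_X) * Abs_fps (hsum w)) n"
    using polylog_fps_to_xword[OF _ assms, of 1 w n] by (cases n) (simp_all add: left_diff_distrib dsum_def)
qed

lemma hsum_conv_radius:
  assumes "N \<ge> 1" "w \<in> lists (yletters N)"
  shows "fps_conv_radius (Abs_fps (hsum w)) \<ge> 1"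
proof -
  obtain C where C: "C \<ge> 0" "\<And>n. norm (hsum w n) \<le> C * sqrt (real (Suc n))"
    using hsum_growth[OF assms] by blast
  show ?thesis
  proof (rule fps_conv_radius_ge_1[of _ C])
    fix n
    have "sqrt (real (Suc n)) \<le> sqrt (real (Suc n) ^ 2)"
      unfolding real_sqrt_le_iff by (rule self_le_power) auto
    then have "C * sqrt (real (Suc n)) \<le> C * real (Suc n)"
      using C(1) by (intro mult_left_mono) (simp_all only: real_sqrt_abs abs_of_nat)
    then show "norm (fps_nth (Abs_fps (hsum w)) n) \<le> C * real (Suc n)"
      using C(2)[of n] unfolding fps_nth_Abs_fps by linarith
  qed
qed

lemma yletters_props:
  "N \<ge> 1 \<Longrightarrow> w \<in> lists (yletters N) \<Longrightarrow> a \<in> set w \<Longrightarrow> fst a \<ge> 1 \<and> snd a \<noteq> 0 \<and> norm (snd a) = 1"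
  using norm_roots_unity[of N "snd a"] by (fastforce simp: yletters_def)

lemma polylog_to_xword_sums:
  assumes N: "N \<ge> 1" and w: "w \<in> lists (yletters N)" and z: "0 < z" "z < 1"
  shows "(\<lambda>n. hsum w n * of_real z ^ n) sums (polylog z (to_xword 1 w) / (1 - of_real z))"
proof -
  have r: "ereal (norm (of_real z :: complex)) < fps_conv_radius (Abs_fps (hsum w))"
    using z by (intro less_le_trans[OF _ hsum_conv_radius[OF N w]]) simp
  have "polylog z (to_xword 1 w) = (1 - of_real z) * eval_fps (Abs_fps (hsum w)) (of_real z)"
  proof -
    have X: "fps_conv_radius (1 - fps_X :: complex fps) = \<infinity>"
      using fps_conv_radius_diff[of "1 :: complex fps" fps_X] by simp
    have "polylog_fps (to_xword 1 w) = (1 - fps_X) * Abs_fps (hsum w)"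
      using yletters_props[OF N w] by (intro polylog_fps_to_xword_hsum) blast
    then show ?thesis
      unfolding polylog_def using r X by (simp add: eval_fps_mult eval_fps_diff)
  qed
  moreover have "1 - complex_of_real z \<noteq> 0" using z by (metis of_real_1 of_real_diff of_real_eq_0_iff diff_gt_0_iff_gt less_irrefl)
  ultimately have "eval_fps (Abs_fps (hsum w)) (of_real z) = polylog z (to_xword 1 w) / (1 - of_real z)" by simp
  then show ?thesis using sums_eval_fps[OF r] by simp
qed

lemma shuffle_words_replicate_one:
  "shuffle_words [1] (replicate i 1) = nc_scale (of_nat (Suc i)) (word_poly (replicate (Suc i) 1))"
  by (induction i) (simp_all add: letter_mult_add letter_mult_nc_scale nc_scale_of_nat_Suc del: of_nat_Suc)

text \<open>Shuffling \<open>1\<close> into a power of itself gives the same word from every slot,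
  hence the factor \<open>i + 1\<close> and the factorial.\<close>

lemma polylog_replicate_one:
  assumes z: "0 < z" "z < 1"
  shows "polylog z (replicate i 1) = polylog z [1] ^ i / fact i"
proof (induction i)
  case 0
  then show ?case by (simp add: polylog_def)
next
  case (Suc i)
  have "lin_ext (polylog z) (shuffle_words [1] (replicate i 1)) = polylog z [1] * polylog z (replicate i 1)"
    by (rule polylog_shuffle[OF _ _ _ z]) auto
  then have "of_nat (Suc i) * polylog z (replicate (Suc i) 1) = polylog z [1] * polylog z (replicate i 1)"
    by (simp only: shuffle_words_replicate_one lin_ext_nc_scale lin_ext_word_poly of_rat_of_nat_eq)
  then have "polylog z (replicate (Suc i) 1) = polylog z [1] * polylog z (replicate i 1) / of_nat (Suc i)"
    using of_nat_neq_0[of i, where ?'a = complex] by (metis nonzero_mult_div_cancel_left)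
  then show ?case by (simp add: Suc)
qed

lemma polylog_fps_one_nth: "fps_nth (polylog_fps [1]) n = 1 / of_nat n"
  by (cases n) (simp_all add: omega_def)

lemma polylog_one:
  assumes z: "0 < z" "z < 1"
  shows "polylog z [1] = of_real (- ln (1 - z))"
proof -
  have "(\<lambda>n. - ((- (- of_real z)) ^ n) / of_nat n) sums ln (1 + (- of_real z :: complex))"
    by (rule Ln_series') (use z in simp)
  then have "(\<lambda>n. - (- ((- (- of_real z)) ^ n) / of_nat n)) sums (- ln (1 + (- of_real z :: complex)))"
    by (rule sums_minus)
  then have "(\<lambda>n. fps_nth (polylog_fps [1]) n * of_real z ^ n) sums (- ln (1 + (- of_real z :: complex)))"
    unfolding polylog_fps_one_nth by simp
  moreover have "(\<lambda>n. fps_nth (polylog_fps [1]) n * of_real z ^ n) sums polylog z [1]"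
    by (rule polylog_sums) (use z in auto)
  ultimately have "polylog z [1] = - ln (1 - of_real z)" using sums_unique2 by fastforce
  also have "(1 - of_real z :: complex) = of_real (1 - z)" by simp
  also have "ln (of_real (1 - z) :: complex) = of_real (ln (1 - z))" by (rule Ln_of_real) (use z in simp)
  finally show ?thesis by simp
qed

lemma norm_polylog_one:
  assumes z: "0 < z" "z < 1"
  shows "norm (polylog z [1]) = - ln (1 - z)"
  using assms by (simp add: polylog_one)

lemma eventually_at_left_1: "eventually (\<lambda>z :: real. 1 / 2 < z \<and> z < 1) (at_left 1)"
  using eventually_at_left_real[of "1 / 2" "1 :: real"] by simp

lemma filterlim_norm_polylog_one: "filterlim (\<lambda>z. norm (polylog z [1])) at_top (at_left 1)"
proof -
  have "filterlim (\<lambda>z :: real. 1 - z) (at_right 0) (at_left 1)"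
    by (auto simp: filterlim_at eventually_at_filter intro!: tendsto_eq_intros)
  from filterlim_compose[OF ln_at_0 this]
  have "filterlim (\<lambda>z :: real. - ln (1 - z)) at_top (at_left 1)"
    by (simp add: filterlim_uminus_at_top)
  then show ?thesis
    by (rule filterlim_mono_eventually[OF _ order_refl order_refl])
      (use eventually_at_left_1 in eventually_elim, simp add: norm_polylog_one)
qed

text \<open>
  By the inequality of arithmetic and geometric means,
  \<open>1 / sqrt (n + 1) \<le> (t + 1 / (t (n + 1))) / 2\<close>; the choice \<open>t = sqrt (1 - z)\<close> makes both parts small.
\<close>

lemma abel_mean_bound:
  assumes C: "C \<ge> 0" and f: "\<And>n. norm (f n) \<le> C / sqrt (real (Suc n))"
    and z: "1 / 2 < z" "z < 1" and S: "(\<lambda>n. f n * of_real z ^ n :: complex) sums S"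
  shows "norm ((1 - of_real z) * S) \<le> 8 * C * exp (- (1 / 4) * norm (polylog z [1]))"
proof -
  define t L where "t = sqrt (1 - z)" and "L = norm (polylog z [1])"
  have t: "t > 0" "t * t = 1 - z" using z by (auto simp: t_def)
  have L: "L = - ln (1 - z)" unfolding L_def using z by (intro norm_polylog_one) auto
  have "L \<ge> 0" by (simp add: L_def)
  have texp: "t = exp (- (1 / 2) * L)"
    using z by (simp add: t_def L ln_sqrt[symmetric])
  have geo: "(\<lambda>n. z ^ n) sums (1 / (1 - z))" using z by (intro geometric_sums) auto
  have "(\<lambda>n. fps_nth (polylog_fps [1]) n * of_real z ^ n) sums polylog z [1]"
    by (rule polylog_sums) (use z in auto)
  then have "(\<lambda>n. complex_of_real (z ^ n / real n)) sums complex_of_real L"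
    using z unfolding polylog_fps_one_nth by (simp add: polylog_one L)
  then have "(\<lambda>n. z ^ n / real n) sums L" unfolding sums_of_real_iff .
  then have "(\<lambda>n. z ^ Suc n / real (Suc n)) sums L" by (subst sums_Suc_iff) simp
  from sums_mult[OF this, of "1 / z"]
  have lg: "(\<lambda>n. z ^ n / real (Suc n)) sums (L / z)" using z by (simp del: of_nat_Suc)
  have G: "(\<lambda>n. C / 2 * (t * z ^ n + 1 / t * (z ^ n / real (Suc n)))) sums (C / 2 * (t * (1 / (1 - z)) + 1 / t * (L / z)))"
    by (intro sums_mult sums_add geo lg)
  have bound: "norm (f n * of_real z ^ n) \<le> C / 2 * (t * z ^ n + 1 / t * (z ^ n / real (Suc n)))" for n
  proof -
    define x where "x = 1 / sqrt (real (Suc n))"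
    have xx: "x * x = 1 / real (Suc n)" by (simp add: x_def)
    have "0 \<le> (t - x) * (t - x)" by simp
    then have "2 * (t * x) \<le> t * t + x * x" by (simp add: algebra_simps)
    then have "t * (2 * x) \<le> t * (t + 1 / t * (x * x))" using t(1) by (simp add: algebra_simps)
    then have "2 * x \<le> t + 1 / t * (x * x)" using t(1) by (simp only: mult_le_cancel_left_pos)
    then have "C / 2 * (2 * x) \<le> C / 2 * (t + 1 / t * (x * x))" using C by (intro mult_left_mono) auto
    moreover have "norm (f n) \<le> C / 2 * (2 * x)" using f[of n] by (simp add: x_def)
    ultimately have "norm (f n) \<le> C / 2 * (t + 1 / t * (1 / real (Suc n)))"
      unfolding xx by (rule order_trans[rotated])
    then have "norm (f n) * z ^ n \<le> C / 2 * (t + 1 / t * (1 / real (Suc n))) * z ^ n"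
      using z by (intro mult_right_mono) auto
    then show ?thesis using z by (simp add: norm_mult norm_power algebra_simps)
  qed
  have "norm S \<le> C / 2 * (t * (1 / (1 - z)) + 1 / t * (L / z))"
    unfolding sums_unique[OF S] sums_unique[OF G]
    by (rule norm_suminf_le[OF bound sums_summable[OF G]])
  moreover have "norm (1 - of_real z :: complex) = t * t"
    using norm_of_real[of "1 - z", where ?'a = complex] t(2) z by simp
  ultimately have "norm ((1 - of_real z) * S) \<le> (t * t) * (C / 2 * (t * (1 / (t * t)) + 1 / t * (L / z)))"
    unfolding norm_mult t(2) using z by (simp only: mult_left_mono)
  also have "\<dots> = C / 2 * (t * (1 + L / z))" using t(1) by (simp add: field_simps)
  \<comment> \<open>The factor \<open>L\<close> is absorbed by giving up half of the decay of
    \<open>t\<close>: 1 + 2 L is at most 16 (1 + L / 4).\<close>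
  also have "\<dots> \<le> C / 2 * (t * (16 * exp (L / 4)))"
  proof (intro mult_left_mono)
    have "L / z \<le> 2 * L"
      using divide_left_mono[of "1 / 2" z L] z \<open>L \<ge> 0\<close> by simp
    moreover have "1 + L / 4 \<le> exp (L / 4)" by (rule exp_ge_add_one_self)
    ultimately show "1 + L / z \<le> 16 * exp (L / 4)" using \<open>L \<ge> 0\<close> by argo
  qed (use C t in auto)
  also have "\<dots> = 8 * C * (exp (- (1 / 2) * L) * exp (L / 4))" by (simp add: texp)
  also have "\<dots> = 8 * C * exp (- (1 / 4) * L)" unfolding exp_add[symmetric] by simp
  finally show ?thesis by (simp add: L_def)
qed

section \<open>The shuffle regularization\<close>

definition shuffle_pow :: "nat \<Rightarrow> complex poly" where
  "shuffle_pow i = monom (1 / fact i) i"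

lemma poly_shuffle_pow: "poly (shuffle_pow i) x = x ^ i / fact i"
  by (simp add: shuffle_pow_def poly_monom)

lemma filterlim_polylog_one: "filterlim (\<lambda>z. polylog z [1]) at_infinity (at_left 1)"
  by (rule filterlim_norm_at_top_imp_at_infinity[OF filterlim_norm_polylog_one])

lemma to_xword_replicate_y1: "to_xword 1 (replicate i y1) = replicate i 1"
  by (induction i) (simp_all add: y1_def)

text \<open>\<open>hsum_expand\<close> is multiplied by \<open>z ^ n\<close> and summed over
  \<open>n\<close>. The powers of \<open>y1\<close> then give their polynomials in
  \<open>polylog z [1]\<close> exactly, so the whole error is the Abel mean of
  \<open>hsum_rem w n - reg_const w\<close>.\<close>

lemma polylog_asymp:
  assumes N: "N \<ge> 1" and w: "w \<in> lists (yletters N)"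
  shows "rapid_null (at_left 1) (\<lambda>z. polylog z [1]) (\<lambda>z. polylog z (to_xword 1 w)
    - poly (\<Sum>i\<le>lead y1 w. smult (reg_const (drop i w)) (shuffle_pow i)) (polylog z [1]))"
proof -
  obtain C where C: "C \<ge> 0" "\<And>n. norm (hsum_rem w n - reg_const w) \<le> C / sqrt (real (Suc n))"
    using fast_limit_hsum_rem[OF N w] by (auto simp: fast_limit_def)
  have "eventually (\<lambda>z. norm (polylog z (to_xword 1 w)
    - poly (\<Sum>i\<le>lead y1 w. smult (reg_const (drop i w)) (shuffle_pow i)) (polylog z [1]))
      \<le> 8 * C * exp (- (1 / 4) * norm (polylog z [1]))) (at_left 1)"
    using eventually_at_left_1
  proof eventually_elim
    case (elim z)
    then have z: "0 < z" "z < 1" "1 / 2 < z" by auto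
    have z1: "1 - complex_of_real z \<noteq> 0" using z by (metis of_real_1 of_real_diff of_real_eq_0_iff diff_gt_0_iff_gt less_irrefl)
    have pw: "(\<lambda>n. hsum (replicate i y1) n * of_real z ^ n) sums (polylog z [1] ^ i / fact i / (1 - of_real z))" for i
      using polylog_to_xword_sums[OF N replicate_y1 z(1,2), of i]
      by (simp add: to_xword_replicate_y1 polylog_replicate_one[OF z(1,2)])
    define Q where "Q = (\<Sum>i\<le>lead y1 w. reg_const (drop i w) * (polylog z [1] ^ i / fact i / (1 - of_real z)))"
    have "(\<lambda>n. hsum w n * of_real z ^ n
        - (\<Sum>i\<le>lead y1 w. reg_const (drop i w) * (hsum (replicate i y1) n * of_real z ^ n)))
      sums (polylog z (to_xword 1 w) / (1 - of_real z) - Q)"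
      unfolding Q_def by (intro sums_diff sums_sum sums_mult pw polylog_to_xword_sums[OF N w z(1,2)])
    moreover have "hsum w n * of_real z ^ n
        - (\<Sum>i\<le>lead y1 w. reg_const (drop i w) * (hsum (replicate i y1) n * of_real z ^ n))
        = (hsum_rem w n - reg_const w) * of_real z ^ n" for n
    proof -
      have "{..lead y1 w} = insert 0 {1..lead y1 w}" by auto
      then show ?thesis
        by (subst hsum_expand) (simp add: algebra_simps sum_distrib_left)
    qed
    ultimately have "(\<lambda>n. (hsum_rem w n - reg_const w) * of_real z ^ n) sums (polylog z (to_xword 1 w) / (1 - of_real z) - Q)"
      by simp
    from abel_mean_bound[OF C z(3,2) this]
    have "norm ((1 - of_real z) * (polylog z (to_xword 1 w) / (1 - of_real z) - Q))
       \<le> 8 * C * exp (- (1 / 4) * norm (polylog z [1]))" .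
    also have "(1 - of_real z) * (polylog z (to_xword 1 w) / (1 - of_real z) - Q)
      = polylog z (to_xword 1 w) - (1 - of_real z) * Q"
      using z1 by (simp add: right_diff_distrib)
    also have "(1 - of_real z) * Q = poly (\<Sum>i\<le>lead y1 w. smult (reg_const (drop i w)) (shuffle_pow i)) (polylog z [1])"
      using z1 by (simp add: Q_def poly_sum poly_shuffle_pow sum_distrib_left)
    finally show ?case .
  qed
  then show ?thesis
    by (intro rapid_null_exp[of _ _ "1 / 4" _ "8 * C"] filterlim_norm_polylog_one) simp_all
qed

section \<open>Roots, their quotients and their partial products\<close>

text \<open>Recursive counterpart of \<open>successive_quotients\<close>: \<open>c\<close> is the
  preceding entry, in step with the accumulator of \<open>to_xword\<close>. Likewise
  \<open>prods\<close> is the counterpart of \<open>partial_products\<close>.\<close>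

fun quots :: "complex \<Rightarrow> complex list \<Rightarrow> complex list" where
  "quots c [] = []"
| "quots c (x # xs) = x / c # quots x xs"

fun prods :: "complex \<Rightarrow> complex list \<Rightarrow> complex list" where
  "prods c [] = []"
| "prods c (x # xs) = c * x # prods (c * x) xs"

lemma length_quots [simp]: "length (quots c e) = length e"
  by (induction c e rule: quots.induct) auto

lemma length_prods [simp]: "length (prods c e) = length e"
  by (induction c e rule: prods.induct) auto

lemma nth_quots: "i < length e \<Longrightarrow> quots c e ! i = (if i = 0 then e ! 0 / c else e ! i / e ! (i - 1))"
proof (induction c e arbitrary: i rule: quots.induct)
  case (2 c x xs)
  then show ?case by (cases i) (auto simp: nth_Cons split: nat.splits)
qed simp

lemma nth_prods: "i < length e \<Longrightarrow> prods c e ! i = c * (\<Prod>j\<le>i. e ! j)"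
proof (induction c e arbitrary: i rule: prods.induct)
  case (2 c x xs)
  then show ?case by (cases i) (auto simp: prod.atMost_Suc_shift simp del: prod.atMost_Suc)
qed simp

lemma successive_quotients_eq: "successive_quotients e = quots 1 e"
  by (rule nth_equalityI) (auto simp: successive_quotients_def nth_quots)

lemma partial_products_eq: "partial_products e = prods 1 e"
  by (rule nth_equalityI) (auto simp: partial_products_def nth_prods)

lemma quots_prods: "c \<noteq> 0 \<Longrightarrow> 0 \<notin> set e \<Longrightarrow> quots c (prods c e) = e"
  by (induction c e rule: prods.induct) auto

lemma xword_eq_to_xword:
  "length s = length e \<Longrightarrow> c \<noteq> 0 \<Longrightarrow> 0 \<notin> set e \<Longrightarrow> xword s e = to_xword c (zip s (quots c e))"
proof (induction s e arbitrary: c rule: list_induct2)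
  case (Cons x s y e)
  have "xword s e = to_xword y (zip s (quots y e))" by (rule Cons.IH) (use Cons.prems in auto)
  then show ?case using Cons.prems by (simp add: xword_def)
qed (simp add: xword_def)

lemma roots_unity_mult: "x \<in> roots_unity N \<Longrightarrow> y \<in> roots_unity N \<Longrightarrow> x * y \<in> roots_unity N"
  by (simp add: roots_unity_def power_mult_distrib)

lemma roots_unity_divide: "x \<in> roots_unity N \<Longrightarrow> y \<in> roots_unity N \<Longrightarrow> x / y \<in> roots_unity N"
  by (simp add: roots_unity_def power_divide)

lemma zero_notin_roots_unity: "N \<ge> 1 \<Longrightarrow> 0 \<notin> roots_unity N"
  by (auto simp: roots_unity_def power_0_left)

lemma set_quots_subset: "c \<in> roots_unity N \<Longrightarrow> set e \<subseteq> roots_unity N \<Longrightarrow> set (quots c e) \<subseteq> roots_unity N"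
  by (induction c e rule: quots.induct) (auto intro: roots_unity_divide)

lemma hd_quots: "e \<noteq> [] \<Longrightarrow> hd (quots 1 e) = hd e"
  by (cases e) auto

lemma index_quots:
  assumes "cmzv_index N s e"
  shows "cmzv_index N s (quots 1 e)" "convergent_index N s e \<Longrightarrow> convergent_index N s (quots 1 e)"
proof -
  show "cmzv_index N s (quots 1 e)"
    using assms set_quots_subset[of 1 N e] by (auto simp: cmzv_index_def)
  then show "convergent_index N s (quots 1 e)" if "convergent_index N s e"
    using that hd_quots[of e] by (cases e) (auto simp: convergent_index_def cmzv_index_def)
qed

lemma xword_index_eq:
  assumes N: "N \<ge> 1" and "cmzv_index N s e"
  shows "xword s e = to_xword 1 (zip s (quots 1 e))"
  using assms zero_notin_roots_unity[OF N] by (intro xword_eq_to_xword) (auto simp: cmzv_index_def)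

text \<open>A word is cut into blocks of zeros closed by a root. Prefixing \<open>0\<close>
  lengthens the first block, which exists because the word does not end in \<open>0\<close>.\<close>

lemma xword_surj:
  assumes N: "N \<ge> 1" and "w \<in> xwords N"
  shows "\<exists>s e. cmzv_index N s e \<and> w = xword s e"
  using assms(2)
proof (induction w)
  case Nil
  have "cmzv_index N [] [] \<and> [] = xword [] []" by (simp add: cmzv_index_def xword_def)
  then show ?case by blast
next
  case (Cons a w)
  obtain s e where se: "cmzv_index N s e" "w = xword s e" using Cons.IH xwords_tl[OF Cons.prems] by blast
  show ?case
  proof (cases "a = 0")
    case False
    then have "cmzv_index N (1 # s) (a # e) \<and> a # w = xword (1 # s) (a # e)"
      using Cons.prems se by (auto simp: cmzv_index_def xword_def xwords_def)
    then show ?thesis by blast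
  next
    case True
    then have "w \<noteq> []" using Cons.prems by (auto simp: xwords_def)
    then obtain m s' b e' where s: "s = m # s'" "e = b # e'"
      using se by (cases s; cases e) (auto simp: cmzv_index_def xword_def)
    then obtain k where "m = Suc k" using se(1) by (cases m) (auto simp: cmzv_index_def)
    then have "cmzv_index N (Suc m # s') e \<and> a # w = xword (Suc m # s') e"
      using se True s by (auto simp: cmzv_index_def xword_def)
    then show ?thesis by blast
  qed
qed

lemma lead_0_convergent:
  assumes "cmzv_index N s e" "lead 1 (xword s e) = 0"
  shows "convergent_index N s e"
  using assms by (cases s; cases e) (auto simp: convergent_index_def cmzv_index_def xword_def)

lemma xwords_norm: "N \<ge> 1 \<Longrightarrow> w \<in> xwords N \<Longrightarrow> a \<in> set w \<Longrightarrow> norm a \<le> 1"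
  using norm_roots_unity[of N a] by (auto simp: xwords_def)

lemma reg_const_convergent:
  assumes "N \<ge> 1" "convergent_index N s e"
  shows "reg_const (zip s e) = cmzv s e" "lead y1 (zip s e) = 0"
proof -
  have ix: "cmzv_index N s e" using assms(2) by (simp add: convergent_index_def)
  show l: "lead y1 (zip s e) = 0" by (rule index_yword(2)[OF ix assms(2)])
  have "hsum_rem (zip s e) = hsum (zip s e)"
    using hsum_expand[of "zip s e"] l by auto
  then show "reg_const (zip s e) = cmzv s e" by (simp add: reg_const_def cmzv_eq_lim_hsum[OF ix])
qed

lemma shuffle_regularization_exists:
  assumes N: "N \<ge> 1"
  obtains f where "shuffle_regularization N f"
    "\<And>w. w \<in> lists (yletters N) \<Longrightarrow> f (word_poly (to_xword 1 w)) = (\<Sum>i\<le>lead y1 w. smult (reg_const (drop i w)) (shuffle_pow i))"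
proof -
  obtain f where f: "algebra_hom_on {p. Poly_Mapping.keys p \<subseteq> xwords N} shuffle_prod f"
    "\<And>w P. rapid_null (at_left 1) (\<lambda>z. polylog z [1]) (\<lambda>z. polylog z w - poly P (polylog z [1])) \<Longrightarrow> f (word_poly w) = P"
  proof (rule regularization_exists[where F = "at_left (1 :: real)" and h = "\<lambda>z. polylog z [1]" and \<Phi> = polylog
        and G = "xwords N" and M = shuffle_prod])
    show "\<exists>P. rapid_null (at_left 1) (\<lambda>z. polylog z [1]) (\<lambda>z. polylog z w - poly P (polylog z [1]))"
      if w: "w \<in> xwords N" for w
    proof -
      obtain s e where se: "cmzv_index N s e" "w = xword s e" using xword_surj[OF N w] by blast
      show ?thesis
        using polylog_asymp[OF N index_yword(1)[OF index_quots(1)[OF se(1)]]]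
        unfolding se(2) xword_index_eq[OF N se(1)] by blast
    qed
    show "eventually (\<lambda>z. lin_ext (polylog z) (shuffle_prod p q) = lin_ext (polylog z) p * lin_ext (polylog z) q) (at_left 1)"
      if "Poly_Mapping.keys p \<subseteq> xwords N" "Poly_Mapping.keys q \<subseteq> xwords N" for p q
      using eventually_at_left_1
    proof eventually_elim
      case (elim z)
      have "lin_ext (polylog z) (shuffle_words u v) = polylog z u * polylog z v"
        if "u \<in> xwords N" "v \<in> xwords N" for u v
        by (rule polylog_shuffle) (use that elim xwords_norm[OF N] in \<open>auto simp: xwords_def\<close>)
      then show ?case
        unfolding shuffle_prod_def by (intro lin_ext_bilinear_ext) (use that in blast)
    qed
    show "filterlim (\<lambda>z. polylog z [1]) at_infinity (at_left 1)" by (rule filterlim_polylog_one)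
    show "polylog z [] = 1" for z by (simp add: polylog_def)
  qed (simp, blast)
  have val: "f (word_poly (to_xword 1 w)) = (\<Sum>i\<le>lead y1 w. smult (reg_const (drop i w)) (shuffle_pow i))"
    if w: "w \<in> lists (yletters N)" for w
    by (rule f(2)[OF polylog_asymp[OF N w]])
  have "shuffle_regularization N f"
    unfolding shuffle_regularization_def A1x_eq
  proof (intro conjI allI impI f(1))
    show "f (word_poly (xword s e)) = [:cmzv s (successive_quotients e):]" if "convergent_index N s e" for s e
    proof -
      have ix: "cmzv_index N s e" using that by (simp add: convergent_index_def)
      show ?thesis
        using reg_const_convergent[OF N index_quots(2)[OF ix that]]
        by (simp add: xword_index_eq[OF N ix] val index_yword(1)[OF index_quots(1)[OF ix]]
            successive_quotients_eq shuffle_pow_def)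
    qed
    show "f (word_poly [1]) = [:0, 1:]" by (intro f(2)) simp
  qed
  then show thesis using val that by blast
qed

text \<open>Uniqueness again transfers the values: a word without leading \<open>1\<close> comes
  from a convergent index, where every regularization is prescribed.\<close>

lemma shuffle_reg_map_expand:
  assumes N: "N \<ge> 1" and w: "w \<in> lists (yletters N)"
  shows "shuffle_reg_map N (word_poly (to_xword 1 w)) = (\<Sum>i\<le>lead y1 w. smult (reg_const (drop i w)) (shuffle_pow i))"
proof -
  obtain f where f: "shuffle_regularization N f"
    "\<And>w. w \<in> lists (yletters N) \<Longrightarrow> f (word_poly (to_xword 1 w)) = (\<Sum>i\<le>lead y1 w. smult (reg_const (drop i w)) (shuffle_pow i))"
    by (rule shuffle_regularization_exists[OF N]) (erule that, blast)
  have g: "shuffle_regularization N (shuffle_reg_map N)"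
    unfolding shuffle_reg_map_def using someI[of "shuffle_regularization N" f] f(1) .
  have to_xword_in: "to_xword c v \<in> xwords N" if "c \<in> roots_unity N" "v \<in> lists (yletters N)" for c v
    using that
  proof (induction c v rule: to_xword.induct)
    case (2 c m \<eta> v)
    have c: "c * \<eta> \<in> roots_unity N" using 2 by (auto simp: yletters_def intro: roots_unity_mult)
    then have "c * \<eta> \<noteq> 0" using zero_notin_roots_unity[OF N] by metis
    then show ?case using 2 c by (auto simp: xwords_def split: if_splits)
  qed (simp add: xwords_def)
  have "shuffle_reg_map N (word_poly (to_xword 1 w)) = f (word_poly (to_xword 1 w))"
  proof (rule algebra_hom_on_unique[OF _ _ leading_letter_law_shuffle])
    fix u assume u: "u \<in> xwords N" "lead 1 u = 0"
    obtain s e where se: "cmzv_index N s e" "u = xword s e" using xword_surj[OF N u(1)] by blast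
    then have "convergent_index N s e" using lead_0_convergent u(2) by blast
    then show "shuffle_reg_map N (word_poly u) = f (word_poly u)"
      using f(1) g se(2) unfolding shuffle_regularization_def by metis
  next
    show "to_xword 1 w \<in> xwords N" using w by (intro to_xword_in) auto
  qed (use f(1) g in \<open>auto simp: shuffle_regularization_def A1x_eq\<close>)
  then show ?thesis using f(2)[OF w] by simp
qed

lemma zeta_stuffle_expand:
  assumes "N \<ge> 1" "cmzv_index N s e"
  shows "zeta_stuffle N s e = (\<Sum>i\<le>lead y1 (zip s e). smult (reg_const (drop i (zip s e))) (stuffle_pow i))"
  unfolding zeta_stuffle_def by (rule stuffle_reg_map_expand[OF assms(1) index_yword(1)[OF assms(2)]])

text \<open>The partial products in the definition of the shuffle values are those that
  \<open>to_xword\<close> forms from \<open>zip s e\<close>, so the same word, and with it the same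
  constants, occur as on the stuffle side.\<close>

lemma zeta_shuffle_expand:
  assumes N: "N \<ge> 1" and ix: "cmzv_index N s e"
  shows "zeta_shuffle N s e = (\<Sum>i\<le>lead y1 (zip s e). smult (reg_const (drop i (zip s e))) (shuffle_pow i))"
proof -
  have e: "length s = length e" "0 \<notin> set e" "set e \<subseteq> roots_unity N"
    using ix zero_notin_roots_unity[OF N] by (auto simp: cmzv_index_def)
  have "set (prods c e) \<subseteq> roots_unity N" if "c \<in> roots_unity N" "set e \<subseteq> roots_unity N" for c e
    using that by (induction c e rule: prods.induct) (auto intro: roots_unity_mult)
  from this[of 1 e] have "0 \<notin> set (prods 1 e)" using e(3) zero_notin_roots_unity[OF N] by auto
  then have "xword s (partial_products e) = to_xword 1 (zip s e)"
    using xword_eq_to_xword[of s "prods 1 e" 1] e by (simp add: partial_products_eq quots_prods)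
  then show ?thesis
    unfolding zeta_shuffle_def using shuffle_reg_map_expand[OF N index_yword(1)[OF ix]] by simp
qed

section \<open>Alternating convolutions and the sine product\<close>

text \<open>The coefficient of u^r in F(-u) F(u), where F is the generating series of
  \<open>f\<close>.\<close>

definition alt_conv :: "(nat \<Rightarrow> 'a :: comm_ring_1) \<Rightarrow> nat \<Rightarrow> 'a" where
  "alt_conv f r = (\<Sum>i\<le>r. (- 1) ^ i * f i * f (r - i))"

text \<open>The elementary symmetric polynomial of degree \<open>i\<close> in 1, 1/2, ..., 1/n; its
  generating polynomial is the product of the factors 1 + u / k.\<close>

definition elem_sym :: "nat \<Rightarrow> nat \<Rightarrow> complex" where
  "elem_sym n i = hsum (replicate i y1) n"

lemma alt_conv_fps:
  "fps_nth (Abs_fps (\<lambda>i. (- 1) ^ i * f i) * Abs_fps f) r = alt_conv f r"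
  by (simp add: fps_mult_nth alt_conv_def atLeast0AtMost)

lemma fps_nth_mult_linear:
  "fps_nth (A * (1 + fps_const a * fps_X)) n
     = fps_nth A n + (if n = 0 then 0 else (a :: complex) * fps_nth A (n - 1))"
proof -
  have "A * (1 + fps_const a * fps_X) = A + fps_const a * (A * fps_X)"
    by (simp only: distrib_left mult_1_right mult.left_commute)
  then show ?thesis by simp
qed

lemma elem_sym_0: "elem_sym n 0 = 1"
  by (simp add: elem_sym_def)

lemma elem_sym_Suc_Suc: "elem_sym (Suc n) (Suc i) = elem_sym n (Suc i) + 1 / of_nat (Suc n) * elem_sym n i"
  by (simp add: elem_sym_def hsum_Suc y1_def del: of_nat_Suc)

lemma elem_sym_Suc:
  "Abs_fps (elem_sym (Suc n)) = Abs_fps (elem_sym n) * (1 + fps_const (1 / of_nat (Suc n)) * fps_X)"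
proof (rule fps_ext)
  fix i show "fps_nth (Abs_fps (elem_sym (Suc n))) i
      = fps_nth (Abs_fps (elem_sym n) * (1 + fps_const (1 / of_nat (Suc n)) * fps_X)) i"
    unfolding fps_nth_mult_linear by (cases i) (simp_all add: elem_sym_0 elem_sym_Suc_Suc del: of_nat_Suc)
qed

lemma elem_sym_Suc':
  "Abs_fps (\<lambda>i. (- 1) ^ i * elem_sym (Suc n) i)
     = Abs_fps (\<lambda>i. (- 1) ^ i * elem_sym n i) * (1 + fps_const (- (1 / of_nat (Suc n))) * fps_X)"
proof (rule fps_ext)
  fix i show "fps_nth (Abs_fps (\<lambda>i. (- 1) ^ i * elem_sym (Suc n) i)) i
      = fps_nth (Abs_fps (\<lambda>i. (- 1) ^ i * elem_sym n i) * (1 + fps_const (- (1 / of_nat (Suc n))) * fps_X)) i"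
    unfolding fps_nth_mult_linear
    by (cases i) (simp_all add: elem_sym_0 elem_sym_Suc_Suc distrib_left del: of_nat_Suc)
qed

section \<open>Euler's product for the sine\<close>

definition sin_partial :: "nat \<Rightarrow> complex fps" where
  "sin_partial n = (\<Prod>k=1..n. 1 - fps_const (1 / of_nat k ^ 2) * fps_X ^ 2)"

lemma sin_partial_Suc:
  "sin_partial (Suc n) = sin_partial n * (1 - fps_const (1 / of_nat (Suc n) ^ 2) * fps_X ^ 2)"
  by (simp add: sin_partial_def mult.commute)

lemma sin_partial_eq:
  "sin_partial n = Abs_fps (\<lambda>i. (- 1) ^ i * elem_sym n i) * Abs_fps (elem_sym n)"
proof (induction n)
  case 0
  have "Abs_fps (elem_sym 0) = 1"
    by (rule fps_ext, case_tac n) (simp_all add: elem_sym_def)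
  moreover have "Abs_fps (\<lambda>i. (- 1) ^ i * elem_sym 0 i) = 1"
    by (rule fps_ext, case_tac n) (simp_all add: elem_sym_def)
  ultimately show ?case by (simp add: sin_partial_def)
next
  case (Suc n)
  define c where "c = fps_const (1 / of_nat (Suc n) :: complex)"
  have c2: "fps_const (1 / of_nat (Suc n) ^ 2 :: complex) = c ^ 2"
    by (simp only: c_def fps_const_power power_one_over)
  show ?case
    unfolding sin_partial_Suc elem_sym_Suc elem_sym_Suc' Suc c2 c_def[symmetric] fps_const_neg[symmetric]
    by (simp only: algebra_simps power2_eq_square mult_1_left mult_1_right) simp
qed

lemma sin_partial_nth: "fps_nth (sin_partial n) r = alt_conv (elem_sym n) r"
  unfolding sin_partial_eq alt_conv_fps ..

lemma sin_partial_Suc_nth: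
  "fps_nth (sin_partial (Suc n)) r = fps_nth (sin_partial n) r
     - (if r < 2 then 0 else fps_nth (sin_partial n) (r - 2) / of_nat (Suc n) ^ 2)"
proof -
  have "sin_partial (Suc n) = sin_partial n - fps_const (1 / of_nat (Suc n) ^ 2) * (sin_partial n * fps_X ^ 2)"
    unfolding sin_partial_Suc by (simp add: algebra_simps)
  then show ?thesis by (simp add: fps_X_power_mult_right_nth)
qed

lemma prod_one_plus_inverse_squares_le: "(\<Prod>k=1..n. 1 + 1 / real k ^ 2) \<le> exp (pi ^ 2 / 6)"
proof -
  have sums: "(\<lambda>k. 1 / (real k + 1) ^ 2) sums (pi ^ 2 / 6)"
    using inverse_squares_sums by (simp add: add.commute)
  have "(\<Prod>k=1..n. 1 + 1 / real k ^ 2) \<le> (\<Prod>k=1..n. exp (1 / real k ^ 2))"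
    by (intro prod_mono conjI) (simp_all add: exp_ge_add_one_self)
  also have "\<dots> = exp (\<Sum>k=1..n. 1 / real k ^ 2)" by (simp add: exp_sum)
  also have "(\<Sum>k=1..n. 1 / real k ^ 2) = (\<Sum>k<n. 1 / (real k + 1) ^ 2)"
    by (simp add: sum.atLeast1_atMost_eq add.commute)
  also have "\<dots> \<le> suminf (\<lambda>k. 1 / (real k + 1) ^ 2)"
    by (rule sum_le_suminf[OF sums_summable[OF sums]]) auto
  also have "\<dots> = pi ^ 2 / 6"
    by (rule sums_unique[OF sums, symmetric])
  finally show ?thesis by simp
qed

text \<open>The coefficients are dominated by those of the product of 1 + u^2 / k^2, whose value at
  u = 1 is at most exp (pi^2 / 6) because 1 + x \<le> exp x. Tannery's theorem asks for a bound
  uniform in \<open>n\<close>.\<close>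

lemma sin_partial_bound: "norm (fps_nth (sin_partial n) r) \<le> exp (pi ^ 2 / 6)"
proof -
  define B where "B = (\<lambda>n. \<Prod>k=1..n. 1 + 1 / real k ^ 2)"
  have "norm (fps_nth (sin_partial n) r) \<le> B n"
  proof (induction n arbitrary: r)
    case 0
    then show ?case by (simp add: sin_partial_def B_def)
  next
    case (Suc n)
    have B: "B (Suc n) = B n + B n / real (Suc n) ^ 2" by (simp add: B_def algebra_simps)
    have "B n \<ge> 0" unfolding B_def by (intro prod_nonneg) simp
    then have "norm (if r < 2 then 0 else fps_nth (sin_partial n) (r - 2) / of_nat (Suc n) ^ 2) \<le> B n / real (Suc n) ^ 2"
      using Suc[of "r - 2"] by (simp add: norm_divide norm_power divide_right_mono del: of_nat_Suc)
    then show ?case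
      unfolding sin_partial_Suc_nth B using Suc[of r] by (intro order_trans[OF norm_triangle_ineq4] add_mono)
  qed
  also have "B n \<le> exp (pi ^ 2 / 6)"
    unfolding B_def by (rule prod_one_plus_inverse_squares_le)
  finally show ?thesis .
qed

text \<open>Existence and rate come from increments of size 1 / k^2; the value is identified in
  \<open>sin_partial_limit\<close>. The rate permits the comparison with polynomials in the harmonic
  number.\<close>

lemma sin_partial_fast_limit: "\<exists>c. fast_limit (\<lambda>n. fps_nth (sin_partial n) r) c"
proof -
  define K where "K = exp (pi ^ 2 / 6 :: real)"
  define f where "f = (\<lambda>k. fps_nth (sin_partial k) r - fps_nth (sin_partial (k - 1)) r)"
  have "norm (f k) \<le> K / (real k * sqrt (real k))" if k: "k \<ge> 1" for k
  proof -
    obtain j where j: "k = Suc j" using k by (cases k) auto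
    have "norm (f k) \<le> K / real k ^ 2"
      using sin_partial_bound[of j "r - 2"]
      by (simp add: K_def f_def j sin_partial_Suc_nth norm_divide norm_power divide_right_mono del: of_nat_Suc)
    also have "\<dots> \<le> K / (real k * sqrt (real k))"
    proof (intro divide_left_mono)
      have "sqrt (real k) \<le> sqrt (real k ^ 2)" unfolding real_sqrt_le_iff using k by (intro self_le_power) auto
      then show "real k * sqrt (real k) \<le> real k ^ 2" by (simp add: power2_eq_square mult_left_mono)
    qed (use k in \<open>auto simp: K_def\<close>)
    finally show ?thesis .
  qed
  then obtain c where c: "fast_limit (\<lambda>n. \<Sum>k=1..n. f k) c" using fast_limit_sum[of K f] by (auto simp: K_def)
  have "fps_nth (sin_partial n) r = fps_nth (sin_partial 0) r + (\<Sum>k=1..n. f k)" for n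
    by (induction n) (simp_all add: f_def)
  then have e: "(\<lambda>n. fps_nth (sin_partial n) r) = (\<lambda>n. fps_nth (sin_partial 0) r + (\<Sum>k=1..n. f k))"
    by (rule ext)
  have "fast_limit (\<lambda>n. fps_nth (sin_partial n) r) (fps_nth (sin_partial 0) r + c)"
    by (subst e) (rule fast_limit_add[OF fast_limit_const c])
  then show ?thesis ..
qed

definition sin_coeff_limit :: "nat \<Rightarrow> complex" where
  "sin_coeff_limit r = (if even r then (- 1) ^ (r div 2) * of_real pi ^ r / fact (Suc r) else 0)"

lemma eval_sin_partial:
  "fps_conv_radius (sin_partial n) = \<infinity> \<and> eval_fps (sin_partial n) x = (\<Prod>k=1..n. 1 - x ^ 2 / of_nat k ^ 2)"
proof (induction n)
  case (Suc n)
  define g where "g = (1 - fps_const (1 / of_nat (Suc n) ^ 2) * fps_X ^ 2 :: complex fps)"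
  have r: "fps_conv_radius (fps_const (1 / of_nat (Suc n) ^ 2) * fps_X ^ 2 :: complex fps) = \<infinity>"
    using fps_conv_radius_mult[of "fps_const (1 / of_nat (Suc n) ^ 2) :: complex fps" "fps_X ^ 2"] by simp
  then have g: "fps_conv_radius g = \<infinity>"
    using fps_conv_radius_diff[of 1 "fps_const (1 / of_nat (Suc n) ^ 2) * fps_X ^ 2 :: complex fps"]
    by (simp add: g_def)
  have "eval_fps g x = 1 - x ^ 2 / of_nat (Suc n) ^ 2"
    unfolding g_def using r by (simp add: eval_fps_diff eval_fps_mult del: of_nat_Suc)
  moreover have "fps_conv_radius (sin_partial n * g) = \<infinity>"
    using fps_conv_radius_mult[of "sin_partial n" g] g Suc by simp
  ultimately show ?case
    unfolding sin_partial_Suc g_def[symmetric] using g Suc by (simp add: eval_fps_mult mult.commute)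
qed (simp add: sin_partial_def)

text \<open>The limit series \<open>Q\<close> converges in the unit disc, where Tannery's theorem
  exchanges limit and sum and Euler's product identifies pi x Q(x) with sin (pi x). Equality of
  values near 0 then gives equality of coefficients.\<close>

lemma sin_partial_limit: "fast_limit (\<lambda>n. fps_nth (sin_partial n) r) (sin_coeff_limit r)"
proof -
  define q where "q = (\<lambda>r. lim (\<lambda>n. fps_nth (sin_partial n) r))"
  have q: "fast_limit (\<lambda>n. fps_nth (sin_partial n) r) (q r)" for r
    using sin_partial_fast_limit[of r] fast_limit_lim unfolding q_def by blast
  define Q where "Q = Abs_fps q"
  have "norm (q r) \<le> exp (pi ^ 2 / 6)" for r
    by (rule Lim_bounded[OF tendsto_norm[OF fast_limit_LIMSEQ[OF q]]]) (simp add: sin_partial_bound)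
  then have Qr: "fps_conv_radius Q \<ge> 1"
    by (intro fps_conv_radius_ge_1[of _ "exp (pi ^ 2 / 6)"])
      (simp add: Q_def order_trans[OF _ mult_left_mono[of 1, where c = "exp (pi ^ 2 / 6)"]])
  have ev: "of_real pi * x * eval_fps Q x = sin (of_real pi * x)" if x: "norm x < 1" for x :: complex
  proof -
    have "(\<lambda>n. suminf (\<lambda>k. fps_nth (sin_partial n) k * x ^ k)) \<longlonglongrightarrow> suminf (\<lambda>k. q k * x ^ k)"
    proof (rule conjunct2[OF conjunct2[OF tannerys_theorem[where M = "\<lambda>k. exp (pi ^ 2 / 6) * norm x ^ k"]]])
      show "(\<lambda>n. fps_nth (sin_partial n) k * x ^ k) \<longlonglongrightarrow> q k * x ^ k" for k
        by (intro tendsto_mult fast_limit_LIMSEQ[OF q] tendsto_const)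
      show "eventually (\<lambda>(k, n). norm (fps_nth (sin_partial n) k * x ^ k) \<le> exp (pi ^ 2 / 6) * norm x ^ k) (at_top \<times>\<^sub>F sequentially)"
        by (rule always_eventually) (auto simp: norm_mult norm_power intro!: mult_right_mono sin_partial_bound)
      show "summable (\<lambda>k. exp (pi ^ 2 / 6) * norm x ^ k)" using x by (intro summable_mult summable_geometric) simp
    qed simp
    then have "(\<lambda>n. eval_fps (sin_partial n) x) \<longlonglongrightarrow> eval_fps Q x"
      by (simp add: eval_fps_def Q_def)
    then have "(\<lambda>n. of_real pi * x * (\<Prod>k=1..n. 1 - x ^ 2 / of_nat k ^ 2)) \<longlonglongrightarrow> of_real pi * x * eval_fps Q x"
      using eval_sin_partial by (intro tendsto_mult tendsto_const) simp
    then show ?thesis using sin_product_formula_complex[of x] LIMSEQ_unique by blast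
  qed
  have "fps_const (of_real pi) * fps_X * Q = fps_sin (of_real pi)"
  proof (rule eval_fps_eqD)
    have r1: "fps_conv_radius (fps_const (of_real pi :: complex) * fps_X) = \<infinity>"
      using fps_conv_radius_mult[of "fps_const (of_real pi) :: complex fps" fps_X] by simp
    then have r2: "fps_conv_radius (fps_const (of_real pi) * fps_X * Q) \<ge> 1"
      using fps_conv_radius_mult[of "fps_const (of_real pi) * fps_X" Q] Qr by simp
    show "fps_conv_radius (fps_const (of_real pi) * fps_X * Q) > 0"
      by (rule less_le_trans[OF _ r2]) simp
    have "eventually (\<lambda>x :: complex. x \<in> ball 0 1) (nhds 0)"
      by (rule eventually_nhds_in_open) auto
    then show "eventually (\<lambda>x. eval_fps (fps_const (of_real pi) * fps_X * Q) x = eval_fps (fps_sin (of_real pi)) x) (nhds 0)"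
    proof eventually_elim
      case (elim x)
      then have x: "norm x < 1" by simp
      have "ereal (norm x) < 1" using x by simp
      then have "ereal (norm x) < fps_conv_radius Q" using Qr by (rule less_le_trans)
      then show ?case using ev[OF x] r1 by (simp add: eval_fps_mult)
    qed
  qed simp
  then have "fps_nth (fps_const (of_real pi) * fps_X * Q) (Suc r) = fps_nth (fps_sin (of_real pi)) (Suc r)" by simp
  then have "of_real pi * q r = fps_nth (fps_sin (of_real pi)) (Suc r)"
    by (simp add: Q_def mult.assoc)
  also have "\<dots> = of_real pi * sin_coeff_limit r"
    by (auto simp: sin_coeff_limit_def fps_sin_def algebra_simps)
  finally have "q r = sin_coeff_limit r" by (simp del: fact_Suc)
  then show ?thesis using q[of r] by simp
qed

text \<open>Both polynomials approximate the same coefficient of \<open>sin_partial n\<close>: the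
  left one because \<open>stuffle_pow i\<close> approximates \<open>elem_sym n i\<close>, the
  constant one because the coefficient converges. In particular all positive powers of
  \<open>T\<close> cancel.\<close>

lemma alt_conv_stuffle_pow: "alt_conv stuffle_pow r = [:sin_coeff_limit r:]"
proof (rule rapid_null_poly_unique[OF _ filterlim_hsum_y1])
  let ?h = "hsum [y1]"
  let ?g = "\<lambda>n. fps_nth (sin_partial n) r"
  show "rapid_null sequentially ?h (\<lambda>n. ?g n - poly [:sin_coeff_limit r:] (?h n))"
    using fast_limit_imp_rapid_null[OF sin_partial_limit[of r]] by simp
  define er where "er = (\<lambda>i n. elem_sym n i - poly (stuffle_pow i) (?h n))"
  have er: "rapid_null sequentially ?h (er i)" for i
    unfolding er_def elem_sym_def by (rule stuffle_pow_asymp)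
  have "rapid_null sequentially ?h (\<lambda>n. \<Sum>i\<le>r. (- 1) ^ i * (er i n * er (r - i) n
      + er i n * poly (stuffle_pow (r - i)) (?h n) + er (r - i) n * poly (stuffle_pow i) (?h n)))"
    by (intro rapid_null_sum rapid_null_cmult rapid_null_add rapid_null_mult_poly er rapid_null_mult_tendsto[OF er rapid_null_tendsto[OF er]])
  also have "(\<lambda>n. \<Sum>i\<le>r. (- 1) ^ i * (er i n * er (r - i) n
      + er i n * poly (stuffle_pow (r - i)) (?h n) + er (r - i) n * poly (stuffle_pow i) (?h n)))
     = (\<lambda>n. ?g n - poly (alt_conv stuffle_pow r) (?h n))"
  proof
    fix n
    have "?g n - poly (alt_conv stuffle_pow r) (?h n)
        = (\<Sum>i\<le>r. (- 1) ^ i * elem_sym n i * elem_sym n (r - i)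
            - (- 1) ^ i * poly (stuffle_pow i) (?h n) * poly (stuffle_pow (r - i)) (?h n))"
      by (simp only: sin_partial_nth alt_conv_def poly_sum poly_mult poly_power poly_minus poly_1 sum_subtractf)
    also have "\<dots> = (\<Sum>i\<le>r. (- 1) ^ i * (er i n * er (r - i) n
      + er i n * poly (stuffle_pow (r - i)) (?h n) + er (r - i) n * poly (stuffle_pow i) (?h n)))"
      by (rule sum.cong[OF refl]) (simp only: er_def algebra_simps)
    finally show "(\<Sum>i\<le>r. (- 1) ^ i * (er i n * er (r - i) n
      + er i n * poly (stuffle_pow (r - i)) (?h n) + er (r - i) n * poly (stuffle_pow i) (?h n)))
      = ?g n - poly (alt_conv stuffle_pow r) (?h n)" ..
  qed
  finally show "rapid_null sequentially ?h (\<lambda>n. ?g n - poly (alt_conv stuffle_pow r) (?h n))" .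
qed simp

text \<open>This is exp (- u T) exp (u T) = 1 in coefficients, or the binomial expansion of (1 -
  1)^r.\<close>

lemma alt_conv_shuffle_pow: "alt_conv shuffle_pow r = [:if r = 0 then 1 else 0:]"
proof -
  have c: "(\<Sum>i\<le>r. (- 1) ^ i / (fact i * fact (r - i)) :: complex) = (if r = 0 then 1 else 0)"
  proof (cases "r = 0")
    case False
    have "(\<Sum>i\<le>r. (- 1) ^ i / (fact i * fact (r - i)) :: complex) = (\<Sum>i\<le>r. (- 1) ^ i * of_nat (r choose i)) / fact r"
      by (simp add: sum_divide_distrib binomial_fact)
    then show ?thesis using choose_alternating_sum[of r, where ?'a = complex] False by simp
  qed simp
  have "(- 1) ^ i * shuffle_pow i * shuffle_pow (r - i) = monom ((- 1) ^ i / (fact i * fact (r - i))) r"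
    if "i \<le> r" for i
  proof -
    have "(- 1) ^ i * shuffle_pow i * shuffle_pow (r - i) = (- 1) ^ i * monom (1 / (fact i * fact (r - i))) r"
      using that by (simp add: shuffle_pow_def mult_monom mult.assoc)
    \<comment> \<open>The sign is a polynomial on one side and a scalar on the other; a case split
      on parity reconciles them.\<close>
    then show ?thesis by (cases "even i") (simp_all add: minus_monom)
  qed
  then have "alt_conv shuffle_pow r = monom (\<Sum>i\<le>r. (- 1) ^ i / (fact i * fact (r - i))) r"
    by (simp add: alt_conv_def monom_sum)
  then show ?thesis unfolding c by (simp add: monom_0)
qed

section \<open>Symmetrization\<close>

text \<open>Half-open, so that runs concatenate at any cut \<open>j\<close> between \<open>a\<close>
  and \<open>b\<close>, and the run with \<open>a = b\<close> is empty.\<close>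

definition y1_run :: "yletter list \<Rightarrow> nat \<Rightarrow> nat \<Rightarrow> bool" where
  "y1_run w a b \<longleftrightarrow> (\<forall>t. a \<le> t \<and> t < b \<longrightarrow> w ! t = y1)"

definition ycnj :: "yletter \<Rightarrow> yletter" where
  "ycnj a = (fst a, cnj (snd a))"

definition rev_prefix :: "yletter list \<Rightarrow> nat \<Rightarrow> yletter list" where
  "rev_prefix w j = rev (map ycnj (take j w))"

definition prefix_sign :: "yletter list \<Rightarrow> nat \<Rightarrow> complex" where
  "prefix_sign w j = (- 1) ^ sum_list (map fst (take j w)) * prod_list (map (cnj \<circ> snd) (take j w))"

lemma ycnj_eq_y1 [simp]: "ycnj a = y1 \<longleftrightarrow> a = y1"
  by (cases a) (auto simp: ycnj_def y1_def)

lemma le_lead_iff: "i \<le> lead l v \<longleftrightarrow> i \<le> length v \<and> (\<forall>t<i. v ! t = l)"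
proof (induction v arbitrary: i)
  case (Cons a v)
  then show ?case by (cases i) (auto simp: nth_Cons split: nat.splits)
qed auto

lemma y1_run_split: "a \<le> j \<Longrightarrow> j \<le> b \<Longrightarrow> y1_run w a b \<longleftrightarrow> y1_run w a j \<and> y1_run w j b"
  unfolding y1_run_def by (meson le_trans less_le_trans not_le)

text \<open>Stripping \<open>i\<close> letters \<open>y1\<close> behind the cut \<open>j\<close> is
  recorded by the end \<open>b = j + i\<close> of the stripped run. The word that remains is
  \<open>drop b w\<close>, independent of \<open>j\<close>.\<close>

lemma sum_lead_drop:
  assumes "j \<le> length w"
  shows "(\<Sum>i\<le>lead y1 (drop j w). f (drop i (drop j w)) i)
    = (\<Sum>b\<le>length w. if j \<le> b \<and> y1_run w j b then f (drop b w) (b - j) else 0)"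
proof -
  have "(\<Sum>i\<le>lead y1 (drop j w). f (drop i (drop j w)) i)
      = (\<Sum>b\<in>{b\<in>{..length w}. j \<le> b \<and> y1_run w j b}. f (drop b w) (b - j))"
  proof (rule sum.reindex_bij_witness[where i = "\<lambda>b. b - j" and j = "\<lambda>i. i + j"])
    fix i assume i: "i \<in> {..lead y1 (drop j w)}"
    then have "i \<le> length w - j" and *: "\<And>t. t < i \<Longrightarrow> w ! (j + t) = y1"
      using assms by (auto simp: le_lead_iff)
    moreover have "y1_run w j (i + j)"
      unfolding y1_run_def
    proof (intro allI impI)
      fix t assume t: "j \<le> t \<and> t < i + j"
      then have "t - j < i" by arith
      then show "w ! t = y1" using *[of "t - j"] t by simp
    qed
    ultimately show "i + j \<in> {b\<in>{..length w}. j \<le> b \<and> y1_run w j b}" using assms by auto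
  next
    fix b assume "b \<in> {b\<in>{..length w}. j \<le> b \<and> y1_run w j b}"
    then show "b - j \<in> {..lead y1 (drop j w)}"
      using assms by (auto simp: le_lead_iff y1_run_def)
  qed auto
  also have "\<dots> = (\<Sum>b\<le>length w. if j \<le> b \<and> y1_run w j b then f (drop b w) (b - j) else 0)"
    by (rule sum.inter_filter) simp
  finally show ?thesis .
qed

text \<open>Mirror image of \<open>sum_lead_drop\<close>: the prefix is read backwards, so stripping
  \<open>i\<close> letters moves its end from \<open>j\<close> to \<open>a = j - i\<close>.\<close>

lemma sum_lead_rev_prefix:
  assumes "j \<le> length w"
  shows "(\<Sum>i\<le>lead y1 (rev_prefix w j). f (drop i (rev_prefix w j)) i)
    = (\<Sum>a\<le>length w. if a \<le> j \<and> y1_run w a j then f (rev_prefix w a) (j - a) else 0)"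
proof -
  have len: "length (rev_prefix w j) = j" using assms by (simp add: rev_prefix_def)
  have nth: "rev_prefix w j ! t = y1 \<longleftrightarrow> w ! (j - Suc t) = y1" if "t < j" for t
    using that assms by (simp add: rev_prefix_def rev_nth)
  have drop: "drop (j - a) (rev_prefix w j) = rev_prefix w a" if "a \<le> j" for a
    using that assms by (simp add: rev_prefix_def drop_rev take_map min_absorb1)
  have iff: "j - a \<le> lead y1 (rev_prefix w j) \<longleftrightarrow> y1_run w a j" if a: "a \<le> j" for a
    unfolding le_lead_iff len y1_run_def
  proof safe
    fix t assume *: "\<forall>t<j - a. rev_prefix w j ! t = y1" "a \<le> t" "t < j"
    then have "rev_prefix w j ! (j - Suc t) = y1" using a by auto
    then show "w ! t = y1" using nth[of "j - Suc t"] * by auto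
  next
    fix t assume *: "\<forall>t. a \<le> t \<and> t < j \<longrightarrow> w ! t = y1" "t < j - a"
    then show "rev_prefix w j ! t = y1" using nth[of t] by auto
  qed simp
  have "(\<Sum>i\<le>lead y1 (rev_prefix w j). f (drop i (rev_prefix w j)) i)
      = (\<Sum>a\<in>{a\<in>{..length w}. a \<le> j \<and> y1_run w a j}. f (rev_prefix w a) (j - a))"
  proof (rule sum.reindex_bij_witness[where i = "\<lambda>a. j - a" and j = "\<lambda>i. j - i"])
    fix i assume i: "i \<in> {..lead y1 (rev_prefix w j)}"
    then have ij: "i \<le> j" using lead_le_length[of y1 "rev_prefix w j"] len by auto
    then show "j - (j - i) = i" by simp
    show "j - i \<in> {a\<in>{..length w}. a \<le> j \<and> y1_run w a j}"
      using i ij iff[of "j - i"] assms by auto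
    show "f (rev_prefix w (j - i)) (j - (j - i)) = f (drop i (rev_prefix w j)) i"
      using ij drop[of "j - i"] by simp
  qed (use iff in auto)
  also have "\<dots> = (\<Sum>a\<le>length w. if a \<le> j \<and> y1_run w a j then f (rev_prefix w a) (j - a) else 0)"
    by (rule sum.inter_filter) simp
  finally show ?thesis .
qed

text \<open>Each \<open>y1\<close> has first component 1 and root 1, so it contributes just a sign:
  the origin of the signs in \<open>alt_conv\<close>.\<close>

lemma prefix_sign_y1_run:
  assumes "a \<le> j" "j \<le> length w" "y1_run w a j"
  shows "prefix_sign w j = (- 1) ^ (j - a) * prefix_sign w a"
proof -
  have "take j w = take a w @ replicate (j - a) y1"
    using assms by (intro nth_equalityI) (auto simp: y1_run_def nth_append)
  then show ?thesis by (simp add: prefix_sign_def y1_def power_add sum_list_replicate mult_ac)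
qed

lemma smult_sum_right: "smult c (\<Sum>i\<in>I. f i) = (\<Sum>i\<in>I. smult c (f i))"
  by (induction I rule: infinite_finite_induct) (auto simp: smult_add_right)

text \<open>After both factors are expanded, a term is given by a \<le> j \<le> b with only letters
  \<open>y1\<close> from \<open>a\<close> up to \<open>b\<close>. Its constants depend on
  \<open>a\<close> and \<open>b\<close> alone, so for fixed ends the sum over the cut
  \<open>j\<close> is \<open>alt_conv p (b - a)\<close>. The family \<open>p\<close> is left open to
  cover both regularizations.\<close>

lemma symmetrized_poly_expand:
  assumes len: "length s = length e"
    and left: "\<And>j. j \<le> length s \<Longrightarrow> Z (rev (take j s)) (rev (map cnj (take j e)))
        = (\<Sum>i\<le>lead y1 (rev_prefix w j). smult (K (drop i (rev_prefix w j))) (p i))"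
    and right: "\<And>j. j \<le> length s \<Longrightarrow> Z (drop j s) (drop j e)
        = (\<Sum>i\<le>lead y1 (drop j w). smult (K (drop i (drop j w))) (p i))"
    and w: "w = zip s e"
  shows "symmetrized_poly Z s e = (\<Sum>a\<le>length s. \<Sum>b\<le>length s.
      if a \<le> b \<and> y1_run w a b
      then smult (prefix_sign w a * K (rev_prefix w a) * K (drop b w)) (alt_conv p (b - a)) else 0)"
proof -
  define d where "d = length s"
  have dw: "length w = d" using len by (simp add: w d_def)
  define X where "X = (\<lambda>a j b. smult (prefix_sign w a * K (rev_prefix w a) * K (drop b w))
      ((- 1) ^ (j - a) * p (j - a) * p (b - j)))"
  have sign: "(- 1) ^ sum_list (take j s) * prod_list (map cnj (take j e)) = prefix_sign w j" for j
    using len by (simp add: prefix_sign_def w take_zip flip: map_map)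
  have "symmetrized_poly Z s e = (\<Sum>j\<le>d. smult (prefix_sign w j)
     ((\<Sum>a\<le>d. if a \<le> j \<and> y1_run w a j then smult (K (rev_prefix w a)) (p (j - a)) else 0)
      * (\<Sum>b\<le>d. if j \<le> b \<and> y1_run w j b then smult (K (drop b w)) (p (b - j)) else 0)))"
    unfolding symmetrized_poly_def sign d_def[symmetric]
  proof (rule sum.cong[OF refl])
    fix j assume "j \<in> {..d}"
    then have j: "j \<le> length w" "j \<le> length s" by (auto simp: dw d_def)
    show "smult (prefix_sign w j) (Z (rev (take j s)) (rev (map cnj (take j e))) * Z (drop j s) (drop j e))
      = smult (prefix_sign w j)
     ((\<Sum>a\<le>d. if a \<le> j \<and> y1_run w a j then smult (K (rev_prefix w a)) (p (j - a)) else 0)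
      * (\<Sum>b\<le>d. if j \<le> b \<and> y1_run w j b then smult (K (drop b w)) (p (b - j)) else 0))"
      unfolding left[OF j(2)] right[OF j(2)]
      using sum_lead_rev_prefix[OF j(1), of "\<lambda>v i. smult (K v) (p i)"]
        sum_lead_drop[OF j(1), of "\<lambda>v i. smult (K v) (p i)"] by (simp add: dw)
  qed
  also have "\<dots> = (\<Sum>j\<le>d. \<Sum>a\<le>d. \<Sum>b\<le>d. if a \<le> j \<and> j \<le> b \<and> y1_run w a b then X a j b else 0)"
    unfolding sum_product smult_sum_right
  proof (intro sum.cong refl)
    fix j a b assume "j \<in> {..d}" "a \<in> {..d}" "b \<in> {..d}"
    then have jw: "j \<le> length w" by (simp add: dw)
    show "smult (prefix_sign w j)
       ((if a \<le> j \<and> y1_run w a j then smult (K (rev_prefix w a)) (p (j - a)) else 0)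
      * (if j \<le> b \<and> y1_run w j b then smult (K (drop b w)) (p (b - j)) else 0))
      = (if a \<le> j \<and> j \<le> b \<and> y1_run w a b then X a j b else 0)"
    proof (cases "a \<le> j \<and> j \<le> b \<and> y1_run w a b")
      case True
      then have "y1_run w a j" "y1_run w j b" using y1_run_split by blast+
      moreover have "prefix_sign w j = (- 1) ^ (j - a) * prefix_sign w a"
        using prefix_sign_y1_run[OF _ jw, of a] True calculation by simp
      \<comment> \<open>The sign is a complex scalar in \<open>prefix_sign_y1_run\<close> and a
        polynomial in \<open>X\<close>; parity reconciles the two.\<close>
      ultimately show ?thesis
        using True by (cases "even (j - a)") (simp_all add: X_def mult_ac)
    next
      case False
      then have "\<not> (a \<le> j \<and> y1_run w a j) \<or> \<not> (j \<le> b \<and> y1_run w j b)" using y1_run_split by blast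
      then show ?thesis using False by auto
    qed
  qed
  also have "\<dots> = (\<Sum>a\<le>d. \<Sum>b\<le>d. \<Sum>j\<le>d. if a \<le> j \<and> j \<le> b \<and> y1_run w a b then X a j b else 0)"
    by (subst sum.swap) (rule sum.cong[OF refl], rule sum.swap)
  also have "\<dots> = (\<Sum>a\<le>d. \<Sum>b\<le>d. if a \<le> b \<and> y1_run w a b
      then smult (prefix_sign w a * K (rev_prefix w a) * K (drop b w)) (alt_conv p (b - a)) else 0)"
  proof (intro sum.cong refl)
    fix a b assume "a \<in> {..d}" "b \<in> {..d}"
    show "(\<Sum>j\<le>d. if a \<le> j \<and> j \<le> b \<and> y1_run w a b then X a j b else 0)
      = (if a \<le> b \<and> y1_run w a b
      then smult (prefix_sign w a * K (rev_prefix w a) * K (drop b w)) (alt_conv p (b - a)) else 0)"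
    proof (cases "a \<le> b \<and> y1_run w a b")
      case True
      have "(\<Sum>j\<le>d. if a \<le> j \<and> j \<le> b \<and> y1_run w a b then X a j b else 0)
          = (\<Sum>j\<in>{j\<in>{..d}. a \<le> j \<and> j \<le> b}. X a j b)"
        using True by (subst sum.inter_filter) simp_all
      also have "\<dots> = (\<Sum>i\<le>b - a. X a (a + i) b)"
        by (rule sum.reindex_bij_witness[where i = "\<lambda>i. a + i" and j = "\<lambda>j. j - a"])
          (use True \<open>b \<in> {..d}\<close> in auto)
      also have "\<dots> = smult (prefix_sign w a * K (rev_prefix w a) * K (drop b w)) (alt_conv p (b - a))"
        by (simp add: X_def alt_conv_def smult_sum_right)
      finally show ?thesis using True by simp
    next
      case False
      then show ?thesis by (auto intro!: sum.neutral)
    qed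
  qed
  finally show ?thesis by (simp add: d_def)
qed

lemma rev_prefix_index:
  assumes "cmzv_index N s e"
  shows "cmzv_index N (rev (take j s)) (rev (map cnj (take j e)))" "cmzv_index N (drop j s) (drop j e)"
proof -
  have "cnj x \<in> roots_unity N" if "x \<in> roots_unity N" for x
    using that by (simp add: roots_unity_def flip: complex_cnj_power)
  then show "cmzv_index N (rev (take j s)) (rev (map cnj (take j e)))"
    using assms by (auto simp: cmzv_index_def dest!: in_set_takeD)
  show "cmzv_index N (drop j s) (drop j e)"
    using assms by (auto simp: cmzv_index_def dest!: in_set_dropD)
qed

lemma zip_rev_prefix:
  assumes "length s = length e"
  shows "zip (rev (take j s)) (rev (map cnj (take j e))) = rev_prefix (zip s e) j"
proof -
  have "zip (rev (take j s)) (rev (map cnj (take j e))) = rev (zip (take j s) (map cnj (take j e)))"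
    using assms by (intro zip_rev) simp
  also have "zip (take j s) (map cnj (take j e)) = map ycnj (take j (zip s e))"
    by (simp add: zip_map2 take_zip ycnj_def case_prod_beta)
  finally show ?thesis by (simp add: rev_prefix_def)
qed

text \<open>Constant convolutions make the whole symmetrized polynomial constant, which is its
  independence of \<open>T\<close> and gives the definite description in \<open>symmetrized\<close>
  its value.\<close>

lemma symmetrized_expand:
  assumes ix: "cmzv_index N s e" and w: "w = zip s e"
    and Z: "\<And>s e. cmzv_index N s e \<Longrightarrow>
        Z s e = (\<Sum>i\<le>lead y1 (zip s e). smult (reg_const (drop i (zip s e))) (p i))"
    and p: "\<And>r. alt_conv p r = [:q r:]"
  shows "symmetrized Z s e = (\<Sum>a\<le>length s. \<Sum>b\<le>length s.
      if a \<le> b \<and> y1_run w a b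
      then prefix_sign w a * reg_const (rev_prefix w a) * reg_const (drop b w) * q (b - a) else 0)"
proof -
  have len: "length s = length e" using ix by (simp add: cmzv_index_def)
  have "symmetrized_poly Z s e = (\<Sum>a\<le>length s. \<Sum>b\<le>length s.
      if a \<le> b \<and> y1_run w a b
      then smult (prefix_sign w a * reg_const (rev_prefix w a) * reg_const (drop b w)) (alt_conv p (b - a)) else 0)"
    by (rule symmetrized_poly_expand[OF len _ _ w])
      (simp_all add: Z rev_prefix_index[OF ix] zip_rev_prefix[OF len] w drop_zip)
  also have "\<dots> = (\<Sum>a\<le>length s. \<Sum>b\<le>length s.
      [:if a \<le> b \<and> y1_run w a b
      then prefix_sign w a * reg_const (rev_prefix w a) * reg_const (drop b w) * q (b - a) else 0:])"
    unfolding p by (intro sum.cong refl) simp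
  also have "\<dots> = [:\<Sum>a\<le>length s. \<Sum>b\<le>length s.
      if a \<le> b \<and> y1_run w a b
      then prefix_sign w a * reg_const (rev_prefix w a) * reg_const (drop b w) * q (b - a) else 0:]"
    by (rule poly_eqI) (simp add: coeff_sum coeff_pCons split: nat.split)
  finally show ?thesis unfolding symmetrized_def by simp
qed

section \<open>The ideal generated by zeta(2)\<close>

lemma zeta2_in_algebra: "of_real (pi\<^sup>2 / 6) \<in> cmzv_algebra N"
proof -
  have ix: "convergent_index N [2] [1]"
    by (simp add: convergent_index_def cmzv_index_def)
  have "(\<lambda>k. 1 / (real k + 1) ^ 2) sums (pi ^ 2 / 6)"
    using inverse_squares_sums by (simp add: add.commute)
  then have "(\<lambda>n. complex_of_real (\<Sum>k<n. 1 / (real k + 1) ^ 2)) \<longlonglongrightarrow> of_real (pi\<^sup>2 / 6)"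
    unfolding sums_def by (rule tendsto_of_real)
  moreover have "complex_of_real (\<Sum>k<n. 1 / (real k + 1) ^ 2) = cmzv_partial n [2] [1]" for n
    by (simp add: cmzv_partial_eq_hsum hsum.simps(2) sum.atLeast1_atMost_eq add.commute)
  ultimately have "cmzv [2] [1] = of_real (pi\<^sup>2 / 6)"
    unfolding cmzv_def by (simp only: limI)
  then show ?thesis using cmzv_algebra.zeta_value[OF ix] by (simp only:)
qed

lemma cmzv_algebra_power: "x \<in> cmzv_algebra N \<Longrightarrow> x ^ n \<in> cmzv_algebra N"
  by (induction n) (auto intro: cmzv_algebra_1 cmzv_algebra.mult)

lemma cmzv_algebra_prod_list:
  "(\<And>x. x \<in> set xs \<Longrightarrow> f x \<in> cmzv_algebra N) \<Longrightarrow> prod_list (map f xs) \<in> cmzv_algebra N"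
  by (induction xs) (auto intro: cmzv_algebra_1 cmzv_algebra.mult)

lemma zeta2_ideal_0: "0 \<in> zeta2_ideal N"
  unfolding zeta2_ideal_def using cmzv_algebra_0 by force

lemma zeta2_ideal_add: "x \<in> zeta2_ideal N \<Longrightarrow> y \<in> zeta2_ideal N \<Longrightarrow> x + y \<in> zeta2_ideal N"
  unfolding zeta2_ideal_def by (force simp: distrib_left[symmetric] intro: cmzv_algebra.add)

lemma zeta2_ideal_mult: "x \<in> zeta2_ideal N \<Longrightarrow> c \<in> cmzv_algebra N \<Longrightarrow> c * x \<in> zeta2_ideal N"
  unfolding zeta2_ideal_def by (force simp: mult.left_commute intro: cmzv_algebra.mult)

lemma zeta2_ideal_sum: "(\<And>i. i \<in> I \<Longrightarrow> f i \<in> zeta2_ideal N) \<Longrightarrow> sum f I \<in> zeta2_ideal N"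
  by (induction I rule: infinite_finite_induct) (auto intro: zeta2_ideal_add zeta2_ideal_0)

text \<open>For r = 2 m + 2 the power pi^r is a rational multiple of the power m + 1 of pi^2 / 6;
  one factor generates the ideal, the others stay in the algebra.\<close>

lemma sin_coeff_limit_in_ideal:
  assumes "r > 0" shows "sin_coeff_limit r \<in> zeta2_ideal N"
proof (cases "even r")
  case True
  then obtain m where m: "r = 2 * Suc m" using assms by (cases "r div 2") auto
  define z where "z = complex_of_real (pi\<^sup>2 / 6)"
  define c where "c = complex_of_rat ((- 1) ^ Suc m * 6 ^ Suc m / fact (Suc r))"
  have "of_real pi ^ r = 6 ^ Suc m * z ^ Suc m"
    unfolding m power_mult z_def power_mult_distrib[symmetric] by simp
  moreover have "complex_of_rat (fact (Suc r)) = fact (Suc r)"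
    by (metis of_nat_fact of_rat_of_nat_eq)
  ultimately have "sin_coeff_limit r = z * (c * z ^ m)"
    using True by (simp add: sin_coeff_limit_def c_def m of_rat_mult of_rat_divide of_rat_power of_rat_minus mult_ac
        del: fact_Suc)
  moreover have "c * z ^ m \<in> cmzv_algebra N"
    unfolding c_def z_def by (intro cmzv_algebra.mult cmzv_algebra_power zeta2_in_algebra cmzv_algebra_of_rat)
  ultimately show ?thesis unfolding zeta2_ideal_def z_def by blast
qed (simp add: sin_coeff_limit_def zeta2_ideal_0)

theorem theorem4p6:
  fixes N d :: nat and s :: "nat list" and e :: "complex list"
  assumes "N \<ge> 1" and "d \<ge> 1"
    and "length s = d" and "length e = d"
    and "\<forall>m\<in>set s. m \<ge> 1"
    and "set e \<subseteq> roots_unity N"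
  shows "zetaS_shuffle N s e - zetaS_stuffle N s e \<in> zeta2_ideal N"
proof -
  have ix: "cmzv_index N s e" using assms by (simp add: cmzv_index_def)
  define w where "w = zip s e"
  have w: "w \<in> lists (yletters N)" unfolding w_def by (rule index_yword(1)[OF ix])
  define c where "c = (\<lambda>a b. prefix_sign w a * reg_const (rev_prefix w a) * reg_const (drop b w))"
  have sh: "symmetrized (zeta_shuffle N) s e = (\<Sum>a\<le>length s. \<Sum>b\<le>length s.
      if a \<le> b \<and> y1_run w a b then c a b * (if b - a = 0 then 1 else 0) else 0)"
    unfolding c_def by (rule symmetrized_expand[OF ix w_def zeta_shuffle_expand[OF assms(1)] alt_conv_shuffle_pow])
  have st: "symmetrized (zeta_stuffle N) s e = (\<Sum>a\<le>length s. \<Sum>b\<le>length s.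
      if a \<le> b \<and> y1_run w a b then c a b * sin_coeff_limit (b - a) else 0)"
    unfolding c_def by (rule symmetrized_expand[OF ix w_def zeta_stuffle_expand[OF assms(1)] alt_conv_stuffle_pow])
  \<comment> \<open>Both expansions run over the same pairs with the same \<open>c a b\<close>.
    Since \<open>sin_coeff_limit 0 = 1\<close>, they can differ only where
    \<open>a < b\<close>.\<close>
  have "zetaS_shuffle N s e - zetaS_stuffle N s e = (\<Sum>a\<le>length s. \<Sum>b\<le>length s.
      if a \<le> b \<and> y1_run w a b then c a b * ((if b - a = 0 then 1 else 0) - sin_coeff_limit (b - a)) else 0)"
    unfolding zetaS_shuffle_def zetaS_stuffle_def sh st sum_subtractf[symmetric]
    by (intro sum.cong refl) (simp add: right_diff_distrib)
  also have "\<dots> \<in> zeta2_ideal N"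
  proof (intro zeta2_ideal_sum)
    fix a b
    have root: "prefix_sign w a \<in> cmzv_algebra N"
    proof -
      have "cnj (snd x) \<in> cmzv_algebra N" if "x \<in> set (take a w)" for x
        using w in_set_takeD[OF that]
        by (intro cmzv_algebra.scalar cyclotomic_field.root)
          (auto simp: yletters_def roots_unity_def in_lists_conv_set simp flip: complex_cnj_power)
      then have "prod_list (map (cnj \<circ> snd) (take a w)) \<in> cmzv_algebra N"
        by (intro cmzv_algebra_prod_list) simp
      moreover have "(- 1) ^ k \<in> cmzv_algebra N" for k
        using cmzv_algebra_power[OF cmzv_algebra_of_rat[of "- 1"]] by simp
      ultimately show ?thesis unfolding prefix_sign_def by (intro cmzv_algebra.mult)
    qed
    have "rev_prefix w a \<in> lists (yletters N)"
      using index_yword(1)[OF rev_prefix_index(1)[OF ix, of a]] zip_rev_prefix[of s e a] assms by (simp add: w_def)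
    moreover have "drop b w \<in> lists (yletters N)"
      using w by (auto simp: in_lists_conv_set dest: in_set_dropD)
    ultimately have c: "c a b \<in> cmzv_algebra N"
      unfolding c_def using root by (intro cmzv_algebra.mult reg_const_in_algebra[OF assms(1)])
    have q: "(if b - a = 0 then 1 else 0) - sin_coeff_limit (b - a) \<in> zeta2_ideal N"
    proof (cases "b - a = 0")
      case True
      then show ?thesis using zeta2_ideal_0 by (simp add: sin_coeff_limit_def)
    next
      case False
      then show ?thesis
        using zeta2_ideal_mult[OF sin_coeff_limit_in_ideal[of "b - a"] cmzv_algebra_of_rat[of "- 1"]] by simp
    qed
    show "(if a \<le> b \<and> y1_run w a b then c a b * ((if b - a = 0 then 1 else 0) - sin_coeff_limit (b - a)) else 0)
        \<in> zeta2_ideal N"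
      using zeta2_ideal_mult[OF q c] zeta2_ideal_0 by simp
  qed
  finally show ?thesis .
qed

end
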